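(* Let $p$ be a prime number, assume that $\mathbb{F}_p\subseteq R$ and that $R$ is noetherian as $R^G$-module, and let $P$ be a Sylow $p$-subgroup of $G$. Put $\mu=\inf\{r>0\mid H^r(G,R)\neq 0\}$ and $\mathcal{P}=\{P'\le P\mid \operatorname{height} I_R(P')\le\mu+1\}$. If $R$ and $R^G$ are both Cohen-Macaulay and $\mu<\infty$, then the restriction map $$\operatorname{res}^G_{\mathcal{P}}\colon H^{\mu}(G,R)\to\prod_{P'\in\mathcal{P}}H^{\mu}(P',R)$$ is injective.
   Context: $G$ is a finite group and $R$ is a commutative ring on which $G$ acts by ring automorphisms; $R^G$ is the subring of $G$-invariants. $H^*(G,R)$ is group cohomology with coefficients in the $G$-module $R$. For a subgroup $H\le G$, $I_R(H)$ is the ideal of $R$ generated by all elements $h(r)-r$ with $h\in H$, $r\in R$. The height of an ideal is the infimum of the heights of the prime ideals containing it, and $\inf\emptyset=\infty$ (so the unit ideal has height $\infty$). The map $\operatorname{res}^G_{\mathcal{P}}$ has as components the restriction maps $\operatorname{res}^G_{P'}$, $P'\in\mathcal{P}$. *)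

theory Defs
  imports "HOL-Algebra.Algebra" "HOL-Library.Extended_Nat" "HOL-Computational_Algebra.Primes"
begin

section \<open>Group cohomology via inhomogeneous cochains\<close>

text \<open>The coefficient module is the additive group of \<open>M\<close>, with \<open>G\<close> acting on it through \<open>\<phi>\<close>.
  An \<open>n\<close>-tuple of group elements is a list of length \<open>n\<close>.\<close>

definition tuples :: "('g, 'b) monoid_scheme \<Rightarrow> nat \<Rightarrow> 'g list set" where
  "tuples G n = {gs. length gs = n \<and> set gs \<subseteq> carrier G}"

definition cochains ::
    "('g, 'b) monoid_scheme \<Rightarrow> ('r, 'm) ring_scheme \<Rightarrow> nat \<Rightarrow> ('g list \<Rightarrow> 'r) monoid" where
  "cochains G M n =
     \<lparr>carrier = tuples G n \<rightarrow>\<^sub>E carrier M,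
      monoid.mult = (\<lambda>f f'. \<lambda>gs\<in>tuples G n. f gs \<oplus>\<^bsub>M\<^esub> f' gs),
      monoid.one = (\<lambda>gs\<in>tuples G n. \<zero>\<^bsub>M\<^esub>)\<rparr>"

text \<open>In the usual 1-based notation, on \<open>(g\<^sub>1, \<dots>, g\<^sub>n\<^sub>+\<^sub>1)\<close> the coboundary of \<open>f\<close> is
  \<open>g\<^sub>1 f(g\<^sub>2, \<dots>, g\<^sub>n\<^sub>+\<^sub>1) + \<Sum>\<^sub>1\<^sub>\<le>\<^sub>j\<^sub>\<le>\<^sub>n (-1)^j f(\<dots>, g\<^sub>j g\<^sub>j\<^sub>+\<^sub>1, \<dots>) + (-1)^(n+1) f(g\<^sub>1, \<dots>, g\<^sub>n)\<close>;
  below \<open>j = Suc i\<close>.\<close>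

definition coboundary ::
    "('g, 'b) monoid_scheme \<Rightarrow> ('r, 'm) ring_scheme \<Rightarrow> ('g \<Rightarrow> 'r \<Rightarrow> 'r) \<Rightarrow> nat \<Rightarrow>
     ('g list \<Rightarrow> 'r) \<Rightarrow> 'g list \<Rightarrow> 'r" where
  "coboundary G M \<phi> n f =
     (\<lambda>gs\<in>tuples G (Suc n).
        \<phi> (hd gs) (f (tl gs))
        \<oplus>\<^bsub>M\<^esub> (\<Oplus>\<^bsub>M\<^esub>i\<in>{..<n}. add_pow M ((-1 :: int) ^ Suc i)
               (f (take i gs @ (gs ! i \<otimes>\<^bsub>G\<^esub> gs ! Suc i) # drop (i + 2) gs)))
        \<oplus>\<^bsub>M\<^esub> add_pow M ((-1 :: int) ^ Suc n) (f (butlast gs)))"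

definition cocycles ::
    "('g, 'b) monoid_scheme \<Rightarrow> ('r, 'm) ring_scheme \<Rightarrow> ('g \<Rightarrow> 'r \<Rightarrow> 'r) \<Rightarrow> nat \<Rightarrow>
     ('g list \<Rightarrow> 'r) set" where
  "cocycles G M \<phi> n = kernel (cochains G M n) (cochains G M (Suc n)) (coboundary G M \<phi> n)"

fun coboundaries ::
    "('g, 'b) monoid_scheme \<Rightarrow> ('r, 'm) ring_scheme \<Rightarrow> ('g \<Rightarrow> 'r \<Rightarrow> 'r) \<Rightarrow> nat \<Rightarrow>
     ('g list \<Rightarrow> 'r) set" where
  "coboundaries G M \<phi> 0 = {\<one>\<^bsub>cochains G M 0\<^esub>}"
| "coboundaries G M \<phi> (Suc n) = coboundary G M \<phi> n ` carrier (cochains G M n)"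

definition cohomology ::
    "('g, 'b) monoid_scheme \<Rightarrow> ('r, 'm) ring_scheme \<Rightarrow> ('g \<Rightarrow> 'r \<Rightarrow> 'r) \<Rightarrow> nat \<Rightarrow>
     ('g list \<Rightarrow> 'r) set monoid" where
  "cohomology G M \<phi> n =
     (cochains G M n\<lparr>carrier := cocycles G M \<phi> n\<rparr>) Mod coboundaries G M \<phi> n"

text \<open>On the class \<open>C\<close> of a cocycle \<open>f\<close>, \<open>res\<close> is the class of the restriction of \<open>f\<close> to
  \<open>H\<^sup>n\<close>: the restrictions of the members of \<open>C\<close> all lie in that one coset of the coboundaries.\<close>

definition res ::
    "('g, 'b) monoid_scheme \<Rightarrow> ('r, 'm) ring_scheme \<Rightarrow> ('g \<Rightarrow> 'r \<Rightarrow> 'r) \<Rightarrow> nat \<Rightarrow> 'g set \<Rightarrow>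
     ('g list \<Rightarrow> 'r) set \<Rightarrow> ('g list \<Rightarrow> 'r) set" where
  "res G M \<phi> n H C =
     set_mult (cochains (G\<lparr>carrier := H\<rparr>) M n)
       (coboundaries (G\<lparr>carrier := H\<rparr>) M \<phi> n)
       ((\<lambda>f. restrict f (tuples (G\<lparr>carrier := H\<rparr>) n)) ` C)"

definition res_family ::
    "('g, 'b) monoid_scheme \<Rightarrow> ('r, 'm) ring_scheme \<Rightarrow> ('g \<Rightarrow> 'r \<Rightarrow> 'r) \<Rightarrow> nat \<Rightarrow> 'g set set \<Rightarrow>
     ('g list \<Rightarrow> 'r) set \<Rightarrow> 'g set \<Rightarrow> ('g list \<Rightarrow> 'r) set" where
  "res_family G M \<phi> n \<P> C = (\<lambda>H\<in>\<P>. res G M \<phi> n H C)"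

section \<open>Group actions on rings\<close>

locale ring_action = group_action G "carrier R" \<phi> + R?: cring R
  for G (structure) and R (structure) and \<phi> +
  assumes acts_by_ring_hom: "g \<in> carrier G \<Longrightarrow> \<phi> g \<in> ring_hom R R"

definition invariant_ring ::
    "('g, 'b) monoid_scheme \<Rightarrow> ('r, 'm) ring_scheme \<Rightarrow> ('g \<Rightarrow> 'r \<Rightarrow> 'r) \<Rightarrow> ('r, 'm) ring_scheme" where
  "invariant_ring G R \<phi> = R\<lparr>carrier := {r \<in> carrier R. \<forall>g \<in> carrier G. \<phi> g r = r}\<rparr>"

definition augmentation_ideal ::
    "('r, 'm) ring_scheme \<Rightarrow> ('g \<Rightarrow> 'r \<Rightarrow> 'r) \<Rightarrow> 'g set \<Rightarrow> 'r set" where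
  "augmentation_ideal R \<phi> H = Idl\<^bsub>R\<^esub> {\<phi> h r \<ominus>\<^bsub>R\<^esub> r | h r. h \<in> H \<and> r \<in> carrier R}"

definition sylow_subgroup :: "nat \<Rightarrow> 'g set \<Rightarrow> ('g, 'b) monoid_scheme \<Rightarrow> bool" where
  "sylow_subgroup p P G \<longleftrightarrow> subgroup P G \<and> card P = p ^ multiplicity p (order G)"

section \<open>Commutative algebra\<close>

text \<open>Used with a subring of \<open>R\<close> as the ring of scalars.\<close>

definition ring_as_module :: "('r, 'm) ring_scheme \<Rightarrow> ('r, 'r) module" where
  "ring_as_module R =
     \<lparr>carrier = carrier R, monoid.mult = monoid.mult R, monoid.one = \<one>\<^bsub>R\<^esub>, ring.zero = \<zero>\<^bsub>R\<^esub>,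
      ring.add = ring.add R, smult = monoid.mult R\<rparr>"

definition noetherian_module :: "('a, 'b) ring_scheme \<Rightarrow> ('a, 'c, 'd) module_scheme \<Rightarrow> bool" where
  "noetherian_module A M \<longleftrightarrow> module A M \<and>
     (\<forall>N. submodule N A M \<longrightarrow>
        (\<exists>F \<subseteq> carrier M. finite F \<and> N = \<Inter> {N'. submodule N' A M \<and> F \<subseteq> N'}))"

definition prime_height :: "('r, 'm) ring_scheme \<Rightarrow> 'r set \<Rightarrow> enat" where
  "prime_height R q =
     (SUP n \<in> {n. \<exists>c :: nat \<Rightarrow> 'r set. (\<forall>i \<le> n. primeideal (c i) R) \<and>
                    (\<forall>i < n. c i \<subset> c (Suc i)) \<and> c n = q}. enat n)"

definition height :: "('r, 'm) ring_scheme \<Rightarrow> 'r set \<Rightarrow> enat" where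
  "height R I = (INF q \<in> {q. primeideal q R \<and> I \<subseteq> q}. prime_height R q)"

definition krull_dim :: "('r, 'm) ring_scheme \<Rightarrow> enat" where
  "krull_dim R = (SUP q \<in> {q. primeideal q R}. prime_height R q)"

text \<open>Each \<open>x\<^sub>i\<close> is a non-zero-divisor modulo the ideal generated by its predecessors, and the whole
  sequence generates a proper ideal.\<close>

definition regular_sequence :: "('r, 'm) ring_scheme \<Rightarrow> 'r list \<Rightarrow> bool" where
  "regular_sequence R xs \<longleftrightarrow> set xs \<subseteq> carrier R \<and>
     (\<forall>i < length xs. \<forall>r \<in> carrier R.
        xs ! i \<otimes>\<^bsub>R\<^esub> r \<in> Idl\<^bsub>R\<^esub> (set (take i xs)) \<longrightarrow> r \<in> Idl\<^bsub>R\<^esub> (set (take i xs))) \<and>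
     Idl\<^bsub>R\<^esub> (set xs) \<noteq> carrier R"

definition depth :: "('r, 'm) ring_scheme \<Rightarrow> 'r set \<Rightarrow> enat" where
  "depth R I = (SUP xs \<in> {xs. regular_sequence R xs \<and> set xs \<subseteq> I}. enat (length xs))"

text \<open>The fraction \<open>a / s\<close> is the set of all pairs \<open>(b, t)\<close> with \<open>u (a t - b s) = 0\<close> for some
  denominator \<open>u\<close>.  As for quotient rings in the library, the operations on classes take the union
  over all representatives, which all yield the same fraction.\<close>

definition fraction :: "('r, 'm) ring_scheme \<Rightarrow> 'r set \<Rightarrow> 'r \<Rightarrow> 'r \<Rightarrow> ('r \<times> 'r) set" where
  "fraction R S a s =
     {(b, t). b \<in> carrier R \<and> t \<in> S \<and>
        (\<exists>u \<in> S. u \<otimes>\<^bsub>R\<^esub> (a \<otimes>\<^bsub>R\<^esub> t \<ominus>\<^bsub>R\<^esub> b \<otimes>\<^bsub>R\<^esub> s) = \<zero>\<^bsub>R\<^esub>)}"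

definition ring_of_fractions :: "('r, 'm) ring_scheme \<Rightarrow> 'r set \<Rightarrow> ('r \<times> 'r) set ring" where
  "ring_of_fractions R S =
     \<lparr>carrier = {fraction R S a s | a s. a \<in> carrier R \<and> s \<in> S},
      monoid.mult = (\<lambda>C D. \<Union>(a, s)\<in>C. \<Union>(b, t)\<in>D. fraction R S (a \<otimes>\<^bsub>R\<^esub> b) (s \<otimes>\<^bsub>R\<^esub> t)),
      monoid.one = fraction R S \<one>\<^bsub>R\<^esub> \<one>\<^bsub>R\<^esub>,
      ring.zero = fraction R S \<zero>\<^bsub>R\<^esub> \<one>\<^bsub>R\<^esub>,
      ring.add = (\<lambda>C D. \<Union>(a, s)\<in>C. \<Union>(b, t)\<in>D.
               fraction R S (a \<otimes>\<^bsub>R\<^esub> t \<oplus>\<^bsub>R\<^esub> b \<otimes>\<^bsub>R\<^esub> s) (s \<otimes>\<^bsub>R\<^esub> t))\<rparr>"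

definition localization :: "('r, 'm) ring_scheme \<Rightarrow> 'r set \<Rightarrow> ('r \<times> 'r) set ring" where
  "localization R q = ring_of_fractions R (carrier R - q)"

definition cohen_macaulay_local :: "('r, 'm) ring_scheme \<Rightarrow> bool" where
  "cohen_macaulay_local S \<longleftrightarrow> cring S \<and> noetherian_ring S \<and>
     (\<exists>m. {m'. maximalideal m' S} = {m} \<and> depth S m = krull_dim S)"

definition cohen_macaulay :: "('r, 'm) ring_scheme \<Rightarrow> bool" where
  "cohen_macaulay R \<longleftrightarrow> cring R \<and> noetherian_ring R \<and>
     (\<forall>q. primeideal q R \<longrightarrow> cohen_macaulay_local (localization R q))"

end

theory Submission
  imports Defs
begin

text \<open>Let \<open>A = R\<^sup>G\<close>, let \<open>f\<close> represent a class of degree \<open>\<mu>\<close> that restricts to zero on every member of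
  \<open>\<P>\<close>, and let \<open>J\<close> be the annihilator of the class in \<open>A\<close>.

  If \<open>H\<close> is in \<open>\<P>\<close>, then corestriction shows that \<open>J\<close> contains the image of the trace \<open>R\<^sup>H \<rightarrow> A\<close>.
  Let \<open>q\<close> be a prime of \<open>R\<close> containing \<open>J\<close>.  A conjugate \<open>q'\<close> of \<open>q\<close> has an inertia group in which
  \<open>H = P \<inter> inertia q'\<close> has index prime to \<open>p\<close>, and by Artin's independence of characters some trace from
  \<open>R\<^sup>H\<close> then lies outside \<open>q'\<close>.  So \<open>H\<close> is not in \<open>\<P>\<close>, and since \<open>I\<^sub>R(H) \<subseteq> q'\<close>, the height of \<open>q\<close> is
  at least \<open>\<mu> + 2\<close>.  By lying over and incomparability the same holds for the primes of \<open>A\<close>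
  containing \<open>J\<close>.

  As \<open>A\<close> and \<open>R\<close> are Cohen-Macaulay, prime avoidance yields \<open>\<mu> + 2\<close> elements of \<open>J\<close> forming a weakly regular
  sequence in both rings.  Dividing \<open>R\<close> successively by the first \<open>\<mu>\<close> of them shifts the class down to
  degree \<open>0\<close>, without loss because the cohomology in degrees strictly between \<open>0\<close> and \<open>\<mu>\<close> vanishes; there
  the regularity in \<open>A\<close> of the remaining two elements forces the class to be zero.\<close>

section \<open>Regular sequences modulo an ideal\<close>

text \<open>The constant \<open>\<mu> + 2\<close>: \<open>\<mu>\<close> elements are spent on
  reaching degree 0. There an element \<open>z\<close> of \<open>R\<close> is known only through
  invariants \<open>u = c z\<close> and \<open>v = e z\<close> modulo an ideal, and two elements are
  what it takes to recover \<open>z\<close> as the common fraction \<open>u / c = v / e\<close>. The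
  descent uses regularity in \<open>R\<close> and this last step uses it in \<open>A\<close>, so the
  sequence is built regular in both rings at once. The ideals of \<open>A\<close> and
  \<open>R\<close> stay in step during the descent because invariants of \<open>R/I\<close> lift to
  \<open>A\<close>, which is what the vanishing of \<open>H^1\<close> provides. Independence of
  characters is not applied to \<open>R^H\<close> but to characters of \<open>R\<close>, obtained by
  composing with the norm \<open>R -> R^H\<close>. As \<open>H\<close> acts trivially modulo
  \<open>q'\<close> and has \<open>p\<close>-power order, this norm is a Frobenius power modulo
  \<open>q'\<close>, and injectivity of Frobenius on \<open>R/q'\<close> separates the inertia group
  from the rest. The passage to a conjugate prime is forced by \<open>\<P>\<close> containing only
  subgroups of one fixed Sylow group; it changes neither the height nor the contraction to
  \<open>A\<close>. Quotients of \<open>R\<close> are never formed: cochains have values in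
  \<open>R\<close>, and identities hold modulo \<open>I\<close>.\<close>

definition nonzerodivisor_mod :: "('r, 'm) ring_scheme \<Rightarrow> 'r set \<Rightarrow> 'r \<Rightarrow> bool" where
  "nonzerodivisor_mod R I a \<longleftrightarrow> (\<forall>r \<in> carrier R. a \<otimes>\<^bsub>R\<^esub> r \<in> I \<longrightarrow> r \<in> I)"

definition adjoin :: "('r, 'm) ring_scheme \<Rightarrow> 'r set \<Rightarrow> 'r \<Rightarrow> 'r set" where
  "adjoin R I a = {i \<oplus>\<^bsub>R\<^esub> a \<otimes>\<^bsub>R\<^esub> r | i r. i \<in> I \<and> r \<in> carrier R}"

text \<open>Unlike \<open>regular_sequence\<close>, this does not ask the ideal to stay proper, so
  the annihilator of a class may be the unit ideal without a case distinction. The base ideal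
  \<open>I\<close> is a parameter because sequences are consumed one element at a time.\<close>

fun weakly_regular :: "('r, 'm) ring_scheme \<Rightarrow> 'r set \<Rightarrow> 'r list \<Rightarrow> bool" where
  "weakly_regular R I [] \<longleftrightarrow> True"
| "weakly_regular R I (a # as) \<longleftrightarrow> nonzerodivisor_mod R I a \<and> weakly_regular R (adjoin R I a) as"

lemma weakly_regular_append:
  "weakly_regular R I (as @ bs) \<longleftrightarrow>
    weakly_regular R I as \<and> weakly_regular R (foldl (adjoin R) I as) bs"
  by (induction as arbitrary: I) auto

context cring
begin

lemma adjoinI: "i \<in> I \<Longrightarrow> r \<in> carrier R \<Longrightarrow> i \<oplus> a \<otimes> r \<in> adjoin R I a"
  unfolding adjoin_def by blast

lemma adjoinE:
  assumes "x \<in> adjoin R I a"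
  obtains i r where "i \<in> I" "r \<in> carrier R" "x = i \<oplus> a \<otimes> r"
  using assms unfolding adjoin_def by blast

lemma ideal_subset_adjoin:
  assumes "ideal I R" "a \<in> carrier R"
  shows "I \<subseteq> adjoin R I a"
proof
  fix i assume i: "i \<in> I"
  then have "i \<in> carrier R" using assms(1) ideal.Icarr by fast
  then have "i \<oplus> a \<otimes> \<zero> = i" using assms by simp
  then show "i \<in> adjoin R I a" using adjoinI[OF i zero_closed, of a] by simp
qed

lemma generator_in_adjoin:
  assumes "ideal I R" "a \<in> carrier R"
  shows "a \<in> adjoin R I a"
proof -
  have "\<zero> \<in> I" using assms(1) additive_subgroup.zero_closed ideal.axioms(1) by blast
  from adjoinI[OF this one_closed, of a] show ?thesis using assms by simp
qed

lemma adjoin_ideal: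
  assumes I: "ideal I R" and a: "a \<in> carrier R"
  shows "ideal (adjoin R I a) R"
proof -
  have car: "x \<in> carrier R" if "x \<in> I" for x using that I ideal.Icarr by fast
  have add: "x \<oplus> y \<in> I" if "x \<in> I" "y \<in> I" for x y
    using that I additive_subgroup.a_closed ideal.axioms(1) by fast
  show ?thesis
  proof (rule idealI[OF ring_axioms])
    show "subgroup (adjoin R I a) (add_monoid R)"
    proof (rule add.subgroupI)
      show "adjoin R I a \<subseteq> carrier R" using car a by (auto elim!: adjoinE)
      show "adjoin R I a \<noteq> {}" using generator_in_adjoin[OF assms] by blast
    next
      fix x assume "x \<in> adjoin R I a"
      then obtain i r where x: "i \<in> I" "r \<in> carrier R" "x = i \<oplus> a \<otimes> r" by (rule adjoinE)
      have "\<ominus> i \<in> I" using x I additive_subgroup.a_inv_closed ideal.axioms(1) by fast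
      moreover have "\<ominus> x = \<ominus> i \<oplus> a \<otimes> (\<ominus> r)" using x car a by (simp add: minus_add r_minus)
      ultimately show "\<ominus> x \<in> adjoin R I a" using adjoinI[of "\<ominus> i" I "\<ominus> r" a] x by simp
    next
      fix x y assume "x \<in> adjoin R I a" "y \<in> adjoin R I a"
      then obtain i r j s where x: "i \<in> I" "r \<in> carrier R" "x = i \<oplus> a \<otimes> r"
        and y: "j \<in> I" "s \<in> carrier R" "y = j \<oplus> a \<otimes> s" by (elim adjoinE)
      have "x \<oplus> y = (i \<oplus> j) \<oplus> a \<otimes> (r \<oplus> s)" using x y car a by algebra
      then show "x \<oplus> y \<in> adjoin R I a" using adjoinI[of "i \<oplus> j" I "r \<oplus> s" a] x y add by simp
    qed
  next
    fix x c assume "x \<in> adjoin R I a" and c: "c \<in> carrier R"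
    then obtain i r where x: "i \<in> I" "r \<in> carrier R" "x = i \<oplus> a \<otimes> r" by (elim adjoinE)
    have "c \<otimes> x = c \<otimes> i \<oplus> a \<otimes> (c \<otimes> r)" using x car a c by algebra
    moreover have "c \<otimes> i \<in> I" using I c x ideal.I_l_closed by fast
    ultimately show 1: "c \<otimes> x \<in> adjoin R I a" using adjoinI[of "c \<otimes> i" I "c \<otimes> r" a] x c by simp
    then show "x \<otimes> c \<in> adjoin R I a" using m_comm[of c x] x car a c by simp
  qed
qed

lemma adjoin_subset:
  assumes "ideal K R" "I \<subseteq> K" "a \<in> K"
  shows "adjoin R I a \<subseteq> K"
proof
  fix x assume "x \<in> adjoin R I a"
  then obtain i r where x: "i \<in> I" "r \<in> carrier R" "x = i \<oplus> a \<otimes> r" by (rule adjoinE)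
  interpret K: ideal K R by fact
  show "x \<in> K" using x assms(2,3) K.a_closed K.I_r_closed by auto
qed

lemma adjoin_commute:
  assumes I: "ideal I R" and a: "a \<in> carrier R" and c: "c \<in> carrier R"
  shows "adjoin R (adjoin R I a) c = adjoin R (adjoin R I c) a"
proof -
  have *: "adjoin R (adjoin R I a) c \<subseteq> adjoin R (adjoin R I c) a"
    if "a \<in> carrier R" "c \<in> carrier R" for a c
    using that I
    by (intro adjoin_subset adjoin_ideal)
      (auto intro: generator_in_adjoin adjoin_ideal ideal_subset_adjoin[THEN subsetD])
  show ?thesis using *[OF a c] *[OF c a] by blast
qed

lemma foldl_adjoin_ideal:
  assumes "ideal I R" "set as \<subseteq> carrier R"
  shows "ideal (foldl (adjoin R) I as) R"
  using assms by (induction as arbitrary: I) (auto simp: adjoin_ideal)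

lemma foldl_adjoin_subset:
  assumes "ideal I R" "set as \<subseteq> carrier R"
  shows "I \<subseteq> foldl (adjoin R) I as"
  using assms
proof (induction as arbitrary: I)
  case (Cons a as)
  then show ?case using ideal_subset_adjoin[of I a] adjoin_ideal[of I a] by force
qed simp

lemma foldl_adjoin_swap:
  assumes "ideal I R" "set as \<subseteq> carrier R" "c \<in> carrier R"
  shows "foldl (adjoin R) (adjoin R I c) as = adjoin R (foldl (adjoin R) I as) c"
  using assms by (induction as arbitrary: I) (auto simp: adjoin_ideal adjoin_commute)

text \<open>Links the explicit ideals \<open>I + a R\<close>, whose elements are easily decomposed,
  with the generated ideals in which \<open>regular_sequence\<close> is phrased.\<close>

lemma foldl_adjoin_eq_genideal:
  assumes "set as \<subseteq> carrier R"
  shows "foldl (adjoin R) {\<zero>} as = Idl (set as)"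
proof
  have *: "foldl (adjoin R) I bs \<subseteq> K" if "ideal K R" "I \<subseteq> K" "set bs \<subseteq> K" for I K bs
    using that
  proof (induction bs arbitrary: I)
    case (Cons b bs)
    then show ?case using adjoin_subset[of K I b] by simp
  qed simp
  have id: "ideal (Idl (set as)) R" using assms by (rule genideal_ideal)
  show "foldl (adjoin R) {\<zero>} as \<subseteq> Idl (set as)"
    using *[OF id] genideal_self[OF assms] additive_subgroup.zero_closed[OF ideal.axioms(1)[OF id]]
    by auto
  have "set as \<subseteq> foldl (adjoin R) I as" if "ideal I R" "set as \<subseteq> carrier R" for I as
    using that
  proof (induction as arbitrary: I)
    case (Cons a as)
    have "a \<in> foldl (adjoin R) (adjoin R I a) as"
      using Cons.prems foldl_adjoin_subset[of "adjoin R I a" as] adjoin_ideal[of I a]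
        generator_in_adjoin[of I a] by auto
    then show ?case using Cons adjoin_ideal[of I a] by auto
  qed simp
  then show "Idl (set as) \<subseteq> foldl (adjoin R) {\<zero>} as"
    using genideal_minimal foldl_adjoin_ideal zeroideal assms by simp
qed

lemma regular_sequence_imp_weakly_regular:
  assumes "regular_sequence R xs"
  shows "weakly_regular R {\<zero>} xs"
proof -
  have xs: "set xs \<subseteq> carrier R" using assms unfolding regular_sequence_def by blast
  have "weakly_regular R {\<zero>} (take k xs)" for k
  proof (induction k)
    case (Suc k)
    show ?case
    proof (cases "k < length xs")
      case True
      have "set (take k xs) \<subseteq> carrier R" using xs set_take_subset[of k xs] by blast
      then have "nonzerodivisor_mod R (foldl (adjoin R) {\<zero>} (take k xs)) (xs ! k)"
        using True assms
        unfolding regular_sequence_def nonzerodivisor_mod_def by (simp add: foldl_adjoin_eq_genideal)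
      then show ?thesis using Suc True
        by (simp add: take_Suc_conv_app_nth weakly_regular_append)
    qed (use Suc in simp)
  qed simp
  from this[of "length xs"] show ?thesis by simp
qed

lemma (in ideal) zero_mem: "\<zero> \<in> I"
  using additive_subgroup.zero_closed is_additive_subgroup by blast

lemma (in ideal) minus_closed:
  "x \<in> I \<Longrightarrow> y \<in> I \<Longrightarrow> x \<ominus> y \<in> I"
  unfolding a_minus_def by (simp add: a_closed a_inv_closed)

lemma (in ideal) mem_if_add_mem:
  "x \<oplus> y \<in> I \<Longrightarrow> x \<in> carrier R \<Longrightarrow> y \<in> I \<Longrightarrow> x \<in> I"
  using minus_closed[of "x \<oplus> y" y] Icarr[of y] by (simp add: a_minus_def a_assoc r_neg)

lemma adjoin_iff:
  assumes "ideal I R" "a \<in> carrier R" "x \<in> carrier R"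
  shows "x \<in> adjoin R I a \<longleftrightarrow> (\<exists>r \<in> carrier R. x \<ominus> a \<otimes> r \<in> I)"
proof
  interpret I: ideal I R by fact
  assume "x \<in> adjoin R I a"
  then obtain i r where x: "i \<in> I" "r \<in> carrier R" "x = i \<oplus> a \<otimes> r" by (rule adjoinE)
  then have "x \<ominus> a \<otimes> r = i" using assms I.Icarr by algebra
  then have "x \<ominus> a \<otimes> r \<in> I" using x(1) by simp
  then show "\<exists>r \<in> carrier R. x \<ominus> a \<otimes> r \<in> I" using x(2) by blast
next
  interpret I: ideal I R by fact
  assume "\<exists>r \<in> carrier R. x \<ominus> a \<otimes> r \<in> I"
  then obtain r where r: "r \<in> carrier R" "x \<ominus> a \<otimes> r \<in> I" by blast
  have "x = (x \<ominus> a \<otimes> r) \<oplus> a \<otimes> r" using r assms by algebra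
  then show "x \<in> adjoin R I a" using adjoinI[OF r(2,1), of a] by simp
qed

text \<open>If \<open>a\<close> and \<open>c\<close> are regular modulo \<open>I\<close>, then \<open>Hom(R/m, R/(I + a))\<close> and
  \<open>Hom(R/m, R/(I + c))\<close> are both isomorphic to \<open>Ext\<^sup>1(R/m, R/I)\<close>.\<close>

lemma annihilated_element_exchange:
  assumes I: "ideal I R" and a: "a \<in> m" and c: "c \<in> m" and m: "m \<subseteq> carrier R"
    and nza: "nonzerodivisor_mod R I a" and nzc: "nonzerodivisor_mod R I c"
    and z: "z \<in> carrier R" "z \<notin> adjoin R I a" "\<And>t. t \<in> m \<Longrightarrow> t \<otimes> z \<in> adjoin R I a"
  shows "\<exists>w \<in> carrier R. w \<notin> adjoin R I c \<and> (\<forall>t \<in> m. t \<otimes> w \<in> adjoin R I c)"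
proof -
  interpret I: ideal I R by fact
  have ac: "a \<in> carrier R" "c \<in> carrier R" using a c m by auto
  \<comment> \<open>\<open>w\<close> stands for \<open>c z / a\<close> modulo \<open>I\<close>. The
    relation is symmetric, \<open>z\<close> being \<open>a w / c\<close> in turn; this is why
    \<open>w\<close> cannot vanish modulo \<open>I + c\<close>.\<close>
  obtain w where w: "w \<in> carrier R" "c \<otimes> z \<ominus> a \<otimes> w \<in> I"
    using z(3)[OF c] adjoin_iff[OF I ac(1)] ac z(1) by auto
  show ?thesis
  proof (intro bexI conjI ballI notI)
    show "w \<in> carrier R" by fact
  next
    assume "w \<in> adjoin R I c"
    then obtain v where v: "v \<in> carrier R" "w \<ominus> c \<otimes> v \<in> I"
      using adjoin_iff[OF I ac(2) w(1)] by auto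
    have "c \<otimes> (z \<ominus> a \<otimes> v) = (c \<otimes> z \<ominus> a \<otimes> w) \<oplus> a \<otimes> (w \<ominus> c \<otimes> v)"
      using w v ac z by algebra
    also have "\<dots> \<in> I" using w v ac I.I_l_closed by simp
    finally have "z \<ominus> a \<otimes> v \<in> I"
      using nzc[unfolded nonzerodivisor_mod_def, rule_format, of "z \<ominus> a \<otimes> v"] v(1) z(1) ac by simp
    then show False using z adjoin_iff[OF I ac(1) z(1)] v by auto
  next
    fix t assume t: "t \<in> m"
    then have tc: "t \<in> carrier R" using m by auto
    obtain v where v: "v \<in> carrier R" "t \<otimes> z \<ominus> a \<otimes> v \<in> I"
      using z(3)[OF t] adjoin_iff[OF I ac(1)] tc z(1) by auto
    have "a \<otimes> (t \<otimes> w \<ominus> c \<otimes> v) = c \<otimes> (t \<otimes> z \<ominus> a \<otimes> v) \<ominus> t \<otimes> (c \<otimes> z \<ominus> a \<otimes> w)"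
      using w v ac z tc by algebra
    also have "\<dots> \<in> I" using w v ac tc I.I_l_closed I.minus_closed by simp
    finally have "t \<otimes> w \<ominus> c \<otimes> v \<in> I"
      using nza[unfolded nonzerodivisor_mod_def, rule_format, of "t \<otimes> w \<ominus> c \<otimes> v"] w(1) v(1) ac tc by simp
    then show "t \<otimes> w \<in> adjoin R I c" using adjoin_iff[OF I ac(2)] v w tc by auto
  qed
qed

text \<open>The half of the permutability of regular sequences that holds in every ring: if
  \<open>a x = c y\<close> modulo \<open>I\<close>, then regularity of \<open>c\<close> makes
  \<open>y\<close> a multiple \<open>a v\<close>, and cancelling \<open>a\<close> gives
  \<open>x = c v\<close>.\<close>

lemma nonzerodivisor_mod_adjoin:
  assumes I: "ideal I R" and a: "a \<in> carrier R" and c: "c \<in> carrier R"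
    and nza: "nonzerodivisor_mod R I a" and nzc: "nonzerodivisor_mod R (adjoin R I a) c"
  shows "nonzerodivisor_mod R (adjoin R I c) a"
  unfolding nonzerodivisor_mod_def
proof (intro ballI impI)
  interpret I: ideal I R by fact
  fix x assume x: "x \<in> carrier R" "a \<otimes> x \<in> adjoin R I c"
  then obtain y where y: "y \<in> carrier R" "a \<otimes> x \<ominus> c \<otimes> y \<in> I"
    using adjoin_iff[OF I c] a by auto
  have "c \<otimes> y \<ominus> a \<otimes> x = \<ominus> (a \<otimes> x \<ominus> c \<otimes> y)" using x y a c by algebra
  then have "c \<otimes> y \<ominus> a \<otimes> x \<in> I" using y(2) I.a_inv_closed by simp
  then have "c \<otimes> y \<in> adjoin R I a" using adjoin_iff[OF I a, of "c \<otimes> y"] x y a c by auto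
  then have "y \<in> adjoin R I a" using nzc y unfolding nonzerodivisor_mod_def by auto
  then obtain v where v: "v \<in> carrier R" "y \<ominus> a \<otimes> v \<in> I" using adjoin_iff[OF I a y(1)] by auto
  have "a \<otimes> (x \<ominus> c \<otimes> v) = (a \<otimes> x \<ominus> c \<otimes> y) \<oplus> c \<otimes> (y \<ominus> a \<otimes> v)"
    using x y v a c by algebra
  also have "\<dots> \<in> I" using y v a c I.I_l_closed by simp
  finally have "x \<ominus> c \<otimes> v \<in> I"
    using nza[unfolded nonzerodivisor_mod_def, rule_format, of "x \<ominus> c \<otimes> v"] x(1) v(1) a c by simp
  then show "x \<in> adjoin R I c" using adjoin_iff[OF I c x(1)] v by auto
qed

text \<open>\<open>c\<close> is moved to the front by passing each entry of \<open>as\<close> in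
  turn with \<open>nonzerodivisor_mod_adjoin\<close>, which needs \<open>c\<close> to be regular
  modulo the partial ideal that includes this entry.\<close>

lemma weakly_regular_adjoin:
  assumes "ideal I R" "set as \<subseteq> carrier R" "c \<in> carrier R" "weakly_regular R I as"
    and "\<And>i. i \<le> length as \<Longrightarrow> nonzerodivisor_mod R (foldl (adjoin R) I (take i as)) c"
  shows "weakly_regular R (adjoin R I c) as"
  using assms
proof (induction as arbitrary: I)
  case (Cons a as)
  have ca: "a \<in> carrier R" "set as \<subseteq> carrier R" using Cons.prems by auto
  have "weakly_regular R (adjoin R (adjoin R I a) c) as"
  proof (rule Cons.IH)
    fix i assume "i \<le> length as"
    then show "nonzerodivisor_mod R (foldl (adjoin R) (adjoin R I a) (take i as)) c"
      using Cons.prems(5)[of "Suc i"] by simp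
  qed (use Cons.prems adjoin_ideal in auto)
  moreover have "nonzerodivisor_mod R (adjoin R I c) a"
    using Cons.prems(5)[of 1] Cons.prems ca nonzerodivisor_mod_adjoin by auto
  ultimately show ?case using adjoin_commute[of I a c] Cons.prems ca by simp
qed simp

end

section \<open>Prime avoidance and the maximal associated primes of a quotient\<close>

lemma (in ideal) finprod_mem:
  assumes "cring R" "finite A" "f \<in> A \<rightarrow> carrier R" "a \<in> A" "f a \<in> I"
  shows "finprod R f A \<in> I"
proof -
  interpret cring R by fact
  have "finprod R f (insert a (A - {a})) = f a \<otimes> finprod R f (A - {a})"
    using assms by (intro finprod_insert) auto
  moreover have "insert a (A - {a}) = A" using assms by auto
  moreover have "finprod R f (A - {a}) \<in> carrier R" using assms by (intro finprod_closed) auto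
  ultimately show ?thesis using assms I_r_closed by auto
qed

lemma (in primeideal) mem_of_finprod_mem:
  assumes "finite A" "f \<in> A \<rightarrow> carrier R" "finprod R f A \<in> I"
  shows "\<exists>a \<in> A. f a \<in> I"
  using assms
proof (induction A rule: finite_induct)
  case empty
  then show ?case using I_notcarr one_imp_carrier by auto
next
  case (insert x A)
  then have "f x \<otimes> finprod R f A \<in> I" by (simp add: Pi_iff)
  then have "f x \<in> I \<or> finprod R f A \<in> I" using insert by (intro I_prime) (auto simp: Pi_iff)
  then show ?case using insert by (auto simp: Pi_iff)
qed

context cring
begin

lemma prime_avoidance:
  assumes "finite Q" "ideal J R" "\<And>q. q \<in> Q \<Longrightarrow> primeideal q R" "\<And>q. q \<in> Q \<Longrightarrow> \<not> J \<subseteq> q"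
  shows "\<exists>x \<in> J. \<forall>q \<in> Q. x \<notin> q"
  using assms
proof (induction Q rule: finite_psubset_induct)
  case (psubset Q)
  interpret J: ideal J R by fact
  show ?case
  proof (cases "\<exists>q \<in> Q. \<exists>q' \<in> Q. q' \<subset> q")
    case True
    then obtain q q' where q: "q \<in> Q" "q' \<in> Q" "q' \<subset> q" by blast
    then have "\<exists>x \<in> J. \<forall>q \<in> Q - {q'}. x \<notin> q"
      using psubset.prems by (intro psubset.IH) auto
    then show ?thesis using q by blast
  next
    case False
    show ?thesis
    proof (cases "Q = {}")
      case True
      then show ?thesis using J.zero_mem by blast
    next
      case ne: False
      then obtain q where q: "q \<in> Q" by blast
      define Q' where "Q' = Q - {q}"
      have Q': "finite Q'" "q \<notin> Q'" "Q = insert q Q'" using q psubset(1) Q'_def by auto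
      interpret q: primeideal q R using q psubset by auto
      obtain x where x: "x \<in> J" "\<forall>q\<in>Q'. x \<notin> q"
        using psubset.IH[of Q'] psubset.prems Q' by blast
      show ?thesis
      proof (cases "x \<in> q")
        case out: False
        then show ?thesis using x Q' by auto
      next
        case xq: True
        obtain y where y: "y \<in> J" "y \<notin> q" using psubset.prems(3)[OF q] by auto
        \<comment> \<open>By incomparability every other prime has an element outside
          \<open>q\<close>. The product \<open>s\<close> of these lies in all of them but not in
          \<open>q\<close>, so adding \<open>y s\<close> corrects \<open>x\<close> at
          \<open>q\<close> without disturbing it at the others.\<close>
        have "\<forall>q' \<in> Q'. \<exists>t \<in> q'. t \<notin> q"
        proof
          fix q' assume q': "q' \<in> Q'"
          then have "\<not> q' \<subset> q" "q' \<noteq> q" using False q Q'(2) by (auto simp: Q'(3))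
          then show "\<exists>t \<in> q'. t \<notin> q" by blast
        qed
        then obtain t where t: "\<And>q'. q' \<in> Q' \<Longrightarrow> t q' \<in> q'" "\<And>q'. q' \<in> Q' \<Longrightarrow> t q' \<notin> q" by metis
        have tc: "t \<in> Q' \<rightarrow> carrier R"
        proof
          fix q' assume "q' \<in> Q'"
          then interpret q': primeideal q' R using psubset.prems(2) Q'(3) by blast
          show "t q' \<in> carrier R" using t(1)[OF \<open>q' \<in> Q'\<close>] by (rule q'.Icarr)
        qed
        define s where "s = finprod R t Q'"
        have sc: "s \<in> carrier R" unfolding s_def using tc by simp
        have sq: "s \<notin> q" using q.mem_of_finprod_mem[OF Q'(1) tc] t s_def by auto
        have sQ: "s \<in> q'" if "q' \<in> Q'" for q'
        proof -
          interpret q': primeideal q' R using psubset.prems(2) that Q'(3) by blast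
          show ?thesis using q'.finprod_mem[OF cring_axioms Q'(1) tc that t(1)[OF that]] s_def by simp
        qed
        have c: "x \<in> carrier R" "y \<in> carrier R" using x y J.Icarr by auto
        show ?thesis
        proof (intro bexI ballI)
          show "x \<oplus> y \<otimes> s \<in> J" using x y sc J.I_r_closed J.a_closed by simp
          fix q' assume q': "q' \<in> Q"
          show "x \<oplus> y \<otimes> s \<notin> q'"
          proof
            assume a: "x \<oplus> y \<otimes> s \<in> q'"
            interpret q': primeideal q' R using q' psubset by auto
            show False
            proof (cases "q' = q")
              case True
              have "y \<otimes> s \<oplus> x \<in> q" using a c sc True by (simp add: a_comm)
              then have "y \<otimes> s \<in> q" using q.mem_if_add_mem xq c sc by blast
              then show False using q.I_prime c sc sq y by blast
            next
              case False
              then have "y \<otimes> s \<in> q'" using q' sQ c q'.I_l_closed Q' by auto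
              then have "x \<in> q'" using a c q'.mem_if_add_mem by blast
              then show False using x q' False Q' by auto
            qed
          qed
        qed
      qed
    qed
  qed
qed

text \<open>The associated primes of \<open>R/I\<close> that are maximal among the annihilators of
  its nonzero elements. In a noetherian ring their union is the set of zero divisors modulo
  \<open>I\<close>, and maximality makes their primality and finiteness accessible without primary
  decomposition.\<close>

definition zero_divisor_primes :: "'a set \<Rightarrow> 'a set set" where
  "zero_divisor_primes I =
     {q. \<exists>z \<in> carrier R. z \<notin> I \<and> q = {a \<in> carrier R. a \<otimes> z \<in> I} \<and>
        (\<forall>y \<in> carrier R. y \<notin> I \<longrightarrow> q \<subseteq> {a \<in> carrier R. a \<otimes> y \<in> I} \<longrightarrow> q = {a \<in> carrier R. a \<otimes> y \<in> I})}"

lemma annihilator_ideal: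
  assumes "ideal I R" "z \<in> carrier R"
  shows "ideal {a \<in> carrier R. a \<otimes> z \<in> I} R"
proof -
  interpret I: ideal I R by fact
  show ?thesis
  proof (rule idealI[OF ring_axioms])
    show "subgroup {a \<in> carrier R. a \<otimes> z \<in> I} (add_monoid R)"
    proof (rule add.subgroupI)
      have "\<zero> \<in> {a \<in> carrier R. a \<otimes> z \<in> I}" using assms by simp
      then show "{a \<in> carrier R. a \<otimes> z \<in> I} \<noteq> {}" by blast
    qed (use assms in \<open>auto simp: l_distr l_minus\<close>)
  next
    fix a x assume a: "a \<in> {a \<in> carrier R. a \<otimes> z \<in> I}" and x: "x \<in> carrier R"
    then have "x \<otimes> (a \<otimes> z) \<in> I" using I.I_l_closed by simp
    then show "x \<otimes> a \<in> {a \<in> carrier R. a \<otimes> z \<in> I}" "a \<otimes> x \<in> {a \<in> carrier R. a \<otimes> z \<in> I}"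
      using a x assms(2) by (simp_all add: m_assoc m_lcomm)
  qed
qed

text \<open>If \<open>b z\<close> is nonzero modulo \<open>I\<close>, its annihilator contains that
  of \<open>z\<close> and equals it by maximality; so whatever kills \<open>b z\<close> already
  kills \<open>z\<close>.\<close>

lemma zero_divisor_primes_prime:
  assumes I: "ideal I R" and q: "q \<in> zero_divisor_primes I"
  shows "primeideal q R"
proof -
  interpret I: ideal I R by fact
  obtain z where z: "z \<in> carrier R" "z \<notin> I" "q = {a \<in> carrier R. a \<otimes> z \<in> I}"
    and mx: "\<And>y. y \<in> carrier R \<Longrightarrow> y \<notin> I \<Longrightarrow> q \<subseteq> {a \<in> carrier R. a \<otimes> y \<in> I} \<Longrightarrow>
       q = {a \<in> carrier R. a \<otimes> y \<in> I}"
    using q unfolding zero_divisor_primes_def by blast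
  show ?thesis
  proof (rule primeidealI)
    show "ideal q R" using annihilator_ideal[OF I z(1)] z by simp
    show "cring R" by (rule cring_axioms)
    have "\<one> \<notin> q" using z by simp
    then show "carrier R \<noteq> q" using one_closed by blast
    fix a b assume ab: "a \<in> carrier R" "b \<in> carrier R" "a \<otimes> b \<in> q"
    show "a \<in> q \<or> b \<in> q"
    proof (rule disjCI)
      assume "b \<notin> q"
      then have bz: "b \<otimes> z \<notin> I" using z ab by simp
      have "q \<subseteq> {a \<in> carrier R. a \<otimes> (b \<otimes> z) \<in> I}"
      proof
        fix x assume "x \<in> q"
        then have x: "x \<in> carrier R" "x \<otimes> z \<in> I" using z(3) by auto
        then have "b \<otimes> (x \<otimes> z) \<in> I" using ab I.I_l_closed by simp
        then show "x \<in> {a \<in> carrier R. a \<otimes> (b \<otimes> z) \<in> I}" using x ab(2) z(1) by (simp add: m_lcomm)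
      qed
      with mx[OF _ bz] ab(2) z(1) have "q = {a \<in> carrier R. a \<otimes> (b \<otimes> z) \<in> I}" by blast
      moreover have "a \<otimes> (b \<otimes> z) \<in> I" using ab z(1,3) by (simp add: m_assoc)
      ultimately show "a \<in> q" using ab(1) by blast
    qed
  qed
qed

end

section \<open>Regular elements and the length of regular sequences in noetherian rings\<close>

lemma (in noetherian_ring) exists_maximal_ideal_in:
  assumes "S \<noteq> {}" "S \<subseteq> {I. ideal I R}"
  shows "\<exists>M \<in> S. \<forall>I \<in> S. M \<subseteq> I \<longrightarrow> I = M"
proof (rule subset_Zorn_nonempty[OF assms(1)])
  fix C assume C: "C \<noteq> {}" "subset.chain S C"
  then have "subset.chain {I. ideal I R} C" using assms(2) by (auto simp: subset_chain_def)
  then have "\<Union>C \<in> C" using ideal_chain_is_trivial C by blast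
  then show "\<Union>C \<in> S" using C by (auto simp: subset_chain_def)
qed

locale noetherian_cring = noetherian_ring + cring
begin

lemma zero_divisor_in_prime:
  assumes I: "ideal I R" and z: "z \<in> carrier R" "z \<notin> I" and a: "a \<in> carrier R" "a \<otimes> z \<in> I"
  shows "\<exists>q \<in> zero_divisor_primes I. a \<in> q"
proof -
  let ?ann = "\<lambda>z. {a \<in> carrier R. a \<otimes> z \<in> I}"
  \<comment> \<open>Only annihilators containing \<open>a\<close> are compared. A larger annihilator
    contains \<open>a\<close> as well, so a maximal member of \<open>S\<close> is maximal among all
    annihilators.\<close>
  define S where "S = {?ann y | y. y \<in> carrier R \<and> y \<notin> I \<and> a \<otimes> y \<in> I}"
  have "S \<noteq> {}" "S \<subseteq> {I. ideal I R}" using z a annihilator_ideal[OF I] unfolding S_def by blast+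
  from exists_maximal_ideal_in[OF this] obtain M
    where M: "M \<in> S" "\<forall>K \<in> S. M \<subseteq> K \<longrightarrow> K = M" by (elim bexE)
  obtain y where y: "M = ?ann y" "y \<in> carrier R" "y \<notin> I" "a \<otimes> y \<in> I" using M(1) unfolding S_def by blast
  have "M \<in> zero_divisor_primes I"
    unfolding zero_divisor_primes_def
  proof (intro CollectI exI conjI bexI ballI impI)
    fix x assume x: "x \<in> carrier R" "x \<notin> I" "M \<subseteq> ?ann x"
    then have "a \<otimes> x \<in> I" using y a by blast
    then have "?ann x \<in> S" using x unfolding S_def by blast
    with M(2) have "M \<subseteq> ?ann x \<longrightarrow> ?ann x = M" by (rule bspec)
    with x(3) show "M = ?ann x" by simp
  qed (rule y)+
  moreover have "a \<in> M" using y(1,4) a(1) by simp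
  ultimately show ?thesis by (intro bexI)
qed

text \<open>The witnesses of the maximal annihilators generate, modulo \<open>I\<close>, a finitely generated
  ideal; the annihilators of finitely many generating witnesses are already all of them.\<close>

lemma finite_zero_divisor_primes:
  assumes I: "ideal I R"
  shows "finite (zero_divisor_primes I)"
proof -
  interpret I: ideal I R by fact
  let ?ann = "\<lambda>z. {a \<in> carrier R. a \<otimes> z \<in> I}"
  let ?Z = "zero_divisor_primes I"
  define P where "P q z \<longleftrightarrow> z \<in> carrier R \<and> z \<notin> I \<and> q = ?ann z" for q z
  have "\<forall>q \<in> ?Z. \<exists>z. P q z" unfolding zero_divisor_primes_def P_def by blast
  then obtain w where w: "\<And>q. q \<in> ?Z \<Longrightarrow> P q (w q)" by metis
  have wc: "w q \<in> carrier R" "w q \<notin> I" "q = ?ann (w q)" if "q \<in> ?Z" for q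
  proof -
    note w' = w[OF that, unfolded P_def]
    from w' show "w q \<in> carrier R" by (rule conjunct1)
    from w' show "w q \<notin> I" by (elim conjE)
    from w' show "q = ?ann (w q)" by (elim conjE)
  qed
  define S where "S = {Idl (w ` Q) | Q. finite Q \<and> Q \<subseteq> ?Z}"
  have "S \<noteq> {}" unfolding S_def by blast
  moreover have "S \<subseteq> {I. ideal I R}"
    unfolding S_def using wc(1) by (auto intro!: genideal_ideal)
  ultimately have "\<exists>M \<in> S. \<forall>K \<in> S. M \<subseteq> K \<longrightarrow> K = M" by (rule exists_maximal_ideal_in)
  then obtain M where M: "M \<in> S" "\<forall>K \<in> S. M \<subseteq> K \<longrightarrow> K = M" by (elim bexE)
  obtain Q where Q: "finite Q" "Q \<subseteq> ?Z" "M = Idl (w ` Q)" using M(1) S_def by blast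
  have "?Z \<subseteq> Q"
  proof
    fix q assume q: "q \<in> ?Z"
    interpret q: primeideal q R using q by (rule zero_divisor_primes_prime[OF I])
    have sub: "w ` (insert q Q) \<subseteq> carrier R" using wc q Q by auto
    have "Idl (w ` (insert q Q)) \<in> S" unfolding S_def using Q q by blast
    moreover have "M \<subseteq> Idl (w ` (insert q Q))"
      unfolding Q(3) using sub by (intro subset_Idl_subset) auto
    ultimately have "Idl (w ` (insert q Q)) = M" using M(2) by blast
    then have wq: "w q \<in> Idl (w ` Q)"
      using genideal_self[OF sub] Q(3) by auto
    show "q \<in> Q"
    proof (rule ccontr)
      assume nq: "q \<notin> Q"
      have "\<exists>t \<in> q'. t \<notin> q" if q': "q' \<in> Q" for q'
      proof (rule ccontr)
        assume "\<not> (\<exists>t \<in> q'. t \<notin> q)"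
        then have "q' \<subseteq> q" by blast
        then have "q' = q"
          using q' Q(2) wc[OF q] unfolding zero_divisor_primes_def by blast
        then show False using nq q' by blast
      qed
      then obtain t where t: "\<And>q'. q' \<in> Q \<Longrightarrow> t q' \<in> q'" "\<And>q'. q' \<in> Q \<Longrightarrow> t q' \<notin> q" by metis
      have tc: "t \<in> Q \<rightarrow> carrier R"
        using t(1) wc(3) Q(2) by blast
      \<comment> \<open>\<open>s\<close> lies in every member of \<open>Q\<close> but not in the
        prime \<open>q\<close>. It kills all generators \<open>w q'\<close> modulo \<open>I\<close>,
        hence also \<open>w q\<close>, which is a combination of them; but then \<open>s\<close>
        belongs to the annihilator \<open>q\<close>.\<close>
      define s where "s = finprod R t Q"
      have sc: "s \<in> carrier R" unfolding s_def using tc by simp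
      have sq: "s \<notin> q" using q.mem_of_finprod_mem[OF Q(1) tc] t s_def by auto
      have sQ: "s \<in> q'" if "q' \<in> Q" for q'
        using ideal.finprod_mem[OF _ cring_axioms Q(1) tc that] t(1)[OF that] that Q(2)
          zero_divisor_primes_prime[OF I] primeideal.axioms(1) s_def by blast
      have "ideal {x \<in> carrier R. x \<otimes> s \<in> I} R" by (rule annihilator_ideal[OF I sc])
      moreover have "w ` Q \<subseteq> {x \<in> carrier R. x \<otimes> s \<in> I}"
      proof
        fix x assume "x \<in> w ` Q"
        then obtain q' where q': "q' \<in> Q" "x = w q'" by blast
        then have Z: "q' \<in> ?Z" using Q(2) by blast
        have "s \<otimes> w q' \<in> I" using sQ[OF q'(1)] wc(3)[OF Z] by blast
        then show "x \<in> {x \<in> carrier R. x \<otimes> s \<in> I}"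
          using wc(1)[OF Z] sc m_comm q'(2) by simp
      qed
      ultimately have "Idl (w ` Q) \<subseteq> {x \<in> carrier R. x \<otimes> s \<in> I}" by (rule genideal_minimal)
      then have "w q \<otimes> s \<in> I" using wq by blast
      then have "s \<otimes> w q \<in> I" using sc wc[OF q] m_comm by auto
      then have "s \<in> q" using wc(3)[OF q] sc by blast
      then show False using sq by blast
    qed
  qed
  then show ?thesis using Q(1) finite_subset by blast
qed

text \<open>A regular element of \<open>m\<close> modulo \<open>I\<close> shows that
  \<open>m\<close> is contained in no member of \<open>zero_divisor_primes I\<close>. The primes
  belonging to all the ideals in \<open>N\<close> are finitely many and can be avoided
  together.\<close>

lemma exists_nonzerodivisor_mod:
  assumes "finite N" "\<And>I. I \<in> N \<Longrightarrow> ideal I R" "ideal m R"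
    and "\<And>I. I \<in> N \<Longrightarrow> \<exists>a \<in> m. nonzerodivisor_mod R I a"
  shows "\<exists>c \<in> m. \<forall>I \<in> N. nonzerodivisor_mod R I c"
proof -
  let ?Q = "\<Union>I \<in> N. zero_divisor_primes I"
  have "\<exists>c \<in> m. \<forall>q \<in> ?Q. c \<notin> q"
  proof (rule prime_avoidance)
    show "finite ?Q" using assms finite_zero_divisor_primes by auto
    show "primeideal q R" if "q \<in> ?Q" for q using that assms(2) zero_divisor_primes_prime by blast
    fix q assume "q \<in> ?Q"
    then obtain I where I: "I \<in> N" "q \<in> zero_divisor_primes I" by blast
    then obtain a where a: "a \<in> m" "nonzerodivisor_mod R I a" using assms by blast
    have "a \<notin> q" using I(2) a(2) unfolding zero_divisor_primes_def nonzerodivisor_mod_def by auto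
    then show "\<not> m \<subseteq> q" using a by blast
  qed fact
  then obtain c where c: "c \<in> m" "\<forall>q \<in> ?Q. c \<notin> q" by blast
  have "nonzerodivisor_mod R I c" if I: "I \<in> N" for I
    unfolding nonzerodivisor_mod_def
    using zero_divisor_in_prime[OF assms(2)[OF I]] c I ideal.Icarr[OF assms(3) c(1)] by blast
  then show ?thesis using c by blast
qed

lemma weakly_regular_take_nonzerodivisor:
  assumes "weakly_regular R I as" "i < length as"
  shows "nonzerodivisor_mod R (foldl (adjoin R) I (take i as)) (as ! i)"
  using assms
proof (induction as arbitrary: I i)
  case (Cons a as)
  then show ?case by (cases i) auto
qed simp

text \<open>Both \<open>as\<close> and \<open>bs\<close> of length \<open>k\<close> compute \<open>Ext\<^sup>k(R/m, R/I)\<close>: a common \<open>c\<close>, regular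
  modulo all the partial ideals, is exchanged against the last element of either sequence and then
  moved to the front.\<close>

theorem annihilated_element_transfer:
  assumes "ideal I R" "ideal m R" "set as \<subseteq> m" "set bs \<subseteq> m" "length as = length bs"
    and "weakly_regular R I as" "weakly_regular R I bs"
    and "z \<in> carrier R" "z \<notin> foldl (adjoin R) I as"
    and "\<And>t. t \<in> m \<Longrightarrow> t \<otimes> z \<in> foldl (adjoin R) I as"
  shows "\<exists>w \<in> carrier R. w \<notin> foldl (adjoin R) I bs \<and>
           (\<forall>t \<in> m. t \<otimes> w \<in> foldl (adjoin R) I bs)"
  using assms
proof (induction "length as" arbitrary: I as bs z)
  case 0
  then show ?case by auto
next
  case (Suc k)
  interpret m: ideal m R by fact
  have mc: "m \<subseteq> carrier R" using m.Icarr by blast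
  obtain as' a where as: "as = as' @ [a]" using Suc.hyps(2) by (cases as rule: rev_cases) auto
  obtain bs' b where bs: "bs = bs' @ [b]"
    using Suc.hyps(2) Suc.prems(5) by (cases bs rule: rev_cases) auto
  have len: "length as' = k" "length bs' = k" using as bs Suc.hyps(2) Suc.prems(5) by auto
  let ?I = "\<lambda>as. foldl (adjoin R) I as"
  have sets: "set as' \<subseteq> m" "set bs' \<subseteq> m" "a \<in> m" "b \<in> m" using as bs Suc.prems(3,4) by auto
  have id: "ideal (?I xs) R" if "set xs \<subseteq> m" for xs
    using foldl_adjoin_ideal[OF Suc.prems(1)] that mc by blast
  \<comment> \<open>The sequences have length \<open>k + 1\<close>, so \<open>{..k}\<close> runs
    over their proper prefixes only. Modulo the full ideal of \<open>as\<close> no element of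
    \<open>m\<close> is regular, as all of \<open>m\<close> kills \<open>z\<close>.\<close>
  define N where "N = (\<lambda>i. ?I (take i as)) ` {..k} \<union> (\<lambda>i. ?I (take i bs)) ` {..k}"
  have "\<exists>c \<in> m. \<forall>J \<in> N. nonzerodivisor_mod R J c"
  proof (rule exists_nonzerodivisor_mod)
    show "finite N" unfolding N_def by simp
    show "ideal J R" if J: "J \<in> N" for J
    proof -
      have "set (take i as) \<subseteq> m" "set (take i bs) \<subseteq> m" for i
        using Suc.prems(3,4) set_take_subset[of i as] set_take_subset[of i bs] by blast+
      then show ?thesis using J id unfolding N_def by blast
    qed
    have nz: "\<exists>a \<in> m. nonzerodivisor_mod R (?I (take i xs)) a"
      if xs: "set xs \<subseteq> m" "weakly_regular R I xs" "i < length xs" for i xs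
      using weakly_regular_take_nonzerodivisor[OF xs(2,3)] nth_mem[OF xs(3)] xs(1)
      by (intro bexI[of _ "xs ! i"]) auto
    fix J assume "J \<in> N"
    then show "\<exists>a \<in> m. nonzerodivisor_mod R J a"
      using nz[OF Suc.prems(3,6)] nz[OF Suc.prems(4,7)] Suc.hyps(2) Suc.prems(5)
      unfolding N_def by auto
  qed fact
  then obtain c where c: "c \<in> m" and cN: "\<And>J. J \<in> N \<Longrightarrow> nonzerodivisor_mod R J c" by blast
  have ca: "nonzerodivisor_mod R (?I (take i as')) c" if "i \<le> k" for i
  proof -
    have "take i as' = take i as" using that as len by simp
    then show ?thesis using cN N_def that by auto
  qed
  have cb: "nonzerodivisor_mod R (?I (take i bs')) c" if "i \<le> k" for i
  proof -
    have "take i bs' = take i bs" using that bs len by simp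
    then show ?thesis using cN N_def that by auto
  qed
  have ca': "nonzerodivisor_mod R (?I as') c" using ca[of k] len by simp
  have cb': "nonzerodivisor_mod R (?I bs') c" using cb[of k] len by simp
  have na: "nonzerodivisor_mod R (?I as') a" "weakly_regular R I as'"
    using Suc.prems(6) as by (auto simp: weakly_regular_append)
  have nb: "nonzerodivisor_mod R (?I bs') b" "weakly_regular R I bs'"
    using Suc.prems(7) bs by (auto simp: weakly_regular_append)
  obtain w where w: "w \<in> carrier R" "w \<notin> adjoin R (?I as') c"
    "\<And>t. t \<in> m \<Longrightarrow> t \<otimes> w \<in> adjoin R (?I as') c"
    using annihilated_element_exchange[OF id[OF sets(1)] sets(3) c mc na(1) ca' Suc.prems(8)]
      Suc.prems(9,10) as by auto
  have swap: "foldl (adjoin R) (adjoin R I c) xs = adjoin R (?I xs) c" if "set xs \<subseteq> m" for xs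
    using foldl_adjoin_swap[OF Suc.prems(1)] that mc c by blast
  \<comment> \<open>With \<open>c\<close> in front, what remains are the shorter sequences
    \<open>as'\<close> and \<open>bs'\<close> over the base ideal \<open>I + c\<close>, to which the
    induction hypothesis applies; afterwards \<open>c\<close> is exchanged for
    \<open>b\<close>.\<close>
  have "\<exists>w \<in> carrier R. w \<notin> foldl (adjoin R) (adjoin R I c) bs' \<and>
           (\<forall>t \<in> m. t \<otimes> w \<in> foldl (adjoin R) (adjoin R I c) bs')"
  proof (rule Suc.hyps(1)[of as'])
    have cc: "c \<in> carrier R" "set as' \<subseteq> carrier R" "set bs' \<subseteq> carrier R" using sets c mc by auto
    show "ideal (adjoin R I c) R" using Suc.prems(1) cc(1) by (rule adjoin_ideal)
    show "weakly_regular R (adjoin R I c) as'"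
      using Suc.prems(1) cc(2,1) na(2) by (rule weakly_regular_adjoin) (simp add: ca len)
    show "weakly_regular R (adjoin R I c) bs'"
      using Suc.prems(1) cc(3,1) nb(2) by (rule weakly_regular_adjoin) (simp add: cb len)
    show "w \<notin> foldl (adjoin R) (adjoin R I c) as'" using w swap sets by simp
    show "t \<otimes> w \<in> foldl (adjoin R) (adjoin R I c) as'" if "t \<in> m" for t
      using w that swap sets by simp
  qed (use len sets w(1) Suc.prems(2) in auto)
  then obtain v where v: "v \<in> carrier R" "v \<notin> adjoin R (?I bs') c"
    "\<And>t. t \<in> m \<Longrightarrow> t \<otimes> v \<in> adjoin R (?I bs') c"
    using swap[OF sets(2)] by auto
  show ?case
    using annihilated_element_exchange[OF id[OF sets(2)] c sets(4) mc cb' nb(1) v] bs by simp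
qed

text \<open>If \<open>bs\<close> were longer, the element killed by \<open>m\<close> could be
  transferred to the quotient by the prefix of \<open>bs\<close> of the length of \<open>as\<close>;
  the next entry of \<open>bs\<close> would then kill a nonzero element and not be regular.\<close>

corollary weakly_regular_length_le:
  assumes "ideal m R" "set as \<subseteq> m" "weakly_regular R {\<zero>} as"
    and "z \<in> carrier R" "z \<notin> foldl (adjoin R) {\<zero>} as"
    and "\<And>t. t \<in> m \<Longrightarrow> t \<otimes> z \<in> foldl (adjoin R) {\<zero>} as"
    and "regular_sequence R bs" "set bs \<subseteq> m"
  shows "length bs \<le> length as"
proof (rule ccontr)
  assume "\<not> length bs \<le> length as"
  then have l: "length as < length bs" by simp
  let ?bs = "take (length as) bs" and ?b = "bs ! length as"
  have b: "weakly_regular R {\<zero>} bs" using assms(7) by (rule regular_sequence_imp_weakly_regular)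
  then have "weakly_regular R {\<zero>} (?bs @ drop (length as) bs)" by simp
  then have "weakly_regular R {\<zero>} ?bs" unfolding weakly_regular_append by blast
  moreover have "set ?bs \<subseteq> m" using assms(8) set_take_subset by fast
  ultimately obtain w where w: "w \<in> carrier R" "w \<notin> foldl (adjoin R) {\<zero>} ?bs"
    "\<And>t. t \<in> m \<Longrightarrow> t \<otimes> w \<in> foldl (adjoin R) {\<zero>} ?bs"
    using annihilated_element_transfer[OF zeroideal assms(1,2) _ _ assms(3), of ?bs z] assms(4,5,6) l
    by auto
  moreover have "?b \<in> m" using assms(8) l by (auto dest: nth_mem)
  ultimately show False
    using weakly_regular_take_nonzerodivisor[OF b l] unfolding nonzerodivisor_mod_def by blast
qed

end

section \<open>Localization\<close>

lemma (in cring) ideal_if_closed: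
  assumes "I \<subseteq> carrier R" "\<zero> \<in> I" "\<And>x y. x \<in> I \<Longrightarrow> y \<in> I \<Longrightarrow> x \<oplus> y \<in> I"
    and "\<And>c x. c \<in> carrier R \<Longrightarrow> x \<in> I \<Longrightarrow> c \<otimes> x \<in> I"
  shows "ideal I R"
proof (rule idealI[OF ring_axioms])
  show "subgroup I (add_monoid R)"
  proof (rule add.subgroupI)
    fix x assume x: "x \<in> I"
    then have "(\<ominus> \<one>) \<otimes> x \<in> I" using assms(4) by simp
    then show "\<ominus> x \<in> I" using x assms(1) by (simp add: l_minus subsetD)
  qed (use assms in auto)
next
  fix a x assume "a \<in> I" "x \<in> carrier R"
  then show "x \<otimes> a \<in> I" "a \<otimes> x \<in> I" using assms(1,4) m_comm[of a x] by auto
qed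

locale denominators = cring R for R (structure) +
  fixes S
  assumes S_closed: "S \<subseteq> carrier R" and one_S: "\<one> \<in> S"
    and mult_S: "s \<in> S \<Longrightarrow> t \<in> S \<Longrightarrow> s \<otimes> t \<in> S"
begin

abbreviation frac where "frac a s \<equiv> fraction R S a s"
abbreviation fracs where "fracs \<equiv> ring_of_fractions R S"

lemma S_carrier [simp, intro]: "s \<in> S \<Longrightarrow> s \<in> carrier R"
  using S_closed by blast

lemma mem_fraction:
  "(b, t) \<in> frac a s \<longleftrightarrow>
     b \<in> carrier R \<and> t \<in> S \<and> (\<exists>u \<in> S. u \<otimes> (a \<otimes> t \<ominus> b \<otimes> s) = \<zero>)"
  unfolding fraction_def by simp

lemma fraction_trans:
  assumes "a \<in> carrier R" "s \<in> S" "(b, t) \<in> frac a s" "(c, r) \<in> frac b t"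
  shows "(c, r) \<in> frac a s"
proof -
  obtain u where u: "b \<in> carrier R" "t \<in> S" "u \<in> S" "u \<otimes> (a \<otimes> t \<ominus> b \<otimes> s) = \<zero>"
    using assms(3) mem_fraction by auto
  obtain v where v: "c \<in> carrier R" "r \<in> S" "v \<in> S" "v \<otimes> (b \<otimes> r \<ominus> c \<otimes> t) = \<zero>"
    using assms(4) mem_fraction by auto
  \<comment> \<open>The denominator \<open>t\<close> of the middle fraction is part of the witness:
    the two relations can be combined only after multiplying through by it.\<close>
  have "(u \<otimes> v \<otimes> t) \<otimes> (a \<otimes> r \<ominus> c \<otimes> s) =
      v \<otimes> r \<otimes> (u \<otimes> (a \<otimes> t \<ominus> b \<otimes> s)) \<oplus> u \<otimes> s \<otimes> (v \<otimes> (b \<otimes> r \<ominus> c \<otimes> t))"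
    using u(1-3) v(1-3) assms(1,2) S_closed[THEN subsetD] by algebra
  also have "\<dots> = \<zero>" unfolding u(4) v(4) using u(1-3) v(1-3) assms(1,2) by simp
  finally show ?thesis using u v mult_S mem_fraction by blast
qed

lemma fraction_sym:
  assumes "a \<in> carrier R" "s \<in> S" "(b, t) \<in> frac a s"
  shows "(a, s) \<in> frac b t"
proof -
  obtain u where u: "b \<in> carrier R" "t \<in> S" "u \<in> S" "u \<otimes> (a \<otimes> t \<ominus> b \<otimes> s) = \<zero>"
    using assms(3) mem_fraction by auto
  have "u \<otimes> (b \<otimes> s \<ominus> a \<otimes> t) = \<ominus> (u \<otimes> (a \<otimes> t \<ominus> b \<otimes> s))"
    using u(1-3) assms(1,2) S_closed[THEN subsetD] by algebra
  then show ?thesis using u assms mem_fraction by auto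
qed

lemma fraction_eq_iff:
  assumes "a \<in> carrier R" "s \<in> S" "b \<in> carrier R" "t \<in> S"
  shows "frac a s = frac b t \<longleftrightarrow> (b, t) \<in> frac a s"
proof
  have "(b, t) \<in> frac b t"
    unfolding mem_fraction using assms one_S
    by (auto intro!: bexI[of _ \<one>] simp: a_minus_def r_neg)
  then show "frac a s = frac b t \<Longrightarrow> (b, t) \<in> frac a s" by simp
next
  assume *: "(b, t) \<in> frac a s"
  show "frac a s = frac b t"
    using fraction_trans[OF assms(1,2) *] fraction_trans[OF assms(3,4) fraction_sym[OF assms(1,2) *]]
    by auto
qed

lemma fraction_eqI:
  assumes "a \<in> carrier R" "s \<in> S" "b \<in> carrier R" "t \<in> S" "u \<in> S"
    and "u \<otimes> (a \<otimes> t \<ominus> b \<otimes> s) = \<zero>"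
  shows "frac a s = frac b t"
  unfolding fraction_eq_iff[OF assms(1-4)] mem_fraction using assms by blast

lemma fraction_refl: "a \<in> carrier R \<Longrightarrow> s \<in> S \<Longrightarrow> (a, s) \<in> frac a s"
  using fraction_eq_iff by blast

lemma fraction_cancel:
  assumes "a \<in> carrier R" "s \<in> S" "u \<in> S"
  shows "frac (u \<otimes> a) (u \<otimes> s) = frac a s"
proof (rule fraction_eqI[of _ _ _ _ \<one>])
  have "\<one> \<otimes> (u \<otimes> a \<otimes> s \<ominus> a \<otimes> (u \<otimes> s)) = \<zero>" using assms S_closed[THEN subsetD] by algebra
  then show "\<one> \<otimes> (u \<otimes> a \<otimes> s \<ominus> a \<otimes> (u \<otimes> s)) = \<zero>" .
qed (use assms one_S mult_S in auto)

lemma mult_fraction_rep: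
  assumes "a \<in> carrier R" "s \<in> S" "b \<in> carrier R" "t \<in> S" "(a', s') \<in> frac a s" "(b', t') \<in> frac b t"
  shows "frac (a' \<otimes> b') (s' \<otimes> t') = frac (a \<otimes> b) (s \<otimes> t)"
proof -
  obtain u where u: "a' \<in> carrier R" "s' \<in> S" "u \<in> S" "u \<otimes> (a \<otimes> s' \<ominus> a' \<otimes> s) = \<zero>"
    using assms(5) mem_fraction by auto
  obtain v where v: "b' \<in> carrier R" "t' \<in> S" "v \<in> S" "v \<otimes> (b \<otimes> t' \<ominus> b' \<otimes> t) = \<zero>"
    using assms(6) mem_fraction by auto
  have "(u \<otimes> v) \<otimes> (a \<otimes> b \<otimes> (s' \<otimes> t') \<ominus> a' \<otimes> b' \<otimes> (s \<otimes> t)) =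
      v \<otimes> b \<otimes> t' \<otimes> (u \<otimes> (a \<otimes> s' \<ominus> a' \<otimes> s)) \<oplus> u \<otimes> a' \<otimes> s \<otimes> (v \<otimes> (b \<otimes> t' \<ominus> b' \<otimes> t))"
    using u(1-3) v(1-3) assms(1-4) S_closed[THEN subsetD] by algebra
  also have "\<dots> = \<zero>" unfolding u(4) v(4) using u(1-3) v(1-3) assms(1-4) by simp
  finally show ?thesis
    using u(1-3) v(1-3) assms(1-4) mult_S
    by (intro fraction_eqI[symmetric, of _ _ _ _ "u \<otimes> v"]) auto
qed

lemma add_fraction_rep:
  assumes "a \<in> carrier R" "s \<in> S" "b \<in> carrier R" "t \<in> S" "(a', s') \<in> frac a s" "(b', t') \<in> frac b t"
  shows "frac (a' \<otimes> t' \<oplus> b' \<otimes> s') (s' \<otimes> t') = frac (a \<otimes> t \<oplus> b \<otimes> s) (s \<otimes> t)"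
proof -
  obtain u where u: "a' \<in> carrier R" "s' \<in> S" "u \<in> S" "u \<otimes> (a \<otimes> s' \<ominus> a' \<otimes> s) = \<zero>"
    using assms(5) mem_fraction by auto
  obtain v where v: "b' \<in> carrier R" "t' \<in> S" "v \<in> S" "v \<otimes> (b \<otimes> t' \<ominus> b' \<otimes> t) = \<zero>"
    using assms(6) mem_fraction by auto
  have "(u \<otimes> v) \<otimes> ((a \<otimes> t \<oplus> b \<otimes> s) \<otimes> (s' \<otimes> t') \<ominus> (a' \<otimes> t' \<oplus> b' \<otimes> s') \<otimes> (s \<otimes> t)) =
      v \<otimes> t \<otimes> t' \<otimes> (u \<otimes> (a \<otimes> s' \<ominus> a' \<otimes> s)) \<oplus> u \<otimes> s \<otimes> s' \<otimes> (v \<otimes> (b \<otimes> t' \<ominus> b' \<otimes> t))"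
    using u(1-3) v(1-3) assms(1-4) S_closed[THEN subsetD] by algebra
  also have "\<dots> = \<zero>" unfolding u(4) v(4) using u(1-3) v(1-3) assms(1-4) by simp
  finally show ?thesis
    using u(1-3) v(1-3) assms(1-4) mult_S
    by (intro fraction_eqI[symmetric, of _ _ _ _ "u \<otimes> v"]) auto
qed

lemma mult_fraction:
  assumes "a \<in> carrier R" "s \<in> S" "b \<in> carrier R" "t \<in> S"
  shows "frac a s \<otimes>\<^bsub>fracs\<^esub> frac b t = frac (a \<otimes> b) (s \<otimes> t)"
proof -
  have "(\<Union>(b', t')\<in>frac b t. frac (a' \<otimes> b') (s' \<otimes> t')) = frac (a \<otimes> b) (s \<otimes> t)"
    if "(a', s') \<in> frac a s" for a' s'
    using mult_fraction_rep[OF assms that] fraction_refl[OF assms(3,4)] by fastforce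
  then have "(\<Union>(a', s')\<in>frac a s. \<Union>(b', t')\<in>frac b t. frac (a' \<otimes> b') (s' \<otimes> t')) =
      (\<Union>(a', s')\<in>frac a s. frac (a \<otimes> b) (s \<otimes> t))"
    by (intro SUP_cong) auto
  also have "\<dots> = frac (a \<otimes> b) (s \<otimes> t)" using fraction_refl[OF assms(1,2)] by auto
  finally show ?thesis unfolding ring_of_fractions_def by simp
qed

lemma add_fraction:
  assumes "a \<in> carrier R" "s \<in> S" "b \<in> carrier R" "t \<in> S"
  shows "frac a s \<oplus>\<^bsub>fracs\<^esub> frac b t = frac (a \<otimes> t \<oplus> b \<otimes> s) (s \<otimes> t)"
proof -
  have "(\<Union>(b', t')\<in>frac b t. frac (a' \<otimes> t' \<oplus> b' \<otimes> s') (s' \<otimes> t')) =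
      frac (a \<otimes> t \<oplus> b \<otimes> s) (s \<otimes> t)"
    if "(a', s') \<in> frac a s" for a' s'
    using add_fraction_rep[OF assms that] fraction_refl[OF assms(3,4)] by fastforce
  then have "(\<Union>(a', s')\<in>frac a s. \<Union>(b', t')\<in>frac b t. frac (a' \<otimes> t' \<oplus> b' \<otimes> s') (s' \<otimes> t')) =
      (\<Union>(a', s')\<in>frac a s. frac (a \<otimes> t \<oplus> b \<otimes> s) (s \<otimes> t))"
    by (intro SUP_cong) auto
  also have "\<dots> = frac (a \<otimes> t \<oplus> b \<otimes> s) (s \<otimes> t)" using fraction_refl[OF assms(1,2)] by auto
  finally show ?thesis unfolding ring_of_fractions_def by simp
qed

lemma zero_fracs: "\<zero>\<^bsub>fracs\<^esub> = frac \<zero> \<one>" and one_fracs: "\<one>\<^bsub>fracs\<^esub> = frac \<one> \<one>"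
  unfolding ring_of_fractions_def by simp_all

lemma fraction_in_fracs [simp]: "a \<in> carrier R \<Longrightarrow> s \<in> S \<Longrightarrow> frac a s \<in> carrier fracs"
  unfolding ring_of_fractions_def by auto

lemma fracsE:
  assumes "x \<in> carrier fracs"
  obtains a s where "a \<in> carrier R" "s \<in> S" "x = frac a s"
  using assms unfolding ring_of_fractions_def by auto

lemma zero_fraction: "s \<in> S \<Longrightarrow> frac \<zero> s = \<zero>\<^bsub>fracs\<^esub>"
  unfolding zero_fracs using one_S by (intro fraction_eqI[of _ _ _ _ \<one>]) (auto simp: a_minus_def)

definition extension :: "'a set \<Rightarrow> ('a \<times> 'a) set set" where
  "extension I = {frac a s | a s. a \<in> I \<and> s \<in> S}"

lemma extensionI: "a \<in> I \<Longrightarrow> s \<in> S \<Longrightarrow> frac a s \<in> extension I"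
  unfolding extension_def by blast

text \<open>The fraction may lie in the extended ideal through another representative, so
  \<open>x\<close> itself need not lie in \<open>I\<close>. For a prime disjoint from
  \<open>S\<close> the multiplier \<open>u\<close> can be cancelled.\<close>

lemma fraction_in_extension_iff:
  assumes "ideal I R" "x \<in> carrier R" "s \<in> S"
  shows "frac x s \<in> extension I \<longleftrightarrow> (\<exists>u \<in> S. u \<otimes> x \<in> I)"
proof
  interpret I: ideal I R by fact
  assume "frac x s \<in> extension I"
  then obtain a t where a: "a \<in> I" "t \<in> S" "frac x s = frac a t" unfolding extension_def by blast
  then have "(a, t) \<in> frac x s" using fraction_eq_iff assms I.Icarr by blast
  then obtain u where u: "u \<in> S" "u \<otimes> (x \<otimes> t \<ominus> a \<otimes> s) = \<zero>" unfolding mem_fraction by blast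
  have "(u \<otimes> t) \<otimes> x = u \<otimes> (x \<otimes> t \<ominus> a \<otimes> s) \<oplus> (u \<otimes> s) \<otimes> a"
    using u(1) a(1,2) assms(2,3) I.Icarr S_closed[THEN subsetD] by algebra
  also have "\<dots> \<in> I" unfolding u(2) using a(1) u(1) assms(3) I.I_l_closed I.Icarr by simp
  finally show "\<exists>u \<in> S. u \<otimes> x \<in> I" using mult_S u(1) a(2) by blast
next
  assume "\<exists>u \<in> S. u \<otimes> x \<in> I"
  then obtain u where u: "u \<in> S" "u \<otimes> x \<in> I" by blast
  have "frac x s = frac (u \<otimes> x) (u \<otimes> s)" using fraction_cancel u assms by simp
  then show "frac x s \<in> extension I" using extensionI[OF u(2)] u(1) assms(3) mult_S by simp
qed

lemma extension_zero: "extension {\<zero>} = {\<zero>\<^bsub>fracs\<^esub>}"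
  unfolding extension_def using zero_fraction one_S by auto

text \<open>That the fractions form a commutative ring is a hypothesis here; it is a component of
  \<open>cohen_macaulay_local\<close> and comes with every localization considered.\<close>

lemma extension_ideal:
  assumes B: "cring fracs" and I: "ideal I R"
  shows "ideal (extension I) fracs"
proof (rule cring.ideal_if_closed[OF B])
  interpret I: ideal I R by fact
  show "extension I \<subseteq> carrier fracs" unfolding extension_def using I.Icarr by auto
  show "\<zero>\<^bsub>fracs\<^esub> \<in> extension I" unfolding extension_def zero_fracs using I.zero_mem one_S by blast
  fix x assume "x \<in> extension I"
  then obtain a s where x: "a \<in> I" "s \<in> S" "x = frac a s" unfolding extension_def by blast
  {
    fix y assume "y \<in> extension I"
    then obtain b t where y: "b \<in> I" "t \<in> S" "y = frac b t" unfolding extension_def by blast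
    have "x \<oplus>\<^bsub>fracs\<^esub> y = frac (a \<otimes> t \<oplus> b \<otimes> s) (s \<otimes> t)" using add_fraction x y I.Icarr by simp
    then show "x \<oplus>\<^bsub>fracs\<^esub> y \<in> extension I"
      using x y mult_S by (simp add: extensionI I.I_r_closed I.a_closed)
  next
    fix c assume "c \<in> carrier fracs"
    then obtain b t where c: "b \<in> carrier R" "t \<in> S" "c = frac b t" by (rule fracsE)
    have "c \<otimes>\<^bsub>fracs\<^esub> x = frac (b \<otimes> a) (t \<otimes> s)" using mult_fraction x c I.Icarr by simp
    then show "c \<otimes>\<^bsub>fracs\<^esub> x \<in> extension I"
      using x c mult_S by (simp add: extensionI I.I_l_closed)
  }
qed

lemma adjoin_extension:
  assumes I: "ideal I R" and a: "a \<in> carrier R"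
  shows "adjoin fracs (extension I) (frac a \<one>) = extension (adjoin R I a)"
proof
  interpret I: ideal I R by fact
  show "adjoin fracs (extension I) (frac a \<one>) \<subseteq> extension (adjoin R I a)"
  proof
    fix x assume "x \<in> adjoin fracs (extension I) (frac a \<one>)"
    then obtain i r where x: "i \<in> extension I" "r \<in> carrier fracs"
      "x = i \<oplus>\<^bsub>fracs\<^esub> frac a \<one> \<otimes>\<^bsub>fracs\<^esub> r" unfolding adjoin_def by blast
    obtain j s where i: "j \<in> I" "s \<in> S" "i = frac j s" using x(1) unfolding extension_def by blast
    obtain b t where r: "b \<in> carrier R" "t \<in> S" "r = frac b t" using x(2) by (rule fracsE)
    have "x = frac (j \<otimes> t \<oplus> (a \<otimes> b) \<otimes> s) (s \<otimes> t)"
      using x(3) i r a I.Icarr one_S by (simp add: mult_fraction add_fraction)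
    moreover have "j \<otimes> t \<oplus> (a \<otimes> b) \<otimes> s = j \<otimes> t \<oplus> a \<otimes> (b \<otimes> s)"
      using i r a by (simp add: m_assoc)
    moreover have "j \<otimes> t \<in> I" using i r I.I_r_closed by simp
    ultimately show "x \<in> extension (adjoin R I a)"
      using extensionI adjoinI[of "j \<otimes> t" I "b \<otimes> s" a] i r mult_S by simp
  qed
  show "extension (adjoin R I a) \<subseteq> adjoin fracs (extension I) (frac a \<one>)"
  proof
    fix x assume "x \<in> extension (adjoin R I a)"
    then obtain y s where x: "y \<in> adjoin R I a" "s \<in> S" "x = frac y s" unfolding extension_def by blast
    obtain i r where y: "i \<in> I" "r \<in> carrier R" "y = i \<oplus> a \<otimes> r" using x(1) by (rule adjoinE)
    have "frac i s \<oplus>\<^bsub>fracs\<^esub> frac a \<one> \<otimes>\<^bsub>fracs\<^esub> frac r s = frac (i \<otimes> s \<oplus> a \<otimes> r \<otimes> s) (s \<otimes> s)"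
      using x(2) y a I.Icarr one_S by (simp add: mult_fraction add_fraction)
    also have "i \<otimes> s \<oplus> a \<otimes> r \<otimes> s = s \<otimes> y" using x(2) y a I.Icarr by (simp add: r_distr m_comm m_assoc m_lcomm)
    also have "frac (s \<otimes> y) (s \<otimes> s) = x" using fraction_cancel x(2,3) y a I.Icarr by simp
    finally have "x = frac i s \<oplus>\<^bsub>fracs\<^esub> frac a \<one> \<otimes>\<^bsub>fracs\<^esub> frac r s" by simp
    moreover have "frac i s \<in> extension I" unfolding extension_def using y x(2) by blast
    moreover have "frac r s \<in> carrier fracs" using y(2) x(2) by simp
    ultimately show "x \<in> adjoin fracs (extension I) (frac a \<one>)" unfolding adjoin_def by blast
  qed
qed

text \<open>Flatness of localization in elementary form: clearing the denominator \<open>u\<close>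
  moves the relation to \<open>a (u b)\<close> in \<open>I\<close>, where regularity of
  \<open>a\<close> in \<open>R\<close> applies.\<close>

lemma nonzerodivisor_mod_extension:
  assumes I: "ideal I R" and a: "a \<in> carrier R" and nz: "nonzerodivisor_mod R I a"
  shows "nonzerodivisor_mod fracs (extension I) (frac a \<one>)"
  unfolding nonzerodivisor_mod_def
proof (intro ballI impI)
  fix x assume x: "x \<in> carrier fracs" "frac a \<one> \<otimes>\<^bsub>fracs\<^esub> x \<in> extension I"
  obtain b t where b: "b \<in> carrier R" "t \<in> S" "x = frac b t" using x(1) by (rule fracsE)
  then have "frac (a \<otimes> b) t \<in> extension I" using x(2) a one_S by (simp add: mult_fraction)
  then obtain u where u: "u \<in> S" "u \<otimes> (a \<otimes> b) \<in> I"
    using fraction_in_extension_iff[OF I] a b by auto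
  then have "a \<otimes> (u \<otimes> b) \<in> I" using a b by (simp add: m_lcomm)
  then have "u \<otimes> b \<in> I" using nz u b unfolding nonzerodivisor_mod_def by simp
  then show "x \<in> extension I" using fraction_in_extension_iff[OF I] b u by auto
qed

lemma foldl_adjoin_extension:
  assumes "ideal I R" "set as \<subseteq> carrier R"
  shows "foldl (adjoin fracs) (extension I) (map (\<lambda>a. frac a \<one>) as) =
    extension (foldl (adjoin R) I as)"
  using assms by (induction as arbitrary: I) (auto simp: adjoin_extension adjoin_ideal)

lemma weakly_regular_extension:
  assumes "ideal I R" "set as \<subseteq> carrier R" "weakly_regular R I as"
  shows "weakly_regular fracs (extension I) (map (\<lambda>a. frac a \<one>) as)"
  using assms
  by (induction as arbitrary: I)
    (auto simp: adjoin_extension adjoin_ideal nonzerodivisor_mod_extension)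

lemma extension_prime:
  assumes B: "cring fracs" and c: "primeideal c R" and cS: "c \<inter> S = {}"
  shows "primeideal (extension c) fracs"
    and "a \<in> carrier R \<Longrightarrow> s \<in> S \<Longrightarrow> frac a s \<in> extension c \<longleftrightarrow> a \<in> c"
proof -
  interpret c: primeideal c R by fact
  show iff: "frac a s \<in> extension c \<longleftrightarrow> a \<in> c" if as: "a \<in> carrier R" "s \<in> S" for a s
  proof -
    have "u \<otimes> a \<in> c \<longleftrightarrow> a \<in> c" if u: "u \<in> S" for u
      using c.I_prime[of u a] c.I_l_closed[of a u] cS u as by auto
    then show ?thesis using fraction_in_extension_iff[OF c.is_ideal as] one_S by blast
  qed
  show "primeideal (extension c) fracs"
  proof (rule primeidealI[OF extension_ideal[OF B c.is_ideal] B])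
    have "frac \<one> \<one> \<notin> extension c" using iff[of \<one> \<one>] one_S cS by blast
    moreover have "frac \<one> \<one> \<in> carrier fracs" using one_S by simp
    ultimately show "carrier fracs \<noteq> extension c" by blast
    fix x y assume x: "x \<in> carrier fracs" and y: "y \<in> carrier fracs"
      and xy: "x \<otimes>\<^bsub>fracs\<^esub> y \<in> extension c"
    obtain a s where a: "a \<in> carrier R" "s \<in> S" "x = frac a s" using x by (rule fracsE)
    obtain b t where b: "b \<in> carrier R" "t \<in> S" "y = frac b t" using y by (rule fracsE)
    have "frac (a \<otimes> b) (s \<otimes> t) \<in> extension c" using xy a b by (simp add: mult_fraction)
    then have "a \<otimes> b \<in> c" using iff a b mult_S by simp
    then show "x \<in> extension c \<or> y \<in> extension c" using c.I_prime a b iff by simp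
  qed
qed

end

section \<open>Heights of primes and the Cohen-Macaulay property\<close>

lemma le_prime_height:
  assumes "\<And>i. i \<le> n \<Longrightarrow> primeideal (c i) R" "\<And>i. i < n \<Longrightarrow> c i \<subset> c (Suc i)" "c n = q"
  shows "enat n \<le> prime_height R q"
  unfolding prime_height_def using assms by (intro SUP_upper) blast

lemma prime_height_le:
  assumes "\<And>n c. (\<And>i. i \<le> n \<Longrightarrow> primeideal (c i) R) \<Longrightarrow> (\<And>i. i < n \<Longrightarrow> c i \<subset> c (Suc i)) \<Longrightarrow>
     c n = q \<Longrightarrow> enat n \<le> h"
  shows "prime_height R q \<le> h"
  unfolding prime_height_def using assms by (intro SUP_least) blast

text \<open>Unmixedness: \<open>q\<close> is an associated prime of the quotient by
  \<open>as\<close>. After localizing at \<open>q\<close> the image of \<open>z\<close> is still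
  nonzero and is killed by the maximal ideal, so no regular sequence there is longer than
  \<open>as\<close>. The Cohen-Macaulay property turns this bound on the depth into one on the
  dimension, and chains of primes below \<open>q\<close> survive the localization.\<close>

theorem (in cring) cohen_macaulay_height_le:
  assumes CM: "cohen_macaulay R" and q: "primeideal q R"
    and as: "set as \<subseteq> carrier R" "weakly_regular R {\<zero>} as"
    and z: "z \<in> carrier R" "z \<notin> foldl (adjoin R) {\<zero>} as"
    and qz: "q = {a \<in> carrier R. a \<otimes> z \<in> foldl (adjoin R) {\<zero>} as}"
  shows "prime_height R q \<le> enat (length as)"
proof -
  interpret q: primeideal q R by fact
  interpret denominators R "carrier R - q"
  proof
    show "\<one> \<in> carrier R - q" using q.I_notcarr q.one_imp_carrier by auto
    show "s \<otimes> t \<in> carrier R - q" if "s \<in> carrier R - q" "t \<in> carrier R - q" for s t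
      using that q.I_prime by auto
  qed auto
  define I where "I = foldl (adjoin R) {\<zero>} as"
  have I: "ideal I R" unfolding I_def using zeroideal as(1) by (rule foldl_adjoin_ideal)
  have "cohen_macaulay_local fracs"
    using CM q unfolding cohen_macaulay_def localization_def by blast
  then obtain m where B: "cring fracs" "noetherian_ring fracs"
    and m: "{m'. maximalideal m' fracs} = {m}" "depth fracs m = krull_dim fracs"
    unfolding cohen_macaulay_local_def by blast
  interpret B: cring fracs by (rule B)
  interpret B: noetherian_cring fracs using B by (simp add: noetherian_cring_def)
  interpret m: maximalideal m fracs using m(1) by blast
  \<comment> \<open>A fraction with numerator outside \<open>q\<close> is a unit and cannot lie in
    the maximal ideal. This inclusion suffices, since the length bound is applied to the ideal
    \<open>extension q\<close>.\<close>
  have m_sub: "m \<subseteq> extension q"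
  proof
    fix x assume x: "x \<in> m"
    then have "x \<in> carrier fracs" by (rule m.Icarr)
    then obtain a s where a: "a \<in> carrier R" "s \<in> carrier R - q" "x = frac a s" by (rule fracsE)
    have "a \<in> q"
    proof (rule ccontr)
      assume "a \<notin> q"
      then have aS: "a \<in> carrier R - q" using a by simp
      have "frac s a \<otimes>\<^bsub>fracs\<^esub> x = frac (s \<otimes> a) (a \<otimes> s)"
        unfolding a(3) using a(1,2) aS by (intro mult_fraction) auto
      also have "\<dots> = \<one>\<^bsub>fracs\<^esub>" unfolding one_fracs
      proof (rule fraction_eqI[of _ _ _ _ \<one>])
        show "\<one> \<otimes> (s \<otimes> a \<otimes> \<one> \<ominus> \<one> \<otimes> (a \<otimes> s)) = \<zero>" using a(1,2) by (simp add: m_comm a_minus_def r_neg)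
      qed (use a aS one_S mult_S in auto)
      finally have "\<one>\<^bsub>fracs\<^esub> \<in> m" using m.I_l_closed[OF x, of "frac s a"] a(2) aS by simp
      then show False using m.I_notcarr m.one_imp_carrier by blast
    qed
    then show "x \<in> extension q" unfolding extension_def using a by blast
  qed
  let ?as = "map (\<lambda>a. frac a \<one>) as"
  have fold: "foldl (adjoin fracs) {\<zero>\<^bsub>fracs\<^esub>} ?as = extension I"
    using foldl_adjoin_extension[OF zeroideal as(1)] I_def by (simp add: extension_zero)
  have "depth fracs m \<le> enat (length as)"
    unfolding depth_def
  proof (rule SUP_least)
    fix bs assume bs: "bs \<in> {xs. regular_sequence fracs xs \<and> set xs \<subseteq> m}"
    have "length bs \<le> length ?as"
    proof (rule B.weakly_regular_length_le)
      show "ideal (extension q) fracs" by (rule extension_ideal[OF B(1) q.is_ideal])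
      show "weakly_regular fracs {\<zero>\<^bsub>fracs\<^esub>} ?as"
        using weakly_regular_extension[OF zeroideal as] by (simp add: extension_zero)
      \<comment> \<open>An entry of \<open>as\<close> lies in \<open>I\<close>, hence multiplies
        \<open>z\<close> into \<open>I\<close>, and \<open>q\<close> is the whole annihilator of
        \<open>z\<close>.\<close>
      have "a \<in> q" if "a \<in> set as" for a
      proof -
        have "set as \<subseteq> I" unfolding I_def foldl_adjoin_eq_genideal[OF as(1)] using as(1) by (rule genideal_self)
        then show ?thesis using that as(1) z(1) ideal.I_r_closed[OF I, of a z] unfolding qz I_def by blast
      qed
      then show "set ?as \<subseteq> extension q" unfolding extension_def using one_S by auto
      show "frac z \<one> \<in> carrier fracs" using z(1) one_S by simp
      \<comment> \<open>If the fraction vanished, some denominator \<open>u\<close> would satisfy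
        \<open>u z\<close> in \<open>I\<close> and thus belong to \<open>q\<close>.\<close>
      show "frac z \<one> \<notin> foldl (adjoin fracs) {\<zero>\<^bsub>fracs\<^esub>} ?as"
        unfolding fold fraction_in_extension_iff[OF I z(1) one_S] using qz I_def by blast
      fix t assume "t \<in> extension q"
      then obtain a s where a: "a \<in> q" "s \<in> carrier R - q" "t = frac a s"
        unfolding extension_def by blast
      have "t \<otimes>\<^bsub>fracs\<^esub> frac z \<one> = frac (a \<otimes> z) s"
        using a z(1) one_S q.Icarr by (simp add: mult_fraction)
      moreover have "a \<otimes> z \<in> I" using a(1) qz I_def by blast
      ultimately show "t \<otimes>\<^bsub>fracs\<^esub> frac z \<one> \<in> foldl (adjoin fracs) {\<zero>\<^bsub>fracs\<^esub>} ?as"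
        unfolding fold extension_def using a(2) by blast
    qed (use bs m_sub in auto)
    then show "enat (length bs) \<le> enat (length as)" by simp
  qed
  moreover have "prime_height R q \<le> krull_dim fracs"
  proof (rule prime_height_le)
    fix n c assume c: "\<And>i. i \<le> n \<Longrightarrow> primeideal (c i) R" "\<And>i. i < n \<Longrightarrow> c i \<subset> c (Suc i)" "c n = q"
    have sub: "c i \<subseteq> q" if "i \<le> n" for i
    proof -
      have "c i \<subseteq> c n" using that
      proof (induction rule: inc_induct)
        case (step k)
        then show ?case using c(2)[of k] by blast
      qed simp
      then show ?thesis using c(3) by simp
    qed
    then have disj: "c i \<inter> (carrier R - q) = {}" if "i \<le> n" for i using that by blast
    note prime = extension_prime[OF B(1) c(1) disj]
    have "enat n \<le> prime_height fracs (extension q)"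
    proof (rule le_prime_height)
      show "primeideal (extension (c i)) fracs" if "i \<le> n" for i using prime(1)[OF that that] .
      show "extension (c n) = extension q" using c(3) by simp
      fix i assume i: "i < n"
      then obtain a where a: "a \<in> c (Suc i)" "a \<notin> c i" using c(2) by blast
      then have ac: "a \<in> carrier R"
        using ideal.Icarr[OF primeideal.axioms(1)[OF c(1)[of "Suc i"]]] i by simp
      have "frac a \<one> \<in> extension (c (Suc i))" "frac a \<one> \<notin> extension (c i)"
        using prime(2)[of "Suc i" a \<one>] prime(2)[of i a \<one>] a ac i one_S by auto
      moreover have "extension (c i) \<subseteq> extension (c (Suc i))"
        unfolding extension_def using c(2)[OF i] by blast
      ultimately show "extension (c i) \<subset> extension (c (Suc i))" by blast
    qed
    also have "\<dots> \<le> krull_dim fracs"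
      unfolding krull_dim_def using prime(1)[of n] c(3) by (intro SUP_upper) simp
    finally show "enat n \<le> krull_dim fracs" .
  qed
  ultimately show ?thesis using m(2) by simp
qed

section \<open>Finite groups acting on rings\<close>

locale finite_ring_action = cring R + G: group G
  for R (structure) and G :: "('g, 'b) monoid_scheme" and \<phi> +
  assumes finite_G: "finite (carrier G)" and action: "ring_action G R \<phi>"
begin

abbreviation A where "A \<equiv> invariant_ring G R \<phi>"

sublocale act: group_action G "carrier R" \<phi>
  using action unfolding ring_action_def by blast

lemma act_ring_hom: "g \<in> carrier G \<Longrightarrow> \<phi> g \<in> ring_hom R R"
  using action unfolding ring_action_def ring_action_axioms_def by blast

lemma act_closed [simp]: "g \<in> carrier G \<Longrightarrow> x \<in> carrier R \<Longrightarrow> \<phi> g x \<in> carrier R"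
  by (rule ring_hom_closed[OF act_ring_hom])

lemma act_add [simp]:
  "g \<in> carrier G \<Longrightarrow> x \<in> carrier R \<Longrightarrow> y \<in> carrier R \<Longrightarrow> \<phi> g (x \<oplus> y) = \<phi> g x \<oplus> \<phi> g y"
  by (rule ring_hom_add[OF act_ring_hom])

lemma act_mult [simp]:
  "g \<in> carrier G \<Longrightarrow> x \<in> carrier R \<Longrightarrow> y \<in> carrier R \<Longrightarrow> \<phi> g (x \<otimes> y) = \<phi> g x \<otimes> \<phi> g y"
  by (rule ring_hom_mult[OF act_ring_hom])

lemma act_one [simp]: "g \<in> carrier G \<Longrightarrow> \<phi> g \<one> = \<one>"
  by (rule ring_hom_one[OF act_ring_hom])

lemma act_zero [simp]: "g \<in> carrier G \<Longrightarrow> \<phi> g \<zero> = \<zero>"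
  by (rule ring_hom_zero[OF act_ring_hom ring_axioms ring_axioms])

lemma act_ring_hom_cring: "g \<in> carrier G \<Longrightarrow> ring_hom_cring R R (\<phi> g)"
  by (intro ring_hom_cringI ring_hom_ringI2 cring_axioms ring_axioms act_ring_hom)

lemma act_minus [simp]: "g \<in> carrier G \<Longrightarrow> x \<in> carrier R \<Longrightarrow> \<phi> g (\<ominus> x) = \<ominus> \<phi> g x"
  using ring_hom_cring.hom_a_inv[OF act_ring_hom_cring] by simp

lemma act_diff [simp]:
  "g \<in> carrier G \<Longrightarrow> x \<in> carrier R \<Longrightarrow> y \<in> carrier R \<Longrightarrow> \<phi> g (x \<ominus> y) = \<phi> g x \<ominus> \<phi> g y"
  by (simp add: a_minus_def)

lemma act_pow [simp]: "g \<in> carrier G \<Longrightarrow> x \<in> carrier R \<Longrightarrow> \<phi> g (x [^] (n :: nat)) = \<phi> g x [^] n"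
  by (induction n) simp_all

lemma act_finsum:
  "g \<in> carrier G \<Longrightarrow> f \<in> B \<rightarrow> carrier R \<Longrightarrow> \<phi> g (finsum R f B) = finsum R (\<phi> g \<circ> f) B"
  by (rule ring_hom_cring.hom_finsum[OF act_ring_hom_cring])

lemma act_finprod:
  "g \<in> carrier G \<Longrightarrow> f \<in> B \<rightarrow> carrier R \<Longrightarrow> \<phi> g (finprod R f B) = finprod R (\<phi> g \<circ> f) B"
  by (rule ring_hom_cring.hom_finprod[OF act_ring_hom_cring])

lemma act_comp:
  "g \<in> carrier G \<Longrightarrow> h \<in> carrier G \<Longrightarrow> x \<in> carrier R \<Longrightarrow> \<phi> (g \<otimes>\<^bsub>G\<^esub> h) x = \<phi> g (\<phi> h x)"
  using act.composition_rule by simp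

lemma act_id [simp]: "x \<in> carrier R \<Longrightarrow> \<phi> \<one>\<^bsub>G\<^esub> x = x"
  using act.id_eq_one by (metis restrict_apply')

lemma act_inv [simp]:
  assumes "g \<in> carrier G" "x \<in> carrier R"
  shows "\<phi> g (\<phi> (inv\<^bsub>G\<^esub> g) x) = x" "\<phi> (inv\<^bsub>G\<^esub> g) (\<phi> g x) = x"
  using assms act_comp[of g "inv\<^bsub>G\<^esub> g" x] act_comp[of "inv\<^bsub>G\<^esub> g" g x] by simp_all

lemma carrier_A: "carrier A = {r \<in> carrier R. \<forall>g \<in> carrier G. \<phi> g r = r}"
  unfolding invariant_ring_def by simp

lemma A_simps [simp]:
  "monoid.mult A = monoid.mult R" "\<one>\<^bsub>A\<^esub> = \<one>" "\<zero>\<^bsub>A\<^esub> = \<zero>" "ring.add A = ring.add R"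
  unfolding invariant_ring_def by simp_all

lemma in_A_carrier [simp]: "x \<in> carrier A \<Longrightarrow> x \<in> carrier R"
  unfolding carrier_A by simp

lemma act_A [simp]: "g \<in> carrier G \<Longrightarrow> x \<in> carrier A \<Longrightarrow> \<phi> g x = x"
  unfolding carrier_A by simp

lemma A_subring: "subcring (carrier A) R"
proof (rule subcringI)
  show "subring (carrier A) R" unfolding carrier_A by (rule subringI) auto
  show "x \<otimes> y = y \<otimes> x" if "x \<in> carrier A" "y \<in> carrier A" for x y
    using that by (intro m_comm) simp_all
qed

lemma A_cring: "cring A"
proof -
  have "A = R\<lparr>carrier := carrier A\<rparr>" unfolding invariant_ring_def by simp
  moreover have "carrier A \<subseteq> carrier R" using in_A_carrier by blast
  ultimately show ?thesis using subcring_iff[of "carrier A"] A_subring by simp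
qed

lemma A_a_inv [simp]:
  assumes "x \<in> carrier A"
  shows "\<ominus>\<^bsub>A\<^esub> x = \<ominus> x"
proof -
  interpret A: cring A by (rule A_cring)
  have "\<ominus>\<^bsub>A\<^esub> x \<in> carrier A" "\<ominus>\<^bsub>A\<^esub> x \<oplus> x = \<zero>" using assms A.l_neg[of x] by simp_all
  then show ?thesis using assms minus_equality[of "\<ominus>\<^bsub>A\<^esub> x" x] by simp
qed

lemma A_minus [simp]: "x \<in> carrier A \<Longrightarrow> y \<in> carrier A \<Longrightarrow> x \<ominus>\<^bsub>A\<^esub> y = x \<ominus> y"
  by (simp add: a_minus_def)

lemma A_closed [simp]:
  "x \<in> carrier A \<Longrightarrow> y \<in> carrier A \<Longrightarrow> x \<oplus> y \<in> carrier A"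
  "x \<in> carrier A \<Longrightarrow> y \<in> carrier A \<Longrightarrow> x \<otimes> y \<in> carrier A"
  "x \<in> carrier A \<Longrightarrow> y \<in> carrier A \<Longrightarrow> x \<ominus> y \<in> carrier A"
  "x \<in> carrier A \<Longrightarrow> \<ominus> x \<in> carrier A"
  "\<zero> \<in> carrier A" "\<one> \<in> carrier A" "x \<in> carrier A \<Longrightarrow> x [^] (n :: nat) \<in> carrier A"
  unfolding carrier_A by auto

lemma translate_bij: "g \<in> carrier G \<Longrightarrow> bij_betw (\<lambda>h. g \<otimes>\<^bsub>G\<^esub> h) (carrier G) (carrier G)"
  by (intro bij_betwI[of _ _ _ "\<lambda>h. inv\<^bsub>G\<^esub> g \<otimes>\<^bsub>G\<^esub> h"])
    (auto simp: G.m_assoc[symmetric])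

lemma contraction_ideal:
  assumes "ideal I R" shows "ideal (I \<inter> carrier A) A"
proof -
  interpret I: ideal I R by fact
  interpret A: cring A by (rule A_cring)
  show ?thesis by (rule A.ideal_if_closed) (auto simp: I.zero_mem I.I_l_closed)
qed

lemma contraction_prime:
  assumes "primeideal q R" shows "primeideal (q \<inter> carrier A) A"
proof -
  interpret q: primeideal q R by fact
  have "\<one> \<notin> q" using q.I_notcarr q.one_imp_carrier by auto
  then have "carrier A \<noteq> q \<inter> carrier A" using A_closed by blast
  then show ?thesis
    using q.I_prime by (intro primeidealI contraction_ideal q.is_ideal A_cring) auto
qed

section \<open>Invariant norms, lying over and incomparability\<close>

lemma subgroup_norm_invariant:
  assumes H: "subgroup H G" and s: "s \<in> carrier R" and k: "k \<in> H"
  shows "\<phi> k (\<Otimes>h\<in>H. \<phi> h s) = (\<Otimes>h\<in>H. \<phi> h s)"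
proof -
  interpret H: subgroup H G by fact
  have kG: "k \<in> carrier G" using k by simp
  have bij: "bij_betw (\<lambda>h. k \<otimes>\<^bsub>G\<^esub> h) H H"
    using k by (intro bij_betwI[of _ _ _ "\<lambda>h. inv\<^bsub>G\<^esub> k \<otimes>\<^bsub>G\<^esub> h"])
      (auto simp: G.m_assoc[symmetric])
  have "\<phi> k (\<Otimes>h\<in>H. \<phi> h s) = (\<Otimes>h\<in>H. \<phi> (k \<otimes>\<^bsub>G\<^esub> h) s)"
    using kG s H.subset by (subst act_finprod) (auto intro!: finprod_cong' simp: act_comp)
  also have "\<dots> = (\<Otimes>h\<in>(\<lambda>h. k \<otimes>\<^bsub>G\<^esub> h) ` H. \<phi> h s)"
    using bij s k by (intro finprod_reindex[symmetric]) (auto simp: bij_betw_def)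
  also have "(\<lambda>h. k \<otimes>\<^bsub>G\<^esub> h) ` H = H" using bij by (simp add: bij_betw_def)
  finally show ?thesis .
qed

lemma norm_invariant:
  assumes "x \<in> carrier R"
  shows "(\<Otimes>g\<in>carrier G. \<phi> g x) \<in> carrier A"
  unfolding carrier_A using subgroup_norm_invariant[OF G.subgroup_self assms] assms
  by (auto intro!: finprod_closed)

lemma finprod_add_expand:
  assumes "finite B" "s \<in> carrier R" "f \<in> B \<rightarrow> carrier R"
  shows "(\<Otimes>x\<in>B. s \<oplus> f x) = (\<Oplus>T\<in>Pow B. s [^] (card B - card T) \<otimes> finprod R f T)"
  using assms
proof (induction B rule: finite_induct)
  case empty
  then show ?case by simp
next
  case (insert x B)
  have f: "f x \<in> carrier R" "f \<in> B \<rightarrow> carrier R" using insert.prems by auto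
  have fT: "finprod R f T \<in> carrier R" if "T \<subseteq> B" for T using that f by (intro finprod_closed) auto
  let ?t = "\<lambda>B T. s [^] (card B - card T) \<otimes> finprod R f T"
  have Pow: "Pow (insert x B) = Pow B \<union> insert x ` Pow B" by (rule Pow_insert)
  have "(\<Oplus>T\<in>Pow (insert x B). ?t (insert x B) T) =
      (\<Oplus>T\<in>Pow B. ?t (insert x B) T) \<oplus> (\<Oplus>T\<in>insert x ` Pow B. ?t (insert x B) T)"
    unfolding Pow using insert f
    by (intro finsum_Un_disjoint) (auto intro!: finprod_closed m_closed)
  also have "(\<Oplus>T\<in>insert x ` Pow B. ?t (insert x B) T) = (\<Oplus>T\<in>Pow B. ?t (insert x B) (insert x T))"
    using insert f by (intro finsum_reindex) (auto simp: inj_on_def intro!: finprod_closed m_closed)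
  also have "\<dots> = (\<Oplus>T\<in>Pow B. f x \<otimes> ?t B T)"
  proof (intro finsum_cong')
    fix T assume T: "T \<in> Pow B"
    then have "finite T" "x \<notin> T" using insert finite_subset by auto
    then show "?t (insert x B) (insert x T) = f x \<otimes> ?t B T"
      using T insert f fT by (subst finprod_insert) (auto simp: m_lcomm)
  qed (use insert f fT in auto)
  also have "\<dots> = f x \<otimes> (\<Oplus>T\<in>Pow B. ?t B T)"
    using insert f fT by (intro finsum_rdistr[symmetric]) auto
  also have "(\<Oplus>T\<in>Pow B. ?t (insert x B) T) = (\<Oplus>T\<in>Pow B. s \<otimes> ?t B T)"
  proof (intro finsum_cong')
    fix T assume T: "T \<in> Pow B"
    then have "card T \<le> card B" using insert card_mono by auto
    then have "s [^] (card (insert x B) - card T) = s \<otimes> s [^] (card B - card T)"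
      using insert by (simp add: Suc_diff_le m_comm)
    then show "?t (insert x B) T = s \<otimes> ?t B T" using T insert fT by (simp add: m_assoc)
  qed (use insert f fT in auto)
  also have "\<dots> = s \<otimes> (\<Oplus>T\<in>Pow B. ?t B T)"
    using insert f fT by (intro finsum_rdistr[symmetric]) auto
  also have "s \<otimes> (\<Oplus>T\<in>Pow B. ?t B T) \<oplus> f x \<otimes> (\<Oplus>T\<in>Pow B. ?t B T) = (s \<oplus> f x) \<otimes> (\<Otimes>x\<in>B. s \<oplus> f x)"
    using insert f fT by (subst insert.IH) (auto simp: l_distr)
  also have "\<dots> = (\<Otimes>x\<in>insert x B. s \<oplus> f x)" using insert f by (subst finprod_insert) auto
  finally show ?case by simp
qed

lemma finprod_scale:
  assumes "finite B" "a \<in> carrier R" "f \<in> B \<rightarrow> carrier R"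
  shows "(\<Otimes>x\<in>B. a \<otimes> f x) = a [^] card B \<otimes> finprod R f B"
  using assms by (simp add: finprod_multf finprod_const Pi_def)

text \<open>The characteristic polynomial of \<open>r\<close> has invariant coefficients.\<close>

lemma norm_add_invariant:
  assumes s: "s \<in> carrier A" and a: "a \<in> carrier A" and r: "r \<in> carrier R"
  shows "\<exists>c \<in> carrier A. (\<Otimes>g\<in>carrier G. s \<oplus> a \<otimes> \<phi> g r) = s [^] order G \<oplus> a \<otimes> c"
proof -
  define n where "n = order G"
  define N where "N T = (\<Otimes>g\<in>T. \<phi> g r)" for T
  \<comment> \<open>The coefficient left when one factor \<open>a\<close> is taken out of the term
    of a nonempty \<open>T\<close>. The empty set contributes \<open>s [^] order G\<close> and is
    therefore excluded from \<open>PP\<close>.\<close>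
  define w where "w T = s [^] (n - card T) \<otimes> a [^] (card T - 1)" for T :: "'g set"
  define PP where "PP = Pow (carrier G) - {{}}"
  define c where "c = (\<Oplus>T\<in>PP. w T \<otimes> N T)"
  have fin: "finite PP" unfolding PP_def using finite_G by simp
  have N: "N T \<in> carrier R" if "T \<subseteq> carrier G" for T
    unfolding N_def using that r by (intro finprod_closed) auto
  have w: "w T \<in> carrier A" for T unfolding w_def using s a by simp
  have wN: "(\<lambda>T. w T \<otimes> N T) \<in> PP \<rightarrow> carrier R" using N w unfolding PP_def by auto
  then have cR: "c \<in> carrier R" unfolding c_def by (rule finsum_closed)
  have "\<phi> h c = c" if h: "h \<in> carrier G" for h
  proof -
    let ?h = "\<lambda>T. (\<lambda>g. h \<otimes>\<^bsub>G\<^esub> g) ` T"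
    have hT: "?h T \<subseteq> carrier G" if "T \<subseteq> carrier G" for T using that h by auto
    have inj: "inj_on (\<lambda>g. h \<otimes>\<^bsub>G\<^esub> g) (carrier G)" using translate_bij[OF h] by (simp add: bij_betw_def)
    \<comment> \<open>\<open>h\<close> carries the term of \<open>T\<close> to the term of its left
      translate, since \<open>w\<close> depends on the cardinality alone; and left translation
      permutes \<open>PP\<close>.\<close>
    have "\<phi> h c = (\<Oplus>T\<in>PP. w (?h T) \<otimes> N (?h T))"
      unfolding c_def
    proof (subst act_finsum[OF h wN], intro finsum_cong')
      show "(\<lambda>T. w (?h T) \<otimes> N (?h T)) \<in> PP \<rightarrow> carrier R"
        using N[OF hT] w unfolding PP_def by simp
      fix T assume "T \<in> PP"
      then have T: "T \<subseteq> carrier G" unfolding PP_def by blast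
      have injT: "inj_on (\<lambda>g. h \<otimes>\<^bsub>G\<^esub> g) T" using inj T inj_on_subset by blast
      have "w (?h T) = w T" unfolding w_def using card_image[OF injT] by simp
      moreover have "N (?h T) = \<phi> h (N T)"
      proof -
        have "N (?h T) = (\<Otimes>g\<in>T. \<phi> (h \<otimes>\<^bsub>G\<^esub> g) r)"
          unfolding N_def using h T r by (intro finprod_reindex injT) auto
        also have "\<dots> = \<phi> h (N T)"
          unfolding N_def using h T r
          by (subst act_finprod) (auto intro!: finprod_cong' simp: act_comp subset_iff)
        finally show ?thesis .
      qed
      ultimately show "(\<phi> h \<circ> (\<lambda>T. w T \<otimes> N T)) T = w (?h T) \<otimes> N (?h T)"
        using h w[of T] N[OF T] by simp
    qed simp
    also have "\<dots> = (\<Oplus>T\<in>?h ` PP. w T \<otimes> N T)"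
    proof (intro finsum_reindex[symmetric])
      show "inj_on ?h PP" using inj unfolding PP_def by (auto intro!: inj_onI dest: inj_on_image_eq_iff)
      show "(\<lambda>T. w T \<otimes> N T) \<in> ?h ` PP \<rightarrow> carrier R"
        using N[OF hT] w unfolding PP_def by auto
    qed
    also have "?h ` PP = PP"
    proof
      show "?h ` PP \<subseteq> PP" using h unfolding PP_def by auto
      show "PP \<subseteq> ?h ` PP"
      proof
        fix T assume T: "T \<in> PP"
        let ?T = "(\<lambda>g. inv\<^bsub>G\<^esub> h \<otimes>\<^bsub>G\<^esub> g) ` T"
        have "?h ?T = (\<lambda>g. g) ` T"
          unfolding image_image using T h unfolding PP_def
          by (intro image_cong) (auto simp: G.m_assoc[symmetric])
        moreover have "?T \<in> PP" using T h unfolding PP_def by auto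
        ultimately show "T \<in> ?h ` PP" by (metis image_eqI image_ident)
      qed
    qed
    finally show ?thesis unfolding c_def .
  qed
  then have "c \<in> carrier A" using cR unfolding carrier_A by simp
  moreover have "(\<Otimes>g\<in>carrier G. s \<oplus> a \<otimes> \<phi> g r) = s [^] order G \<oplus> a \<otimes> c"
  proof -
    let ?f = "\<lambda>g. a \<otimes> \<phi> g r"
    let ?t = "\<lambda>T. s [^] (n - card T) \<otimes> finprod R ?f T"
    have fc: "?f \<in> carrier G \<rightarrow> carrier R" using a r by simp
    have tc: "?t \<in> Pow (carrier G) \<rightarrow> carrier R"
      using s a r by (auto intro!: m_closed finprod_closed)
    have "(\<Otimes>g\<in>carrier G. s \<oplus> ?f g) = (\<Oplus>T\<in>Pow (carrier G). ?t T)"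
      using finprod_add_expand[OF finite_G _ fc, of s] s unfolding n_def order_def by simp
    also have "Pow (carrier G) = insert {} PP" unfolding PP_def by blast
    also have "(\<Oplus>T\<in>insert {} PP. ?t T) = ?t {} \<oplus> (\<Oplus>T\<in>PP. ?t T)"
      using fin tc s by (intro finsum_insert) (auto simp: PP_def)
    also have "?t {} = s [^] order G" using s n_def by simp
    also have "(\<Oplus>T\<in>PP. ?t T) = (\<Oplus>T\<in>PP. a \<otimes> (w T \<otimes> N T))"
    proof (intro finsum_cong')
      fix T assume "T \<in> PP"
      then have T: "T \<subseteq> carrier G" "T \<noteq> {}" "finite T"
        unfolding PP_def using finite_G finite_subset by auto
      then have "finprod R ?f T = a [^] card T \<otimes> N T"
        unfolding N_def using a r by (intro finprod_scale) auto
      moreover have "a [^] card T = a \<otimes> a [^] (card T - 1)"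
        using T a by (cases "card T") (auto simp: m_comm)
      ultimately show "?t T = a \<otimes> (w T \<otimes> N T)"
        using a s N[OF T(1)] unfolding w_def by (simp add: m_assoc m_lcomm)
    qed (use wN a in auto)
    also have "\<dots> = a \<otimes> c" unfolding c_def using fin wN a by (intro finsum_rdistr[symmetric]) auto
    finally show ?thesis .
  qed
  ultimately show ?thesis by blast
qed

text \<open>An ideal \<open>M\<close> maximal among those meeting \<open>A\<close> inside
  \<open>p\<close> is prime. That it meets \<open>A\<close> in all of \<open>p\<close> is shown with
  a norm, which takes the place of an equation of integral dependence.\<close>

lemma lying_over:
  assumes noeth: "noetherian_ring R" and p: "primeideal p A"
  shows "\<exists>q. primeideal q R \<and> q \<inter> carrier A = p"
proof -
  interpret R: noetherian_ring R by fact
  interpret p: primeideal p A by fact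
  define S where "S = {I. ideal I R \<and> I \<inter> carrier A \<subseteq> p}"
  have one_p: "\<one> \<notin> p" using p.I_notcarr p.one_imp_carrier by auto
  have p_sub: "p \<subseteq> carrier A" using p.Icarr by blast
  have "{\<zero>} \<in> S" unfolding S_def using zeroideal p.zero_mem by auto
  then have "S \<noteq> {}" "S \<subseteq> {I. ideal I R}" unfolding S_def by auto
  from R.exists_maximal_ideal_in[OF this] obtain M
    where M: "M \<in> S" "\<forall>K \<in> S. M \<subseteq> K \<longrightarrow> K = M" by (elim bexE)
  then have Mi: "ideal M R" and Mp: "M \<inter> carrier A \<subseteq> p" unfolding S_def by auto
  interpret M: ideal M R by (rule Mi)
  \<comment> \<open>Enlarging \<open>M\<close> by \<open>a\<close> violates the defining condition,
    so \<open>M + a R\<close> contains an invariant \<open>s\<close> outside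
    \<open>p\<close>.\<close>
  have big: "\<exists>s r. s \<in> carrier A \<and> s \<notin> p \<and> r \<in> carrier R \<and> s \<ominus> a \<otimes> r \<in> M"
    if a: "a \<in> carrier R" "a \<notin> M" for a
  proof -
    have "adjoin R M a \<noteq> M" using generator_in_adjoin[OF Mi a(1)] a(2) by blast
    then have "adjoin R M a \<notin> S" using M(2) ideal_subset_adjoin[OF Mi a(1)] by blast
    then obtain s where "s \<in> adjoin R M a" "s \<in> carrier A" "s \<notin> p"
      unfolding S_def using adjoin_ideal[OF Mi a(1)] by blast
    then show ?thesis using adjoin_iff[OF Mi a(1)] by auto
  qed
  have prime: "primeideal M R"
  proof (rule primeidealI[OF Mi cring_axioms])
    show "carrier R \<noteq> M" using Mp one_p by auto
    fix a b assume ab: "a \<in> carrier R" "b \<in> carrier R" "a \<otimes> b \<in> M"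
    show "a \<in> M \<or> b \<in> M"
    proof (rule ccontr)
      assume "\<not> (a \<in> M \<or> b \<in> M)"
      then obtain s r t u where s: "s \<in> carrier A" "s \<notin> p" "r \<in> carrier R" "s \<ominus> a \<otimes> r \<in> M"
        and t: "t \<in> carrier A" "t \<notin> p" "u \<in> carrier R" "t \<ominus> b \<otimes> u \<in> M"
        using big[OF ab(1)] big[OF ab(2)] by blast
      have sR: "s \<in> carrier R" "t \<in> carrier R" using s t by auto
      have "s \<otimes> t = (s \<ominus> a \<otimes> r) \<otimes> t \<oplus> ((a \<otimes> r) \<otimes> (t \<ominus> b \<otimes> u) \<oplus> (r \<otimes> u) \<otimes> (a \<otimes> b))"
        using sR s(3) t(3) ab(1,2) by algebra
      also have "\<dots> \<in> M"
        using sR s(3,4) t(3,4) ab by (simp add: M.a_closed M.I_l_closed M.I_r_closed)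
      finally have "s \<otimes> t \<in> M" .
      then have "s \<otimes> t \<in> p" using Mp s(1) t(1) A_closed(2) by blast
      then show False using p.I_prime[of s t] s(1,2) t(1,2) by simp
    qed
  qed
  have "p \<subseteq> M"
  proof (rule ccontr)
    assume "\<not> p \<subseteq> M"
    then obtain a where a: "a \<in> p" "a \<notin> M" by blast
    have aA: "a \<in> carrier A" using a p_sub by blast
    obtain s r where s: "s \<in> carrier A" "s \<notin> p" "r \<in> carrier R" "s \<ominus> a \<otimes> r \<in> M"
      using big[of a] a aA by auto
    define t where "t = s \<ominus> a \<otimes> r"
    have tR: "t \<in> carrier R" unfolding t_def using s aA by simp
    \<comment> \<open>One factor of this norm is \<open>t\<close> itself, so the norm lies in
      \<open>M\<close> and hence in \<open>p\<close>. Expanded it is \<open>s [^] order G\<close>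
      plus a multiple of \<open>a\<close>; with \<open>a\<close> in \<open>p\<close>, a power of
      \<open>s\<close> lands in \<open>p\<close>.\<close>
    define N where "N = (\<Otimes>g\<in>carrier G. \<phi> g t)"
    have NA: "N \<in> carrier A" unfolding N_def using tR by (rule norm_invariant)
    have "N \<in> M"
      unfolding N_def
    proof (rule M.finprod_mem[OF cring_axioms finite_G])
      show "\<phi> \<one>\<^bsub>G\<^esub> t \<in> M" using tR s(4) t_def by simp
    qed (use tR in auto)
    then have Np: "N \<in> p" using Mp NA by blast
    obtain c where c: "c \<in> carrier A"
      "(\<Otimes>g\<in>carrier G. s \<oplus> a \<otimes> \<phi> g (\<ominus> r)) = s [^] order G \<oplus> a \<otimes> c"
      using norm_add_invariant[OF s(1) aA, of "\<ominus> r"] s(3) by auto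
    have "N = (\<Otimes>g\<in>carrier G. s \<oplus> a \<otimes> \<phi> g (\<ominus> r))"
      unfolding N_def t_def using s aA
      by (intro finprod_cong') (auto simp: a_minus_def r_minus)
    then have "s [^] order G \<oplus> a \<otimes> c \<in> p" using Np c(2) by simp
    moreover have "a \<otimes> c \<in> p" using p.I_r_closed[OF a(1) c(1)] by simp
    ultimately have sp: "s [^] order G \<in> p" using p.mem_if_add_mem s(1) by simp
    have "s [^] k \<notin> p" for k :: nat
    proof (induction k)
      case (Suc k)
      show ?case
      proof
        assume "s [^] Suc k \<in> p"
        then have "s [^] k \<otimes> s \<in> p" by simp
        then show False using p.I_prime[of "s [^] k" s] s Suc by simp
      qed
    qed (use one_p in simp)
    then show False using sp by blast
  qed
  then show ?thesis using prime Mp p_sub by blast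
qed

text \<open>The conjugate \<open>g^-1 q\<close>, taken as a preimage so that primality is inherited
  along a ring homomorphism.\<close>

definition act_preimage :: "'g \<Rightarrow> 'a set \<Rightarrow> 'a set" where
  "act_preimage g q = {x \<in> carrier R. \<phi> g x \<in> q}"

lemma act_preimage_prime:
  assumes "primeideal q R" "g \<in> carrier G"
  shows "primeideal (act_preimage g q) R"
proof -
  interpret q: primeideal q R by fact
  have "ideal (act_preimage g q) R"
    by (rule ideal_if_closed) (auto simp: act_preimage_def assms q.zero_mem q.I_l_closed)
  moreover have "\<one> \<notin> act_preimage g q" unfolding act_preimage_def using q.I_notcarr q.one_imp_carrier assms by auto
  then have "carrier R \<noteq> act_preimage g q" using one_closed by blast
  ultimately show ?thesis
    using assms q.I_prime by (intro primeidealI cring_axioms) (auto simp: act_preimage_def)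
qed

lemma act_preimage_contraction:
  assumes "primeideal q R" "g \<in> carrier G"
  shows "act_preimage g q \<inter> carrier A = q \<inter> carrier A"
  unfolding act_preimage_def using assms(2) by auto

lemma act_preimage_height:
  assumes q: "primeideal q R" and g: "g \<in> carrier G"
  shows "prime_height R (act_preimage g q) \<le> prime_height R q"
proof (rule prime_height_le)
  fix n c assume c: "\<And>i. i \<le> n \<Longrightarrow> primeideal (c i) R" "\<And>i. i < n \<Longrightarrow> c i \<subset> c (Suc i)" "c n = act_preimage g q"
  let ?p = "\<lambda>i. act_preimage (inv\<^bsub>G\<^esub> g) (c i)"
  interpret q: primeideal q R by fact
  show "enat n \<le> prime_height R q"
  proof (rule le_prime_height[of _ ?p])
    show "primeideal (?p i) R" if "i \<le> n" for i using c(1)[OF that] g by (intro act_preimage_prime) auto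
    show "?p n = q" using g q.Icarr unfolding c(3) by (auto simp: act_preimage_def)
    fix i assume i: "i < n"
    then obtain x where x: "x \<in> c (Suc i)" "x \<notin> c i" using c(2) by blast
    have "x \<in> carrier R" using ideal.Icarr[OF primeideal.axioms(1)[OF c(1)[of "Suc i"]] x(1)] i by simp
    then have "\<phi> g x \<in> ?p (Suc i)" "\<phi> g x \<notin> ?p i" using x g by (auto simp: act_preimage_def)
    moreover have "?p i \<subseteq> ?p (Suc i)" using c(2)[OF i] by (auto simp: act_preimage_def)
    ultimately show "?p i \<subset> ?p (Suc i)" by blast
  qed
qed

lemma act_pow_mem:
  assumes "g \<in> carrier G" "x \<in> carrier R" "x \<in> q" "\<And>y. y \<in> q \<Longrightarrow> y \<in> carrier R \<Longrightarrow> \<phi> g y \<in> q"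
  shows "\<phi> (g [^]\<^bsub>G\<^esub> (k :: nat)) x \<in> q"
proof (induction k)
  case (Suc k)
  have "g [^]\<^bsub>G\<^esub> Suc k = g \<otimes>\<^bsub>G\<^esub> g [^]\<^bsub>G\<^esub> k"
    using assms(1) by (simp add: G.nat_pow_comm[of g 1 k, simplified])
  then show ?case using Suc assms act_comp by simp
qed (use assms in simp)

text \<open>As \<open>g\<close> has finite order, its inverse is a power of \<open>g\<close> and also maps \<open>q'\<close> into \<open>q'\<close>.\<close>

lemma subset_of_act_subset:
  assumes g: "g \<in> carrier G" and sub: "q' \<subseteq> carrier R" "q \<subseteq> q'" "\<And>x. x \<in> q' \<Longrightarrow> \<phi> g x \<in> q"
  shows "q = q'"
proof -
  have "x \<in> q" if x: "x \<in> q'" for x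
  proof -
    have xR: "x \<in> carrier R" using x sub(1) by blast
    have "\<phi> (g [^]\<^bsub>G\<^esub> (order G - 1)) x \<in> q'" using act_pow_mem[of g x q'] g x sub by blast
    then have "\<phi> g (\<phi> (g [^]\<^bsub>G\<^esub> (order G - 1)) x) \<in> q" by (rule sub(3))
    moreover have "order G = Suc (order G - 1)" using G.order_gt_0_iff_finite finite_G by simp
    then have "g [^]\<^bsub>G\<^esub> (order G) = g \<otimes>\<^bsub>G\<^esub> g [^]\<^bsub>G\<^esub> (order G - 1)"
      using g by (metis G.nat_pow_Suc2)
    then have "\<phi> (g \<otimes>\<^bsub>G\<^esub> g [^]\<^bsub>G\<^esub> (order G - 1)) x = x"
      using G.pow_order_eq_1[OF g] xR by (metis act_id)
    then have "\<phi> g (\<phi> (g [^]\<^bsub>G\<^esub> (order G - 1)) x) = x"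
      using g xR by (simp add: act_comp)
    ultimately show ?thesis by simp
  qed
  then show ?thesis using sub(2) by blast
qed

text \<open>If \<open>q'\<close> lay in no conjugate of \<open>q\<close>, prime avoidance would give
  \<open>x\<close> in \<open>q'\<close> outside all of them. But the norm of \<open>x\<close> is an
  invariant in \<open>q'\<close>, hence in \<open>q\<close>, so some conjugate of \<open>x\<close>
  is in \<open>q\<close>. Once \<open>q'\<close> lies in a conjugate of \<open>q\<close>, the finite
  order of \<open>g\<close> forces equality.\<close>

lemma incomparable:
  assumes q: "primeideal q R" and q': "primeideal q' R" and sub: "q \<subseteq> q'"
    and eq: "q \<inter> carrier A = q' \<inter> carrier A"
  shows "q = q'"
proof -
  interpret q: primeideal q R by fact
  interpret q': primeideal q' R by fact
  have "\<exists>g \<in> carrier G. q' \<subseteq> act_preimage g q"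
  proof (rule ccontr)
    assume *: "\<not> (\<exists>g \<in> carrier G. q' \<subseteq> act_preimage g q)"
    have "\<exists>x \<in> q'. \<forall>Q \<in> (\<lambda>g. act_preimage g q) ` carrier G. x \<notin> Q"
      using finite_G * act_preimage_prime[OF q] by (intro prime_avoidance q'.is_ideal) auto
    then obtain x where x: "x \<in> q'" "\<And>g. g \<in> carrier G \<Longrightarrow> x \<notin> act_preimage g q" by auto
    have xR: "x \<in> carrier R" using x(1) by (rule q'.Icarr)
    have "(\<Otimes>g\<in>carrier G. \<phi> g x) \<in> q'"
    proof (rule q'.finprod_mem[OF cring_axioms finite_G])
      show "\<phi> \<one>\<^bsub>G\<^esub> x \<in> q'" using x(1) xR by simp
    qed (use xR in auto)
    then have "(\<Otimes>g\<in>carrier G. \<phi> g x) \<in> q" using eq norm_invariant[OF xR] by blast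
    moreover have "(\<lambda>g. \<phi> g x) \<in> carrier G \<rightarrow> carrier R" using xR by simp
    ultimately obtain g where "g \<in> carrier G" "\<phi> g x \<in> q"
      using q.mem_of_finprod_mem[OF finite_G] by blast
    then show False using x(2) xR unfolding act_preimage_def by blast
  qed
  then obtain g where g: "g \<in> carrier G" "q' \<subseteq> act_preimage g q" by blast
  then show ?thesis using subset_of_act_subset[OF g(1) _ sub] q'.Icarr unfolding act_preimage_def by blast
qed

text \<open>Incomparability keeps the chain strict after intersection with \<open>A\<close>. This is
  the direction that carries lower bounds on heights from \<open>R\<close> to
  \<open>A\<close>.\<close>

lemma height_le_contraction_height:
  assumes "primeideal q R"
  shows "prime_height R q \<le> prime_height A (q \<inter> carrier A)"
proof (rule prime_height_le)
  fix n c assume c: "\<And>i. i \<le> n \<Longrightarrow> primeideal (c i) R" "\<And>i. i < n \<Longrightarrow> c i \<subset> c (Suc i)" "c n = q"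
  show "enat n \<le> prime_height A (q \<inter> carrier A)"
  proof (rule le_prime_height[of _ "\<lambda>i. c i \<inter> carrier A"])
    show "primeideal (c i \<inter> carrier A) A" if "i \<le> n" for i using c(1)[OF that] by (rule contraction_prime)
    fix i assume i: "i < n"
    then have "c i \<noteq> c (Suc i)" "c i \<subseteq> c (Suc i)" "primeideal (c i) R" "primeideal (c (Suc i)) R"
      using c(1,2) by auto
    then show "c i \<inter> carrier A \<subset> c (Suc i) \<inter> carrier A" using incomparable by blast
  qed (simp add: c(3))
qed

end

section \<open>Frobenius and independence of characters\<close>

lemma (in ideal) finsum_mem:
  assumes "f \<in> B \<rightarrow> I"
  shows "finsum R f B \<in> I"
  using assms
proof (induction B rule: infinite_finite_induct)
  case (insert x F)
  then have "f \<in> F \<rightarrow> carrier R" "f x \<in> carrier R" using Icarr by (simp_all add: Pi_iff)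
  then show ?case using insert by (simp add: a_closed)
qed (simp_all add: zero_mem)

context cring
begin

lemma binomial:
  assumes x: "x \<in> carrier R" and y: "y \<in> carrier R"
  shows "(x \<oplus> y) [^] (n :: nat) = (\<Oplus>k\<in>{..n}. add_pow R (n choose k) (x [^] k \<otimes> y [^] (n - k)))"
proof (induction n)
  case 0
  then show ?case using assms by simp
next
  case (Suc n)
  define t where "t k = add_pow R (n choose k) (x [^] k \<otimes> y [^] (n - k))" for k
  define u where "u k = add_pow R (n choose k) (x [^] k \<otimes> y [^] (Suc n - k))" for k
  define v where "v k = add_pow R (Suc n choose k) (x [^] k \<otimes> y [^] (Suc n - k))" for k
  have c: "t k \<in> carrier R" "u k \<in> carrier R" "v k \<in> carrier R" for k
    unfolding t_def u_def v_def using assms by simp_all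
  have vS: "v (Suc k) = x \<otimes> t k \<oplus> u (Suc k)" for k
    unfolding v_def t_def u_def using x y
    by (simp add: add.nat_pow_mult[symmetric] add_pow_rdistr m_assoc m_lcomm m_comm)
  have u: "y \<otimes> t k = u k" if "k \<le> n" for k
    unfolding t_def u_def using x y that
    by (simp add: add_pow_rdistr m_assoc m_lcomm m_comm Suc_diff_le)
  have "u (Suc n) = \<zero>" unfolding u_def using x y by (simp add: binomial_eq_0)
  then have "(\<Oplus>k\<in>{..n}. u k) = (\<Oplus>k\<in>{..Suc n}. u k)" using c by simp
  also have "\<dots> = (\<Oplus>k\<in>{..n}. u (Suc k)) \<oplus> u 0" using c by (intro finsum_Suc2) simp
  finally have un: "(\<Oplus>k\<in>{..n}. u k) = (\<Oplus>k\<in>{..n}. u (Suc k)) \<oplus> u 0" .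
  have "(x \<oplus> y) [^] Suc n = (x \<oplus> y) \<otimes> (\<Oplus>k\<in>{..n}. t k)"
    using Suc x y c unfolding t_def by (simp add: m_comm)
  also have "\<dots> = (\<Oplus>k\<in>{..n}. x \<otimes> t k) \<oplus> (\<Oplus>k\<in>{..n}. y \<otimes> t k)"
    using x y c by (simp add: l_distr finsum_rdistr)
  also have "(\<Oplus>k\<in>{..n}. y \<otimes> t k) = (\<Oplus>k\<in>{..n}. u k)"
    using u c by (intro finsum_cong') auto
  also have "(\<Oplus>k\<in>{..n}. x \<otimes> t k) \<oplus> (\<Oplus>k\<in>{..n}. u k) =
      ((\<Oplus>k\<in>{..n}. x \<otimes> t k) \<oplus> (\<Oplus>k\<in>{..n}. u (Suc k))) \<oplus> u 0"
    unfolding un using x c by (simp add: a_assoc)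
  also have "(\<Oplus>k\<in>{..n}. x \<otimes> t k) \<oplus> (\<Oplus>k\<in>{..n}. u (Suc k)) = (\<Oplus>k\<in>{..n}. v (Suc k))"
    unfolding vS using x c by (intro finsum_addf[symmetric]) auto
  also have "u 0 = v 0" unfolding u_def v_def by simp
  also have "(\<Oplus>k\<in>{..n}. v (Suc k)) \<oplus> v 0 = (\<Oplus>k\<in>{..Suc n}. v k)"
    using c by (intro finsum_Suc2[symmetric]) simp
  finally show ?case unfolding v_def .
qed

lemma add_pow_dvd_eq_zero:
  assumes "add_pow R p \<one> = \<zero>" "p dvd (n :: nat)" "z \<in> carrier R"
  shows "add_pow R n z = \<zero>"
proof -
  obtain k where "n = p * k" using assms(2) by blast
  then have "add_pow R n z = add_pow R k (add_pow R p z)" using assms(3) by (simp add: add.nat_pow_pow mult.commute)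
  also have "add_pow R p z = add_pow R p \<one> \<otimes> z" using assms(3) by (simp add: add_pow_ldistr)
  finally show ?thesis using assms by simp
qed

lemma frobenius_add:
  assumes p: "Factorial_Ring.prime (p :: nat)" and char: "add_pow R p \<one> = \<zero>"
    and x: "x \<in> carrier R" and y: "y \<in> carrier R"
  shows "(x \<oplus> y) [^] p = x [^] p \<oplus> y [^] p"
proof -
  define t where "t k = add_pow R (p choose k) (x [^] k \<otimes> y [^] (p - k))" for k
  have c: "t k \<in> carrier R" for k unfolding t_def using x y by simp
  obtain m where m: "p = Suc (Suc m)" using prime_ge_2_nat[OF p] by (metis add_2_eq_Suc le_Suc_ex)
  have z: "t (Suc i) = \<zero>" if "i \<in> {..m}" for i
  proof -
    have "p dvd (p choose Suc i)" using p that m by (intro dvd_choose_prime) auto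
    then show ?thesis unfolding t_def using add_pow_dvd_eq_zero[OF char] x y by simp
  qed
  have "(x \<oplus> y) [^] p = (\<Oplus>k\<in>{..Suc (Suc m)}. t k)" unfolding t_def m[symmetric] by (rule binomial[OF x y])
  also have "\<dots> = t p \<oplus> (\<Oplus>k\<in>{..Suc m}. t k)" using c m by simp
  also have "(\<Oplus>k\<in>{..Suc m}. t k) = (\<Oplus>k\<in>{..m}. t (Suc k)) \<oplus> t 0" using c by (intro finsum_Suc2) simp
  also have "(\<Oplus>k\<in>{..m}. t (Suc k)) = (\<Oplus>k\<in>{..m}. \<zero>)" using z by (intro finsum_cong') auto
  also have "\<dots> = \<zero>" by simp
  also have "t p = x [^] p" unfolding t_def using x by simp
  also have "t 0 = y [^] p" unfolding t_def using y by simp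
  finally show ?thesis using x y by simp
qed

lemma frobenius_power_add:
  assumes p: "Factorial_Ring.prime (p :: nat)" and char: "add_pow R p \<one> = \<zero>"
    and x: "x \<in> carrier R" and y: "y \<in> carrier R"
  shows "(x \<oplus> y) [^] (p ^ e) = x [^] (p ^ e) \<oplus> y [^] (p ^ e)"
proof (induction e)
  case (Suc e)
  have *: "z [^] (p ^ Suc e) = (z [^] (p ^ e)) [^] p" if "z \<in> carrier R" for z
    using that by (simp add: nat_pow_pow mult.commute)
  show ?case using * Suc x y frobenius_add[OF p char] by simp
qed (use x y in simp)

lemma pow_mem_prime:
  assumes "primeideal q R" "x \<in> carrier R" "x [^] (n :: nat) \<in> q"
  shows "x \<in> q"
proof -
  interpret q: primeideal q R by fact
  show ?thesis using assms(3)
  proof (induction n)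
    case 0
    then show ?case using q.one_imp_carrier q.I_notcarr by simp
  next
    case (Suc n)
    then show ?case using q.I_prime[of "x [^] n" x] assms(2) by auto
  qed
qed

lemma frobenius_injective_mod:
  assumes p: "Factorial_Ring.prime (p :: nat)" and char: "add_pow R p \<one> = \<zero>"
    and q: "primeideal q R"
    and x: "x \<in> carrier R" and y: "y \<in> carrier R" and xy: "x [^] (p ^ e) \<ominus> y [^] (p ^ e) \<in> q"
  shows "x \<ominus> y \<in> q"
proof (rule pow_mem_prime[OF q])
  \<comment> \<open>Expanding this sum, rather than the difference, avoids the sign
    \<open>(-1)^(p^e)\<close>.\<close>
  have "x = (x \<ominus> y) \<oplus> y" using x y by algebra
  then have "x [^] (p ^ e) = (x \<ominus> y) [^] (p ^ e) \<oplus> y [^] (p ^ e)"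
    using frobenius_power_add[OF p char, of "x \<ominus> y" y e] x y by simp
  then have "(x \<ominus> y) [^] (p ^ e) = x [^] (p ^ e) \<ominus> y [^] (p ^ e)"
    using x y by (simp add: a_minus_def a_assoc r_neg)
  then show "(x \<ominus> y) [^] (p ^ e) \<in> q" using xy by simp
qed (use x y in simp)

text \<open>Artin's independence of characters, with values in the domain \<open>R/q\<close>; characters that agree
  modulo \<open>q\<close> may occur with several indices.\<close>

lemma artin_independence:
  assumes q: "primeideal q R" and "finite T" and i0: "i0 \<in> T"
    and c: "c \<in> T \<rightarrow> carrier R"
    and \<psi>: "\<And>i s. i \<in> T \<Longrightarrow> s \<in> carrier R \<Longrightarrow> \<psi> i s \<in> carrier R" "\<And>i. i \<in> T \<Longrightarrow> \<psi> i \<one> = \<one>"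
      "\<And>i s t. i \<in> T \<Longrightarrow> s \<in> carrier R \<Longrightarrow> t \<in> carrier R \<Longrightarrow> \<psi> i (s \<otimes> t) = \<psi> i s \<otimes> \<psi> i t"
    and rel: "\<And>s. s \<in> carrier R \<Longrightarrow> (\<Oplus>i\<in>T. c i \<otimes> \<psi> i s) \<in> q"
  shows "(\<Oplus>i\<in>{i \<in> T. \<forall>s \<in> carrier R. \<psi> i s \<ominus> \<psi> i0 s \<in> q}. c i) \<in> q"
  using assms(2-)
proof (induction T arbitrary: c rule: finite_psubset_induct)
  case (psubset T)
  interpret q: primeideal q R by fact
  let ?E = "{i \<in> T. \<forall>s \<in> carrier R. \<psi> i s \<ominus> \<psi> i0 s \<in> q}"
  note \<psi> = psubset.prems(3-5)
  have cc: "c i \<in> carrier R" if "i \<in> T" for i using psubset.prems(2) that by auto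
  show ?case
  proof (cases "?E = T")
    case True
    \<comment> \<open>When all characters agree with that of \<open>i0\<close>, the relation at
      \<open>\<one>\<close> is the claim.\<close>
    have "(\<Oplus>i\<in>T. c i) = (\<Oplus>i\<in>T. c i \<otimes> \<psi> i \<one>)" using cc \<psi>(2) by (intro finsum_cong') auto
    then show ?thesis using psubset.prems(6)[OF one_closed] True by simp
  next
    case False
    then obtain j t where j: "j \<in> T" "t \<in> carrier R" "\<psi> j t \<ominus> \<psi> i0 t \<notin> q" by blast
    define T' where "T' = T - {j}"
    have T': "T' \<subset> T" "T = insert j T'" "j \<notin> T'" "finite T'" "T' \<subseteq> T"
      unfolding T'_def using j(1) psubset.hyps by auto
    \<comment> \<open>Subtracting \<open>\<psi> j t\<close> times the relation at \<open>s\<close>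
      from the relation at \<open>t s\<close> gives a relation with coefficients
      \<open>c i d i\<close>, in which the index \<open>j\<close> has disappeared.\<close>
    define d where "d i = \<psi> i t \<ominus> \<psi> j t" for i
    have dc: "d i \<in> carrier R" if "i \<in> T" for i unfolding d_def using \<psi>(1) that j by simp
    define e where "e i = c i \<otimes> d i" for i
    have ec: "e i \<in> carrier R" if "i \<in> T" for i unfolding e_def using dc cc that by simp
    have i0T: "i0 \<in> T" by (rule psubset.prems(1))
    have jE: "j \<notin> ?E" using j by blast
    have "i0 \<in> ?E" using i0T \<psi>(1) q.zero_mem by (simp add: a_minus_def r_neg)
    then have i0T': "i0 \<in> T'" using jE i0T T'_def by auto
    have E: "{i \<in> T'. \<forall>s \<in> carrier R. \<psi> i s \<ominus> \<psi> i0 s \<in> q} = ?E" using jE T'_def by blast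
    have "(\<Oplus>i\<in>{i \<in> T'. \<forall>s \<in> carrier R. \<psi> i s \<ominus> \<psi> i0 s \<in> q}. e i) \<in> q"
    proof (rule psubset.IH[OF T'(1) i0T'])
      show "e \<in> T' \<rightarrow> carrier R" using ec T'(5) by auto
      fix s assume s: "s \<in> carrier R"
      have "(\<Oplus>i\<in>T. e i \<otimes> \<psi> i s) = (\<Oplus>i\<in>T. c i \<otimes> \<psi> i (t \<otimes> s) \<oplus> (\<ominus> \<psi> j t) \<otimes> (c i \<otimes> \<psi> i s))"
      proof (intro finsum_cong')
        fix i assume i: "i \<in> T"
        have cl: "c i \<in> carrier R" "\<psi> i t \<in> carrier R" "\<psi> j t \<in> carrier R" "\<psi> i s \<in> carrier R"
          using cc i j s \<psi>(1) by auto
        then show "e i \<otimes> \<psi> i s = c i \<otimes> \<psi> i (t \<otimes> s) \<oplus> (\<ominus> \<psi> j t) \<otimes> (c i \<otimes> \<psi> i s)"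
          unfolding e_def d_def \<psi>(3)[OF i j(2) s] by algebra
      qed (use cc j s \<psi>(1) in auto)
      also have "\<dots> = (\<Oplus>i\<in>T. c i \<otimes> \<psi> i (t \<otimes> s)) \<oplus> (\<Oplus>i\<in>T. (\<ominus> \<psi> j t) \<otimes> (c i \<otimes> \<psi> i s))"
        using cc j s \<psi>(1) by (intro finsum_addf) auto
      also have "(\<Oplus>i\<in>T. (\<ominus> \<psi> j t) \<otimes> (c i \<otimes> \<psi> i s)) = (\<ominus> \<psi> j t) \<otimes> (\<Oplus>i\<in>T. c i \<otimes> \<psi> i s)"
        using cc j s \<psi>(1) psubset.hyps by (intro finsum_rdistr[symmetric]) auto
      finally have "(\<Oplus>i\<in>T. e i \<otimes> \<psi> i s) \<in> q"
        using psubset.prems(6) s j \<psi>(1) by (simp add: q.a_closed q.I_l_closed)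
      moreover have "e j \<otimes> \<psi> j s = \<zero>"
        unfolding e_def d_def using cc j s \<psi>(1) by (simp add: a_minus_def r_neg)
      then have "(\<Oplus>i\<in>T. e i \<otimes> \<psi> i s) = (\<Oplus>i\<in>T'. e i \<otimes> \<psi> i s)"
        unfolding T'(2) using T' s \<psi>(1) ec by (subst finsum_insert) (auto simp: Pi_iff)
      ultimately show "(\<Oplus>i\<in>T'. e i \<otimes> \<psi> i s) \<in> q" by simp
    qed (use \<psi> T'(5) in auto)
    then have eq: "(\<Oplus>i\<in>?E. e i) \<in> q" unfolding E .
    have fE: "finite ?E" using psubset.hyps by simp
    have i0d: "d i0 \<in> carrier R" using dc i0T by simp
    \<comment> \<open>On \<open>?E\<close> every \<open>d i\<close> is congruent to
      \<open>d i0\<close> modulo \<open>q\<close>. As \<open>d i0\<close> is not in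
      \<open>q\<close>, it can be divided out of the sum that the induction hypothesis
      provides.\<close>
    have "(\<Oplus>i\<in>?E. e i) = (\<Oplus>i\<in>?E. c i \<otimes> d i0 \<oplus> c i \<otimes> (\<psi> i t \<ominus> \<psi> i0 t))"
    proof (intro finsum_cong')
      fix i assume "i \<in> ?E"
      then have i: "i \<in> T" by simp
      have cl: "c i \<in> carrier R" "\<psi> i t \<in> carrier R" "\<psi> j t \<in> carrier R" "\<psi> i0 t \<in> carrier R"
        using cc i j i0T \<psi>(1) by auto
      then show "e i = c i \<otimes> d i0 \<oplus> c i \<otimes> (\<psi> i t \<ominus> \<psi> i0 t)"
        unfolding e_def d_def by algebra
    qed (use cc i0d j i0T \<psi>(1) in auto)
    also have "\<dots> = (\<Oplus>i\<in>?E. c i \<otimes> d i0) \<oplus> (\<Oplus>i\<in>?E. c i \<otimes> (\<psi> i t \<ominus> \<psi> i0 t))"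
      using cc i0d j i0T \<psi>(1) by (intro finsum_addf) auto
    finally have "(\<Oplus>i\<in>?E. c i \<otimes> d i0) \<oplus> (\<Oplus>i\<in>?E. c i \<otimes> (\<psi> i t \<ominus> \<psi> i0 t)) \<in> q" using eq by simp
    moreover have "(\<Oplus>i\<in>?E. c i \<otimes> (\<psi> i t \<ominus> \<psi> i0 t)) \<in> q"
      using cc j(2) by (intro q.finsum_mem) (auto intro: q.I_l_closed)
    moreover have "(\<Oplus>i\<in>?E. c i \<otimes> d i0) \<in> carrier R" using cc i0d by (intro finsum_closed) auto
    ultimately have "(\<Oplus>i\<in>?E. c i \<otimes> d i0) \<in> q" using q.mem_if_add_mem by blast
    also have "(\<Oplus>i\<in>?E. c i \<otimes> d i0) = (\<Oplus>i\<in>?E. c i) \<otimes> d i0"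
      using cc i0d fE by (intro finsum_ldistr[symmetric]) auto
    finally have m: "(\<Oplus>i\<in>?E. c i) \<otimes> d i0 \<in> q" .
    have sc: "(\<Oplus>i\<in>?E. c i) \<in> carrier R" using cc by (intro finsum_closed) auto
    have "d i0 \<notin> q"
    proof
      assume "d i0 \<in> q"
      then have "\<ominus> d i0 \<in> q" by (rule q.a_inv_closed)
      moreover have "\<ominus> d i0 = \<psi> j t \<ominus> \<psi> i0 t" unfolding d_def
        using \<psi>(1)[OF i0T j(2)] \<psi>(1)[OF j(1,2)] by algebra
      ultimately show False using j(3) by simp
    qed
    then show ?thesis using q.I_prime[OF sc i0d m] by blast
  qed
qed

end

section \<open>Inertia groups and traces\<close>

context group
begin

lemma inv_mult_cancel [simp]:
  assumes "x \<in> carrier G" "y \<in> carrier G"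
  shows "inv x \<otimes> (x \<otimes> y) = y" "x \<otimes> (inv x \<otimes> y) = y"
  using assms by (simp_all add: m_assoc[symmetric])

definition transversal :: "'a set \<Rightarrow> 'a set \<Rightarrow> bool" where
  "transversal H T \<longleftrightarrow> T \<subseteq> carrier G \<and> (\<forall>g \<in> carrier G. \<exists>!t. t \<in> T \<and> inv t \<otimes> g \<in> H)"

lemma lcos_eq_iff:
  assumes "subgroup H G" "x \<in> carrier G" "y \<in> carrier G"
  shows "x <# H = y <# H \<longleftrightarrow> inv x \<otimes> y \<in> H"
proof
  assume "x <# H = y <# H"
  then have "y \<in> x <# H" using lcos_self[OF assms(3,1)] by simp
  then obtain h where "h \<in> H" "y = x \<otimes> h" unfolding l_coset_def by blast
  then show "inv x \<otimes> y \<in> H" using assms subgroup.mem_carrier[OF assms(1)] by simp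
next
  assume "inv x \<otimes> y \<in> H"
  then have "y \<in> x <# H" using subgroup.lcos_module_rev[OF assms(1) is_group assms(2,3)] by simp
  then show "x <# H = y <# H" using l_repr_independence assms by blast
qed

lemma exists_transversal:
  assumes H: "subgroup H G"
  shows "\<exists>T. transversal H T"
proof -
  \<comment> \<open>The choice is made from the coset as a set, so \<open>r\<close> is constant on
    cosets; this gives the uniqueness of representatives.\<close>
  define r where "r g = (SOME x. x \<in> g <# H)" for g
  have r: "r g \<in> g <# H" if "g \<in> carrier G" for g
    unfolding r_def using lcos_self[OF that H] by (rule someI)
  have rG: "r g \<in> carrier G" if "g \<in> carrier G" for g
    using r[OF that] l_coset_subset_G[OF subgroup.subset[OF H] that] by blast
  have rH: "r g <# H = g <# H" if "g \<in> carrier G" for g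
    using l_repr_independence[OF r[OF that] that H] by simp
  have "transversal H (r ` carrier G)"
    unfolding transversal_def
  proof (intro conjI ballI ex_ex1I)
    show "r ` carrier G \<subseteq> carrier G" using rG by blast
    fix g assume g: "g \<in> carrier G"
    show "\<exists>t. t \<in> r ` carrier G \<and> inv t \<otimes> g \<in> H"
      using g rH[OF g] rG[OF g] lcos_eq_iff[OF H rG[OF g] g] by blast
    fix t u assume "t \<in> r ` carrier G \<and> inv t \<otimes> g \<in> H" "u \<in> r ` carrier G \<and> inv u \<otimes> g \<in> H"
    then obtain x y where xy: "x \<in> carrier G" "t = r x" "inv t \<otimes> g \<in> H"
      "y \<in> carrier G" "u = r y" "inv u \<otimes> g \<in> H" by blast
    then have "r x <# H = g <# H" "r y <# H = g <# H" using lcos_eq_iff[OF H] rG g by auto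
    then have "x <# H = y <# H" using rH xy by simp
    then show "t = u" using xy r_def by simp
  qed
  then show ?thesis by blast
qed

text \<open>\<open>k\<close> permutes the left cosets of \<open>H\<close>, and \<open>\<pi>\<close>
  is this permutation read on representatives; it is onto as an injective self-map of a finite
  set.\<close>

lemma transversal_translate:
  assumes H: "subgroup H G" and T: "transversal H T" "finite T" and k: "k \<in> carrier G"
  shows "\<exists>\<pi>. bij_betw \<pi> T T \<and> (\<forall>t \<in> T. inv (\<pi> t) \<otimes> (k \<otimes> t) \<in> H)"
proof -
  interpret H: subgroup H G by fact
  have TG: "t \<in> carrier G" if "t \<in> T" for t using T that unfolding transversal_def by blast
  have "\<forall>t \<in> T. \<exists>u. u \<in> T \<and> inv u \<otimes> (k \<otimes> t) \<in> H"
    using T(1) TG k unfolding transversal_def by (meson m_closed)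
  then obtain \<pi> where \<pi>: "\<And>t. t \<in> T \<Longrightarrow> \<pi> t \<in> T" "\<And>t. t \<in> T \<Longrightarrow> inv (\<pi> t) \<otimes> (k \<otimes> t) \<in> H" by metis
  have "inj_on \<pi> T"
  proof (rule inj_onI)
    fix t u assume tu: "t \<in> T" "u \<in> T" "\<pi> t = \<pi> u"
    let ?a = "inv (\<pi> t) \<otimes> (k \<otimes> t)" and ?b = "inv (\<pi> t) \<otimes> (k \<otimes> u)"
    have G: "t \<in> carrier G" "u \<in> carrier G" "\<pi> t \<in> carrier G" using tu TG \<pi> by auto
    have "inv ?a \<otimes> ?b \<in> H" using \<pi>(2)[OF tu(1)] \<pi>(2)[OF tu(2)] tu(3) by simp
    also have "inv ?a \<otimes> ?b = inv t \<otimes> u"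
      using G k by (simp add: inv_mult_group m_assoc)
    finally have "inv t \<otimes> u \<in> H" .
    moreover have "inv u \<otimes> u \<in> H" using G by simp
    ultimately show "t = u" using T(1) tu G unfolding transversal_def by blast
  qed
  then have "bij_betw \<pi> T T"
    using \<pi>(1) T(2) by (metis bij_betw_imageI endo_inj_surj image_subsetI)
  then show ?thesis using \<pi>(2) by blast
qed

text \<open>The counting argument behind Sylow's conjugacy theorem: \<open>I\<close> acts on the
  left cosets of \<open>P\<close>, whose number is prime to \<open>p\<close>, so some orbit has size
  \<open>m\<close> prime to \<open>p\<close>. The stabilizer of \<open>g P\<close> in
  \<open>I\<close> is \<open>I\<close> intersected with \<open>g P g^-1\<close>, which conjugation
  by \<open>g\<close> identifies with the displayed subset of \<open>P\<close>.\<close>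

lemma coset_index:
  assumes fin: "finite (carrier G)" and I: "subgroup I G" and P: "subgroup P G"
    and p: "Factorial_Ring.prime (p :: nat)" and np: "\<not> p dvd card (lcosets P)"
  shows "\<exists>g \<in> carrier G. \<exists>m. card I = card {x \<in> P. g \<otimes> x \<otimes> inv g \<in> I} * m \<and> \<not> p dvd m"
proof -
  interpret I: subgroup I G by fact
  interpret P: subgroup P G by fact
  let ?I = "G\<lparr>carrier := I\<rparr>"
  interpret gI: group ?I by (rule subgroup.subgroup_is_group[OF I is_group])
  define L where "L = lcosets P"
  define \<theta> where "\<theta> i = (\<lambda>C\<in>L. i <# C)" for i
  have LE: "\<exists>a \<in> carrier G. C = a <# P" if "C \<in> L" for C using that unfolding L_def LCOSETS_def by blast
  have LI: "a <# P \<in> L" if "a \<in> carrier G" for a using that unfolding L_def LCOSETS_def by blast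
  have act: "i <# (a <# P) = (i \<otimes> a) <# P" if "i \<in> carrier G" "a \<in> carrier G" for i a
    using lcos_m_assoc[OF P.subset that] .
  have \<theta>L: "i <# C \<in> L" if "i \<in> carrier G" "C \<in> L" for i C
    using LE[OF that(2)] act that(1) LI by auto
  have \<theta>\<theta>: "i <# (j <# C) = (i \<otimes> j) <# C" if "i \<in> carrier G" "j \<in> carrier G" "C \<in> L" for i j C
    using LE[OF that(3)] act that m_assoc by auto
  have \<theta>1: "\<one> <# C = C" if "C \<in> L" for C using LE[OF that] act by auto
  have \<theta>_Bij: "\<theta> i \<in> Bij L" if i: "i \<in> carrier G" for i
  proof -
    have "bij_betw (\<lambda>C. i <# C) L L"
      using i \<theta>L \<theta>\<theta> \<theta>1 by (intro bij_betwI[of _ _ _ "\<lambda>C. inv i <# C"]) auto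
    then show ?thesis unfolding Bij_def \<theta>_def by (auto cong: bij_betw_cong)
  qed
  interpret act: group_action ?I L \<theta>
    unfolding group_action_def group_hom_def group_hom_axioms_def
  proof (intro conjI gI.is_group group_BijGroup homI)
    show "\<theta> i \<in> carrier (BijGroup L)" if "i \<in> carrier ?I" for i
      using that \<theta>_Bij I.subset by (auto simp: BijGroup_def)
    fix i j assume "i \<in> carrier ?I" "j \<in> carrier ?I"
    then have ij: "i \<in> carrier G" "j \<in> carrier G" using I.subset by auto
    then have "\<theta> (i \<otimes> j) = compose L (\<theta> i) (\<theta> j)"
      unfolding \<theta>_def compose_def using \<theta>L \<theta>\<theta> by (intro restrict_ext) auto
    then show "\<theta> (i \<otimes>\<^bsub>?I\<^esub> j) = \<theta> i \<otimes>\<^bsub>BijGroup L\<^esub> \<theta> j"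
      using ij \<theta>_Bij by (simp add: BijGroup_def)
  qed
  have finL: "finite L" unfolding L_def LCOSETS_def using fin by auto
  let ?O = "orbits ?I L \<theta>"
  have "card L = sum card ?O"
  proof -
    have sub: "orb \<subseteq> L" if "orb \<in> ?O" for orb
      using partition.incl[OF act.orbit_partition that] .
    have "L = \<Union>?O"
      using partition.unique_class[OF act.orbit_partition] sub by blast
    moreover have "card (\<Union>?O) = sum card ?O"
      using act.disjoint_union sub finite_subset[OF _ finL]
      by (intro card_Union_disjoint) (auto simp: pairwise_def disjnt_def)
    ultimately show ?thesis by simp
  qed
  then obtain orb where orb: "orb \<in> ?O" "\<not> p dvd card orb"
    using np dvd_sum[of ?O p card] unfolding L_def by metis
  then obtain C where C: "C \<in> L" "orb = orbit ?I \<theta> C" unfolding orbits_def by blast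
  obtain g where g: "g \<in> carrier G" "C = g <# P" using LE[OF C(1)] by blast
  let ?K = "{x \<in> P. g \<otimes> x \<otimes> inv g \<in> I}"
  have stab: "stabilizer ?I \<theta> C = {i \<in> I. inv g \<otimes> i \<otimes> g \<in> P}"
  proof -
    have "\<theta> i C = C \<longleftrightarrow> inv g \<otimes> i \<otimes> g \<in> P" if i: "i \<in> I" for i
    proof -
      have iG: "i \<in> carrier G" using i I.subset by blast
      have "\<theta> i C = (i \<otimes> g) <# P" unfolding \<theta>_def using C g act iG by simp
      then have "\<theta> i C = C \<longleftrightarrow> g <# P = (i \<otimes> g) <# P" using g by auto
      then show ?thesis using lcos_eq_iff[OF P g(1), of "i \<otimes> g"] iG g(1) by (simp add: m_assoc)
    qed
    then show ?thesis unfolding stabilizer_def by auto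
  qed
  have "bij_betw (\<lambda>x. g \<otimes> x \<otimes> inv g) ?K {i \<in> I. inv g \<otimes> i \<otimes> g \<in> P}"
  proof (intro bij_betwI[of _ _ _ "\<lambda>i. inv g \<otimes> i \<otimes> g"])
    have *: "inv g \<otimes> (g \<otimes> x \<otimes> inv g) \<otimes> g = x" "g \<otimes> (inv g \<otimes> x \<otimes> g) \<otimes> inv g = x"
      if "x \<in> carrier G" for x
      using that g(1) by (simp_all add: m_assoc)
    show "(\<lambda>x. g \<otimes> x \<otimes> inv g) \<in> ?K \<rightarrow> {i \<in> I. inv g \<otimes> i \<otimes> g \<in> P}" using * P.subset by auto
    show "(\<lambda>i. inv g \<otimes> i \<otimes> g) \<in> {i \<in> I. inv g \<otimes> i \<otimes> g \<in> P} \<rightarrow> ?K" using * I.subset by auto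
    show "inv g \<otimes> (g \<otimes> x \<otimes> inv g) \<otimes> g = x" if "x \<in> ?K" for x using that * P.subset by auto
    show "g \<otimes> (inv g \<otimes> y \<otimes> g) \<otimes> inv g = y" if "y \<in> {i \<in> I. inv g \<otimes> i \<otimes> g \<in> P}" for y
      using that * I.subset by auto
  qed
  then have "card ?K = card (stabilizer ?I \<theta> C)" unfolding stab by (rule bij_betw_same_card)
  moreover have "card orb * card (stabilizer ?I \<theta> C) = card I"
    using act.orbit_stabilizer_theorem[OF C(1)] C(2) by (simp add: order_def)
  ultimately have "card I = card ?K * card orb" by (simp add: mult.commute)
  then show ?thesis using g(1) orb(2) by blast
qed

end

context finite_ring_action
begin

definition inertia :: "'a set \<Rightarrow> 'g set" where
  "inertia q = {g \<in> carrier G. \<forall>x \<in> carrier R. \<phi> g x \<ominus> x \<in> q}"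

lemma inertia_subgroup:
  assumes "primeideal q R"
  shows "subgroup (inertia q) G"
proof (rule G.subgroupI)
  interpret q: primeideal q R by fact
  show "inertia q \<subseteq> carrier G" unfolding inertia_def by blast
  have "\<one>\<^bsub>G\<^esub> \<in> inertia q" unfolding inertia_def using q.zero_mem by (simp add: a_minus_def r_neg)
  then show "inertia q \<noteq> {}" by blast
  fix g assume "g \<in> inertia q"
  then have g: "g \<in> carrier G" "\<And>x. x \<in> carrier R \<Longrightarrow> \<phi> g x \<ominus> x \<in> q" unfolding inertia_def by auto
  have "\<phi> (inv\<^bsub>G\<^esub> g) x \<ominus> x \<in> q" if x: "x \<in> carrier R" for x
  proof -
    let ?y = "\<phi> (inv\<^bsub>G\<^esub> g) x"
    have y: "?y \<in> carrier R" using g x by simp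
    have "\<ominus> (x \<ominus> ?y) \<in> q" using g(2)[OF y] g(1) x q.a_inv_closed by simp
    moreover have "\<ominus> (x \<ominus> ?y) = ?y \<ominus> x" using x y by algebra
    ultimately show ?thesis by simp
  qed
  then show "inv\<^bsub>G\<^esub> g \<in> inertia q" unfolding inertia_def using g by simp
  fix h assume "h \<in> inertia q"
  then have h: "h \<in> carrier G" "\<And>x. x \<in> carrier R \<Longrightarrow> \<phi> h x \<ominus> x \<in> q" unfolding inertia_def by auto
  have "\<phi> (g \<otimes>\<^bsub>G\<^esub> h) x \<ominus> x \<in> q" if x: "x \<in> carrier R" for x
  proof -
    have y: "\<phi> h x \<in> carrier R" "\<phi> g (\<phi> h x) \<in> carrier R" using g h x by simp_all
    have "\<phi> g (\<phi> h x) \<ominus> x = (\<phi> g (\<phi> h x) \<ominus> \<phi> h x) \<oplus> (\<phi> h x \<ominus> x)" using x y by algebra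
    then show ?thesis using g(2)[OF y(1)] h(2)[OF x] q.a_closed act_comp g(1) h(1) x by simp
  qed
  then show "g \<otimes>\<^bsub>G\<^esub> h \<in> inertia q" unfolding inertia_def using g h by simp
qed

lemma inertia_act_preimage:
  assumes "primeideal q R" "g \<in> carrier G"
  shows "inertia (act_preimage g q) = {x \<in> carrier G. g \<otimes>\<^bsub>G\<^esub> x \<otimes>\<^bsub>G\<^esub> inv\<^bsub>G\<^esub> g \<in> inertia q}"
proof -
  have "(\<forall>r \<in> carrier R. \<phi> x r \<ominus> r \<in> act_preimage g q) \<longleftrightarrow>
      (\<forall>r \<in> carrier R. \<phi> (g \<otimes>\<^bsub>G\<^esub> x \<otimes>\<^bsub>G\<^esub> inv\<^bsub>G\<^esub> g) r \<ominus> r \<in> q)" (is "?l \<longleftrightarrow> ?r")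
    if x: "x \<in> carrier G" for x
  proof
    assume l: ?l
    show ?r
    proof
      fix r assume r: "r \<in> carrier R"
      let ?s = "\<phi> (inv\<^bsub>G\<^esub> g) r"
      have "\<phi> g (\<phi> x ?s \<ominus> ?s) \<in> q" using l r assms(2) unfolding act_preimage_def by simp
      then show "\<phi> (g \<otimes>\<^bsub>G\<^esub> x \<otimes>\<^bsub>G\<^esub> inv\<^bsub>G\<^esub> g) r \<ominus> r \<in> q" using r x assms(2) by (simp add: act_comp)
    qed
  next
    assume r: ?r
    show ?l
    proof
      fix s assume s: "s \<in> carrier R"
      have "\<phi> (g \<otimes>\<^bsub>G\<^esub> x \<otimes>\<^bsub>G\<^esub> inv\<^bsub>G\<^esub> g) (\<phi> g s) \<ominus> \<phi> g s \<in> q" using r s assms(2) by simp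
      then show "\<phi> x s \<ominus> s \<in> act_preimage g q" unfolding act_preimage_def using s x assms(2) by (simp add: act_comp)
    qed
  qed
  then show ?thesis unfolding inertia_def using assms(2) by auto
qed

lemma card_inertia_act_preimage:
  assumes "primeideal q R" "g \<in> carrier G"
  shows "card (inertia (act_preimage g q)) = card (inertia q)"
proof (rule bij_betw_same_card)
  have sub: "inertia q \<subseteq> carrier G" unfolding inertia_def by blast
  have *: "inv\<^bsub>G\<^esub> g \<otimes>\<^bsub>G\<^esub> (g \<otimes>\<^bsub>G\<^esub> x \<otimes>\<^bsub>G\<^esub> inv\<^bsub>G\<^esub> g) \<otimes>\<^bsub>G\<^esub> g = x"
    "g \<otimes>\<^bsub>G\<^esub> (inv\<^bsub>G\<^esub> g \<otimes>\<^bsub>G\<^esub> x \<otimes>\<^bsub>G\<^esub> g) \<otimes>\<^bsub>G\<^esub> inv\<^bsub>G\<^esub> g = x"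
    if "x \<in> carrier G" for x
    using that assms(2) by (simp_all add: G.m_assoc)
  show "bij_betw (\<lambda>x. g \<otimes>\<^bsub>G\<^esub> x \<otimes>\<^bsub>G\<^esub> inv\<^bsub>G\<^esub> g) (inertia (act_preimage g q)) (inertia q)"
    unfolding inertia_act_preimage[OF assms] using * sub assms(2)
    by (intro bij_betwI[of _ _ _ "\<lambda>i. inv\<^bsub>G\<^esub> g \<otimes>\<^bsub>G\<^esub> i \<otimes>\<^bsub>G\<^esub> g"]) auto
qed

text \<open>The sum of a function constant on left cosets is a sum over \<open>G/H\<close>, and
  \<open>k\<close> only permutes its terms. It serves both the invariance of traces and the
  equivariance of a corestricted cochain.\<close>

lemma transversal_finsum:
  assumes H: "subgroup H G" and T: "G.transversal H T" and k: "k \<in> carrier G"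
    and f: "\<And>g. g \<in> carrier G \<Longrightarrow> f g \<in> carrier R"
      "\<And>g h. g \<in> carrier G \<Longrightarrow> h \<in> H \<Longrightarrow> f (g \<otimes>\<^bsub>G\<^esub> h) = f g"
  shows "(\<Oplus>t\<in>T. f (k \<otimes>\<^bsub>G\<^esub> t)) = (\<Oplus>t\<in>T. f t)"
proof -
  have TG: "T \<subseteq> carrier G" using T unfolding G.transversal_def by blast
  then have "finite T" using finite_G finite_subset by blast
  then obtain \<pi> where \<pi>: "bij_betw \<pi> T T" "\<And>t. t \<in> T \<Longrightarrow> inv\<^bsub>G\<^esub> (\<pi> t) \<otimes>\<^bsub>G\<^esub> (k \<otimes>\<^bsub>G\<^esub> t) \<in> H"
    using G.transversal_translate[OF H T _ k] by blast
  have "(\<Oplus>t\<in>T. f (k \<otimes>\<^bsub>G\<^esub> t)) = (\<Oplus>t\<in>T. f (\<pi> t))"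
  proof (intro finsum_cong')
    fix t assume t: "t \<in> T"
    then have G: "t \<in> carrier G" "\<pi> t \<in> carrier G" using TG \<pi>(1) by (auto simp: bij_betw_def)
    have "f (\<pi> t \<otimes>\<^bsub>G\<^esub> (inv\<^bsub>G\<^esub> (\<pi> t) \<otimes>\<^bsub>G\<^esub> (k \<otimes>\<^bsub>G\<^esub> t))) = f (\<pi> t)" using f(2) G(2) \<pi>(2)[OF t] by simp
    moreover have "\<pi> t \<otimes>\<^bsub>G\<^esub> (inv\<^bsub>G\<^esub> (\<pi> t) \<otimes>\<^bsub>G\<^esub> (k \<otimes>\<^bsub>G\<^esub> t)) = k \<otimes>\<^bsub>G\<^esub> t"
      using G k by (simp add: G.m_assoc[symmetric])
    ultimately show "f (k \<otimes>\<^bsub>G\<^esub> t) = f (\<pi> t)" by simp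
  next
    have "\<pi> t \<in> carrier G" if "t \<in> T" for t using that TG \<pi>(1) by (auto simp: bij_betw_def)
    then show "(\<lambda>t. f (\<pi> t)) \<in> T \<rightarrow> carrier R" using f(1) by simp
  qed simp
  also have "\<dots> = (\<Oplus>t\<in>\<pi> ` T. f t)"
    using \<pi>(1) f TG by (intro finsum_reindex[symmetric]) (auto simp: bij_betw_def)
  also have "\<pi> ` T = T" using \<pi>(1) by (simp add: bij_betw_def)
  finally show ?thesis .
qed

text \<open>A coset \<open>t H\<close> either lies in \<open>I\<close> or misses it, so the
  representatives in \<open>I\<close> form a transversal of \<open>I/H\<close>.\<close>

lemma card_transversal_Int:
  assumes H: "subgroup H G" and I: "subgroup I G" and sub: "H \<subseteq> I" and T: "G.transversal H T"
  shows "card I = card (T \<inter> I) * card H"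
proof -
  interpret H: subgroup H G by fact
  interpret I: subgroup I G by fact
  have TG: "T \<subseteq> carrier G" using T unfolding G.transversal_def by blast
  have u: "t = t'" if "t \<in> T" "t' \<in> T" "g \<in> carrier G" "inv\<^bsub>G\<^esub> t \<otimes>\<^bsub>G\<^esub> g \<in> H" "inv\<^bsub>G\<^esub> t' \<otimes>\<^bsub>G\<^esub> g \<in> H" for t t' g
    using that T unfolding G.transversal_def by blast
  have "bij_betw (\<lambda>(t, h). t \<otimes>\<^bsub>G\<^esub> h) ((T \<inter> I) \<times> H) I"
    unfolding bij_betw_def
  proof
    show "inj_on (\<lambda>(t, h). t \<otimes>\<^bsub>G\<^esub> h) ((T \<inter> I) \<times> H)"
    proof (rule inj_onI, clarify)
      fix t h t' h' assume a: "t \<in> T" "h \<in> H" "t' \<in> T" "h' \<in> H" "t \<otimes>\<^bsub>G\<^esub> h = t' \<otimes>\<^bsub>G\<^esub> h'"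
      then have c: "t \<in> carrier G" "t' \<in> carrier G" "h \<in> carrier G" "h' \<in> carrier G" using TG H.subset by auto
      have "inv\<^bsub>G\<^esub> t \<otimes>\<^bsub>G\<^esub> (t \<otimes>\<^bsub>G\<^esub> h) = h" "inv\<^bsub>G\<^esub> t' \<otimes>\<^bsub>G\<^esub> (t' \<otimes>\<^bsub>G\<^esub> h') = h'"
        using c by (simp_all add: G.m_assoc[symmetric])
      then have "t = t'" using u[OF a(1,3), of "t \<otimes>\<^bsub>G\<^esub> h"] a c by simp
      then show "t = t' \<and> h = h'" using a(5) c by simp
    qed
    show "(\<lambda>(t, h). t \<otimes>\<^bsub>G\<^esub> h) ` ((T \<inter> I) \<times> H) = I"
    proof
      show "(\<lambda>(t, h). t \<otimes>\<^bsub>G\<^esub> h) ` ((T \<inter> I) \<times> H) \<subseteq> I" using sub by auto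
      show "I \<subseteq> (\<lambda>(t, h). t \<otimes>\<^bsub>G\<^esub> h) ` ((T \<inter> I) \<times> H)"
      proof
        fix g assume g: "g \<in> I"
        then have gG: "g \<in> carrier G" using I.subset by blast
        then obtain t where t: "t \<in> T" "inv\<^bsub>G\<^esub> t \<otimes>\<^bsub>G\<^esub> g \<in> H" using T unfolding G.transversal_def by blast
        then have tG: "t \<in> carrier G" using TG by blast
        have e: "g = t \<otimes>\<^bsub>G\<^esub> (inv\<^bsub>G\<^esub> t \<otimes>\<^bsub>G\<^esub> g)" using tG gG by (simp add: G.m_assoc[symmetric])
        have "t = g \<otimes>\<^bsub>G\<^esub> inv\<^bsub>G\<^esub> (inv\<^bsub>G\<^esub> t \<otimes>\<^bsub>G\<^esub> g)"
          using tG gG by (simp add: G.inv_mult_group G.m_assoc[symmetric])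
        then have "t \<in> I" using g t(2) sub I.m_closed I.m_inv_closed by (metis subsetD)
        then show "g \<in> (\<lambda>(t, h). t \<otimes>\<^bsub>G\<^esub> h) ` ((T \<inter> I) \<times> H)" using e t by (intro image_eqI[of _ _ "(t, inv\<^bsub>G\<^esub> t \<otimes>\<^bsub>G\<^esub> g)"]) auto
      qed
    qed
  qed
  from bij_betw_same_card[OF this] show ?thesis by (simp add: card_cartesian_product)
qed

text \<open>By Bezout some multiple of \<open>m\<close> is 1 more than a multiple of
  \<open>p\<close>, so \<open>m\<close> in \<open>q\<close> would put \<open>\<one>\<close> into
  \<open>q\<close>.\<close>

lemma prime_to_char_not_in_prime:
  assumes p: "Factorial_Ring.prime (p :: nat)" and char: "add_pow R p \<one> = \<zero>"
    and q: "primeideal q R" and m: "\<not> p dvd m"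
  shows "add_pow R m \<one> \<notin> q"
proof
  assume mq: "add_pow R m \<one> \<in> q"
  interpret q: primeideal q R by fact
  have "coprime m p" using p m prime_imp_coprime coprime_commute by blast
  then obtain a b where ab: "a * m = b * p + 1"
    using bezout_nat[of m p] p m by (metis coprime_imp_gcd_eq_1 dvd_0_right gcd_nat.neutr_eq_iff mult.commute)
  have "add_pow R (a * m) \<one> = add_pow R a \<one> \<otimes> add_pow R m \<one>"
    by (simp add: add_pow_ldistr add.nat_pow_pow mult.commute)
  then have "add_pow R (a * m) \<one> \<in> q" using mq q.I_l_closed by simp
  moreover have "add_pow R (b * p + 1) \<one> = add_pow R (b * p) \<one> \<oplus> \<one>" by simp
  moreover have "add_pow R (b * p) \<one> = \<zero>" by (rule add_pow_dvd_eq_zero[OF char]) auto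
  ultimately have "\<one> \<in> q" using ab by simp
  then show False using q.one_imp_carrier q.I_notcarr by blast
qed

text \<open>The maps \<open>s \<mapsto> t (\<Prod>\<^sub>h h s)\<close> are multiplicative characters with values in \<open>R/q\<close>, and the one for
  \<open>t\<close> agrees with the one for \<open>1\<close> exactly when \<open>t\<close> lies in the inertia group.\<close>

theorem trace_norm_not_in_prime:
  assumes p: "Factorial_Ring.prime (p :: nat)" and char: "add_pow R p \<one> = \<zero>"
    and q: "primeideal q R" and H: "subgroup H G" and sub: "H \<subseteq> inertia q"
    and cardH: "card H = p ^ e" and m: "card (inertia q) = card H * m" "\<not> p dvd m"
    and T: "G.transversal H T"
  shows "\<exists>s \<in> carrier R. (\<Oplus>t\<in>T. \<phi> t (\<Otimes>h\<in>H. \<phi> h s)) \<notin> q"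
proof (rule ccontr)
  interpret q: primeideal q R by fact
  interpret H: subgroup H G by fact
  define N where "N s = (\<Otimes>h\<in>H. \<phi> h s)" for s
  assume "\<not> ?thesis"
  then have rel: "(\<Oplus>t\<in>T. \<phi> t (N s)) \<in> q" if "s \<in> carrier R" for s using that unfolding N_def by blast
  have HG: "H \<subseteq> carrier G" by (rule H.subset)
  have finH: "finite H" using HG finite_G finite_subset by blast
  have TG: "T \<subseteq> carrier G" using T unfolding G.transversal_def by blast
  have finT: "finite T" using TG finite_G finite_subset by blast
  have Nc: "N s \<in> carrier R" if "s \<in> carrier R" for s unfolding N_def using that HG by (intro finprod_closed) auto
  have N1: "N \<one> = \<one>" unfolding N_def using HG by (intro finprod_one_eqI) auto
  have Nm: "N (s \<otimes> t) = N s \<otimes> N t" if "s \<in> carrier R" "t \<in> carrier R" for s t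
  proof -
    have "N (s \<otimes> t) = (\<Otimes>h\<in>H. \<phi> h s \<otimes> \<phi> h t)" unfolding N_def using that HG by (intro finprod_cong') auto
    also have "\<dots> = N s \<otimes> N t" unfolding N_def using that HG by (intro finprod_multf) auto
    finally show ?thesis .
  qed
  have Nt: "\<phi> t (N s) = (\<Otimes>h\<in>H. \<phi> (t \<otimes>\<^bsub>G\<^esub> h) s)" if "t \<in> carrier G" "s \<in> carrier R" for t s
    unfolding N_def using that HG by (subst act_finprod) (auto intro!: finprod_cong' simp: act_comp)
  \<comment> \<open>Modulo \<open>q\<close> a product of factors congruent to \<open>x\<close> is a
    power of \<open>x\<close>. Applied to norms, it produces \<open>card H\<close>-th powers
    wherever \<open>H\<close> acts trivially.\<close>
  have pow_cong: "(\<Otimes>h\<in>K. f h) \<ominus> x [^] card K \<in> q"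
    if "finite K" "f \<in> K \<rightarrow> carrier R" "x \<in> carrier R" "\<And>h. h \<in> K \<Longrightarrow> f h \<ominus> x \<in> q" for K :: "'g set" and f x
    using that
  proof (induction K rule: finite_induct)
    case empty
    then show ?case using q.zero_mem by (simp add: a_minus_def r_neg)
  next
    case (insert k K)
    have c: "f k \<in> carrier R" "(\<Otimes>h\<in>K. f h) \<in> carrier R" "x [^] card K \<in> carrier R"
      using insert.prems by auto
    have "f k \<otimes> (\<Otimes>h\<in>K. f h) \<ominus> x [^] card K \<otimes> x =
        f k \<otimes> ((\<Otimes>h\<in>K. f h) \<ominus> x [^] card K) \<oplus> (f k \<ominus> x) \<otimes> x [^] card K"
      using c insert.prems(2) by algebra
    also have "\<dots> \<in> q"
    proof (rule q.a_closed)
      have "(\<Otimes>h\<in>K. f h) \<ominus> x [^] card K \<in> q" using insert by (simp add: Pi_iff)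
      then show "f k \<otimes> ((\<Otimes>h\<in>K. f h) \<ominus> x [^] card K) \<in> q" using c(1) by (rule q.I_l_closed)
      show "(f k \<ominus> x) \<otimes> x [^] card K \<in> q" using insert.prems(3)[of k] c(3) by (simp add: q.I_r_closed)
    qed
    finally show ?case using insert c by (simp add: Pi_iff)
  qed
  \<comment> \<open>The representative of the coset \<open>H\<close> stands in for the identity,
    which need not belong to \<open>T\<close>.\<close>
  obtain t0 where t0: "t0 \<in> T" "inv\<^bsub>G\<^esub> t0 \<in> H"
    using T unfolding G.transversal_def by (metis G.one_closed G.r_one G.inv_closed subsetD)
  have t0H: "t0 \<in> H" using H.m_inv_closed[OF t0(2)] t0(1) TG by auto
  have in_inertia: "\<phi> g s \<ominus> s \<in> q" if "g \<in> inertia q" "s \<in> carrier R" for g s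
    using that unfolding inertia_def by blast
  have inertia_ok: "\<phi> t (N s) \<ominus> s [^] card H \<in> q" if t: "t \<in> inertia q" and s: "s \<in> carrier R" for t s
  proof -
    interpret I: subgroup "inertia q" G by (rule inertia_subgroup[OF q])
    have "t \<otimes>\<^bsub>G\<^esub> h \<in> inertia q" if "h \<in> H" for h using t sub that by blast
    then show ?thesis
      using Nt[of t s] s t HG I.subset by (auto intro!: pow_cong in_inertia simp: finH subset_iff)
  qed
  have inertia_only: "t \<in> inertia q"
    if t: "t \<in> carrier G" and eq: "\<And>s. s \<in> carrier R \<Longrightarrow> \<phi> t (N s) \<ominus> s [^] card H \<in> q" for t
  proof -
    \<comment> \<open>The factor at \<open>h = 1\<close> puts the whole norm into \<open>q\<close>,
      and the norm is congruent to a power of \<open>s\<close>. So \<open>t^-1 q\<close> is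
      contained in \<open>q\<close>, and the finite order of \<open>t\<close> gives
      equality.\<close>
    have "s \<in> q" if s: "s \<in> carrier R" "\<phi> t s \<in> q" for s
    proof (rule pow_mem_prime[OF q s(1)])
      have "\<phi> t (N s) \<in> q"
        unfolding Nt[OF t s(1)]
      proof (rule q.finprod_mem[OF cring_axioms finH])
        show "\<one>\<^bsub>G\<^esub> \<in> H" by simp
        show "\<phi> (t \<otimes>\<^bsub>G\<^esub> \<one>\<^bsub>G\<^esub>) s \<in> q" using s t by simp
      qed (use t s HG in auto)
      then have "\<ominus> (\<phi> t (N s) \<ominus> s [^] card H) \<oplus> \<phi> t (N s) \<in> q"
        using eq[OF s(1)] q.a_closed q.a_inv_closed by blast
      moreover have "\<ominus> (\<phi> t (N s) \<ominus> s [^] card H) \<oplus> \<phi> t (N s) = s [^] card H"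
      proof -
        have "\<phi> t (N s) \<in> carrier R" "s [^] card H \<in> carrier R" using Nc s t by simp_all
        then show ?thesis by algebra
      qed
      ultimately show "s [^] card H \<in> q" by simp
    qed
    then have "act_preimage t q \<subseteq> q" unfolding act_preimage_def by blast
    then have "act_preimage t q = q"
    proof -
      assume sub': "act_preimage t q \<subseteq> q"
      have ti: "inv\<^bsub>G\<^esub> t \<in> carrier G" using t by simp
      have "\<phi> (inv\<^bsub>G\<^esub> t) x \<in> act_preimage t q" if "x \<in> q" for x
        using that t q.Icarr unfolding act_preimage_def by simp
      then show ?thesis using subset_of_act_subset[OF ti _ sub'] q.Icarr by blast
    qed
    then have tq: "\<phi> t s \<in> q" if "s \<in> q" for s using that unfolding act_preimage_def by blast
    \<comment> \<open>Now that \<open>t\<close> preserves \<open>q\<close>, all \<open>t h s\<close>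
      are congruent to \<open>t s\<close>, so the norm is also congruent to
      \<open>(t s)^(p^e)\<close>. Comparison with \<open>s^(p^e)\<close> and injectivity of
      Frobenius modulo \<open>q\<close> remove the exponent.\<close>
    have "\<phi> t s \<ominus> s \<in> q" if s: "s \<in> carrier R" for s
    proof (rule frobenius_injective_mod[OF p char q])
      have "\<phi> (t \<otimes>\<^bsub>G\<^esub> h) s \<ominus> \<phi> t s \<in> q" if h: "h \<in> H" for h
      proof -
        have hG: "h \<in> carrier G" using h HG by blast
        have "\<phi> t (\<phi> h s \<ominus> s) \<in> q" using in_inertia[of h s] sub h s tq by blast
        then show ?thesis using t hG s by (simp add: act_comp)
      qed
      then have "\<phi> t (N s) \<ominus> \<phi> t s [^] card H \<in> q"
        unfolding Nt[OF t s] using t s HG finH by (intro pow_cong) auto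
      then have d: "(\<phi> t (N s) \<ominus> s [^] card H) \<ominus> (\<phi> t (N s) \<ominus> \<phi> t s [^] card H) \<in> q"
        by (rule q.minus_closed[OF eq[OF s]])
      have "\<phi> t (N s) \<in> carrier R" "s [^] card H \<in> carrier R" "\<phi> t s [^] card H \<in> carrier R"
        using Nc s t by simp_all
      then have "(\<phi> t (N s) \<ominus> s [^] card H) \<ominus> (\<phi> t (N s) \<ominus> \<phi> t s [^] card H) =
        \<phi> t s [^] card H \<ominus> s [^] card H" by algebra
      then show "\<phi> t s [^] (p ^ e) \<ominus> s [^] (p ^ e) \<in> q" using d cardH by simp
    qed (use s t in auto)
    then show ?thesis unfolding inertia_def using t by blast
  qed
  have E: "{t \<in> T. \<forall>s \<in> carrier R. \<phi> t (N s) \<ominus> \<phi> t0 (N s) \<in> q} = T \<inter> inertia q"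
  proof (intro subset_antisym subsetI)
    have c: "\<phi> t (N s) \<in> carrier R" "\<phi> t0 (N s) \<in> carrier R" "s [^] card H \<in> carrier R"
      if "t \<in> T" "s \<in> carrier R" for t s using that TG t0 Nc by auto
    have t0q: "\<phi> t0 (N s) \<ominus> s [^] card H \<in> q" if "s \<in> carrier R" for s
      using inertia_ok t0H sub that by blast
    {
      fix t assume t: "t \<in> {t \<in> T. \<forall>s \<in> carrier R. \<phi> t (N s) \<ominus> \<phi> t0 (N s) \<in> q}"
      have "\<phi> t (N s) \<ominus> s [^] card H \<in> q" if s: "s \<in> carrier R" for s
      proof -
        have "\<phi> t (N s) \<ominus> s [^] card H = (\<phi> t (N s) \<ominus> \<phi> t0 (N s)) \<oplus> (\<phi> t0 (N s) \<ominus> s [^] card H)"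
          using c[OF _ s, of t] CollectD[OF t] by algebra
        then show ?thesis using t s t0q q.a_closed by simp
      qed
      then show "t \<in> T \<inter> inertia q" using t TG inertia_only by blast
    next
      fix t assume t: "t \<in> T \<inter> inertia q"
      have "\<phi> t (N s) \<ominus> \<phi> t0 (N s) \<in> q" if s: "s \<in> carrier R" for s
      proof -
        have "\<phi> t (N s) \<ominus> \<phi> t0 (N s) = (\<phi> t (N s) \<ominus> s [^] card H) \<ominus> (\<phi> t0 (N s) \<ominus> s [^] card H)"
          using c[OF IntD1[OF t] s] by algebra
        then show ?thesis using t s t0q inertia_ok q.minus_closed by simp
      qed
      then show "t \<in> {t \<in> T. \<forall>s \<in> carrier R. \<phi> t (N s) \<ominus> \<phi> t0 (N s) \<in> q}" using t by blast
    }
  qed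
  \<comment> \<open>All coefficients are \<open>\<one>\<close>, so independence says that the number
    of representatives in the inertia group vanishes modulo \<open>q\<close>. This number is the
    index \<open>m\<close>, which is prime to \<open>p\<close>.\<close>
  have "(\<Oplus>t\<in>{t \<in> T. \<forall>s \<in> carrier R. \<phi> t (N s) \<ominus> \<phi> t0 (N s) \<in> q}. \<one>) \<in> q"
  proof (rule artin_independence[OF q finT t0(1)])
    fix s assume s: "s \<in> carrier R"
    have "(\<Oplus>t\<in>T. \<one> \<otimes> \<phi> t (N s)) = (\<Oplus>t\<in>T. \<phi> t (N s))"
      using s TG Nc by (intro finsum_cong') auto
    then show "(\<Oplus>t\<in>T. \<one> \<otimes> \<phi> t (N s)) \<in> q" using rel[OF s] by simp
  qed (use TG Nc N1 Nm in auto)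
  then have "add_pow R (card (T \<inter> inertia q)) \<one> \<in> q" unfolding E using finT by (simp add: add.finprod_const)
  moreover have "card (T \<inter> inertia q) = m"
  proof -
    have "card H \<noteq> 0" using cardH p prime_gt_0_nat by simp
    moreover have "card (inertia q) = card (T \<inter> inertia q) * card H"
      by (rule card_transversal_Int[OF H inertia_subgroup[OF q] sub T])
    ultimately show ?thesis using m(1) by simp
  qed
  ultimately show False using prime_to_char_not_in_prime[OF p char q m(2)] by simp
qed

end

section \<open>Homogeneous cochains\<close>

context cring
begin

lemma finsum_minus:
  "f \<in> B \<rightarrow> carrier R \<Longrightarrow> (\<Oplus>i\<in>B. \<ominus> f i) = \<ominus> (\<Oplus>i\<in>B. f i)"
  by (induction B rule: infinite_finite_induct) (simp_all add: Pi_iff minus_add)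

lemma finsum_lessThan_Suc:
  assumes "\<And>i. i \<le> n \<Longrightarrow> f i \<in> carrier R"
  shows "(\<Oplus>i\<in>{..<Suc n}. f i) = f 0 \<oplus> (\<Oplus>i\<in>{..<n}. f (Suc i))"
proof (cases n)
  case 0
  have "{..<Suc 0} = {0::nat}" by auto
  then show ?thesis using assms 0 by simp
next
  case (Suc m)
  then have "(\<Oplus>i\<in>{..<Suc n}. f i) = (\<Oplus>i\<in>{..Suc m}. f i)" by (simp add: lessThan_Suc_atMost)
  also have "\<dots> = (\<Oplus>i\<in>{..m}. f (Suc i)) \<oplus> f 0" using assms Suc by (intro finsum_Suc2) auto
  finally show ?thesis using assms Suc by (subst a_comm) (auto simp: lessThan_Suc_atMost)
qed

text \<open>The differential of homogeneous cochains, the alternating sum over the deletions of an entry.\<close>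

fun hdiff :: "('g list \<Rightarrow> 'a) \<Rightarrow> 'g list \<Rightarrow> 'a" where
  "hdiff E [] = \<zero>"
| "hdiff E (x # xs) = E xs \<ominus> hdiff (\<lambda>ys. E (x # ys)) xs"

text \<open>The prism operator, a chain homotopy between the identity and composition with \<open>\<rho>\<close>.\<close>

fun prism :: "('g \<Rightarrow> 'g) \<Rightarrow> ('g list \<Rightarrow> 'a) \<Rightarrow> 'g list \<Rightarrow> 'a" where
  "prism \<rho> E [] = \<zero>"
| "prism \<rho> E (x # xs) = \<ominus> E (x # map \<rho> (x # xs)) \<ominus> prism \<rho> (\<lambda>ys. E (x # ys)) xs"

end

text \<open>Values off the lists of length \<open>n\<close> over \<open>S\<close> are arbitrary,
  which spares all restrictions. With an ideal for \<open>I\<close> the predicate says that a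
  cochain vanishes modulo \<open>I\<close>.\<close>

definition cochain :: "'g set \<Rightarrow> nat \<Rightarrow> 'r set \<Rightarrow> ('g list \<Rightarrow> 'r) \<Rightarrow> bool" where
  "cochain S n I f \<longleftrightarrow> (\<forall>gs. length gs = n \<longrightarrow> set gs \<subseteq> S \<longrightarrow> f gs \<in> I)"

lemma cochainD: "cochain S n I f \<Longrightarrow> length gs = n \<Longrightarrow> set gs \<subseteq> S \<Longrightarrow> f gs \<in> I"
  unfolding cochain_def by blast

lemma cochain_Cons: "cochain S (Suc n) I f \<Longrightarrow> g \<in> S \<Longrightarrow> cochain S n I (\<lambda>gs. f (g # gs))"
  unfolding cochain_def by auto

lemma cochain_subset: "cochain S n I f \<Longrightarrow> S' \<subseteq> S \<Longrightarrow> cochain S' n I f"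
  unfolding cochain_def by blast

context cring
begin

lemma hdiff_closed:
  assumes "cochain S n (carrier R) E" "length xs = Suc n" "set xs \<subseteq> S"
  shows "hdiff E xs \<in> carrier R"
  using assms
proof (induction xs arbitrary: E n)
  case (Cons x xs)
  have "E xs \<in> carrier R" using Cons.prems cochainD[OF Cons.prems(1)] by simp
  moreover have "hdiff (\<lambda>ys. E (x # ys)) xs \<in> carrier R"
  proof (cases n)
    case (Suc m)
    then show ?thesis using Cons.prems Cons.IH[OF cochain_Cons[of S m "carrier R" E x]] by simp
  qed (use Cons.prems in simp)
  ultimately show ?case by simp
qed simp

lemma hdiff_cochain: "cochain S n (carrier R) E \<Longrightarrow> cochain S (Suc n) (carrier R) (hdiff E)"
  using hdiff_closed unfolding cochain_def by blast

lemma hdiff_cong: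
  assumes "\<And>ys. length ys = n \<Longrightarrow> set ys \<subseteq> S \<Longrightarrow> E ys = E' ys" "length xs = Suc n" "set xs \<subseteq> S"
  shows "hdiff E xs = hdiff E' xs"
  using assms
proof (induction xs arbitrary: E E' n)
  case (Cons x xs)
  have "hdiff (\<lambda>ys. E (x # ys)) xs = hdiff (\<lambda>ys. E' (x # ys)) xs"
  proof (cases n)
    case (Suc m)
    show ?thesis using Cons.prems Suc by (intro Cons.IH[of m]) auto
  qed (use Cons.prems in simp)
  then show ?case using Cons.prems by simp
qed simp

text \<open>A binary \<open>h\<close> lets one induction cover sums and differences of cochains as
  well as additive maps applied to a single one, where \<open>h\<close> ignores its second
  argument.\<close>

lemma hdiff_additive:
  assumes "cochain S n (carrier R) E" "cochain S n (carrier R) E'" "length xs = Suc n" "set xs \<subseteq> S"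
    and h: "\<And>x y. x \<in> carrier R \<Longrightarrow> y \<in> carrier R \<Longrightarrow> h x y \<in> carrier R"
      "\<And>x y x' y'. x \<in> carrier R \<Longrightarrow> y \<in> carrier R \<Longrightarrow> x' \<in> carrier R \<Longrightarrow> y' \<in> carrier R \<Longrightarrow>
        h (x \<ominus> x') (y \<ominus> y') = h x y \<ominus> h x' y'"
  shows "hdiff (\<lambda>ys. h (E ys) (E' ys)) xs = h (hdiff E xs) (hdiff E' xs)"
  using assms(1-4)
proof (induction xs arbitrary: E E' n)
  case (Cons x xs)
  have h0: "h \<zero> \<zero> = \<zero>"
    using h(2)[of \<zero> \<zero> \<zero> \<zero>] h(1)[of \<zero> \<zero>] by (simp add: a_minus_def r_neg)
  have c: "E xs \<in> carrier R" "E' xs \<in> carrier R"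
    using Cons.prems(3,4) cochainD[OF Cons.prems(1)] cochainD[OF Cons.prems(2)] by simp_all
  show ?case
  proof (cases n)
    case 0
    then show ?thesis using Cons.prems c h(1) h(2)[of "E []" "E' []" \<zero> \<zero>] h0 by simp
  next
    case (Suc m)
    have x: "x \<in> S" "length xs = Suc m" "set xs \<subseteq> S" using Cons.prems Suc by auto
    have cc: "cochain S m (carrier R) (\<lambda>ys. E (x # ys))" "cochain S m (carrier R) (\<lambda>ys. E' (x # ys))"
      using Cons.prems Suc x by (auto intro: cochain_Cons)
    show ?thesis
      using Cons.IH[OF cc x(2,3)] h(2)[OF c hdiff_closed[OF cc(1) x(2,3)] hdiff_closed[OF cc(2) x(2,3)]]
      by simp
  qed
qed simp

lemma hdiff_hom:
  assumes "cochain S n (carrier R) E" "length xs = Suc n" "set xs \<subseteq> S"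
    and "\<And>x. x \<in> carrier R \<Longrightarrow> h x \<in> carrier R"
      "\<And>x y. x \<in> carrier R \<Longrightarrow> y \<in> carrier R \<Longrightarrow> h (x \<ominus> y) = h x \<ominus> h y"
  shows "hdiff (\<lambda>ys. h (E ys)) xs = h (hdiff E xs)"
  using hdiff_additive[OF assms(1,1,2,3), of "\<lambda>x y. h x"] assms(4,5) by simp

lemma hdiff_add:
  assumes "cochain S n (carrier R) E" "cochain S n (carrier R) E'" "length xs = Suc n" "set xs \<subseteq> S"
  shows "hdiff (\<lambda>ys. E ys \<oplus> E' ys) xs = hdiff E xs \<oplus> hdiff E' xs"
  by (rule hdiff_additive[OF assms]) (simp, algebra)

lemma hdiff_diff:
  assumes "cochain S n (carrier R) E" "cochain S n (carrier R) E'" "length xs = Suc n" "set xs \<subseteq> S"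
  shows "hdiff (\<lambda>ys. E ys \<ominus> E' ys) xs = hdiff E xs \<ominus> hdiff E' xs"
  by (rule hdiff_additive[OF assms]) (simp, algebra)

lemma hdiff_zero: "hdiff (\<lambda>ys. \<zero>) xs = \<zero>"
  by (induction xs) (simp_all add: a_minus_def)

lemma hdiff_finsum:
  assumes "finite T" "\<And>t. t \<in> T \<Longrightarrow> cochain S n (carrier R) (E t)" "length xs = Suc n" "set xs \<subseteq> S"
  shows "hdiff (\<lambda>ys. \<Oplus>t\<in>T. E t ys) xs = (\<Oplus>t\<in>T. hdiff (E t) xs)"
  using assms(1,2)
proof (induction T rule: finite_induct)
  case empty
  then show ?case by (simp add: hdiff_zero)
next
  case (insert t T)
  have E: "E u ys \<in> carrier R" if "u \<in> insert t T" "length ys = n" "set ys \<subseteq> S" for u ys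
    using cochainD[OF insert.prems[OF that(1)] that(2,3)] .
  have "hdiff (\<lambda>ys. \<Oplus>u\<in>insert t T. E u ys) xs = hdiff (\<lambda>ys. E t ys \<oplus> (\<Oplus>u\<in>T. E u ys)) xs"
    using E insert.hyps assms(3,4) by (intro hdiff_cong[of n S]) (auto intro!: finsum_insert)
  also have "\<dots> = hdiff (E t) xs \<oplus> hdiff (\<lambda>ys. \<Oplus>u\<in>T. E u ys) xs"
  proof (rule hdiff_add[OF _ _ assms(3,4)])
    show "cochain S n (carrier R) (E t)" using insert.prems by simp
    show "cochain S n (carrier R) (\<lambda>ys. \<Oplus>u\<in>T. E u ys)"
      unfolding cochain_def using E by (auto intro!: finsum_closed)
  qed
  also have "\<dots> = (\<Oplus>u\<in>insert t T. hdiff (E u) xs)"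
    using insert hdiff_closed[OF _ assms(3,4)] by (subst finsum_insert) auto
  finally show ?case .
qed

lemma hdiff_map: "hdiff E (map \<rho> xs) = hdiff (\<lambda>ys. E (map \<rho> ys)) xs"
  by (induction xs arbitrary: E) simp_all

text \<open>Expanding both differentials at the head \<open>x\<close>, the two occurrences of
  \<open>hdiff E xs\<close> cancel, and what is left is the double differential of the cochain with
  first entry fixed to \<open>x\<close>.\<close>

lemma hdiff_hdiff:
  assumes "cochain S n (carrier R) E" "length xs = Suc (Suc n)" "set xs \<subseteq> S"
  shows "hdiff (hdiff E) xs = \<zero>"
  using assms
proof (induction xs arbitrary: E n)
  case (Cons x xs)
  have x: "x \<in> S" "length xs = Suc n" "set xs \<subseteq> S" using Cons.prems by auto
  have 1: "hdiff E xs \<in> carrier R" by (rule hdiff_closed[OF Cons.prems(1) x(2,3)])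
  show ?case
  proof (cases n)
    case 0
    then obtain y where xs: "xs = [y]" using x(2) by (cases xs) auto
    have "E [] \<in> carrier R" using cochainD[OF Cons.prems(1)] 0 by simp
    then show ?thesis using xs by (simp add: a_minus_def r_neg)
  next
    case (Suc m)
    have E': "cochain S m (carrier R) (\<lambda>ys. E (x # ys))" using Cons.prems(1) Suc x(1) by (auto intro: cochain_Cons)
    have "hdiff (\<lambda>ys. hdiff E (x # ys)) xs = hdiff E xs \<ominus> hdiff (hdiff (\<lambda>ys. E (x # ys))) xs"
      using hdiff_diff[OF Cons.prems(1) _ x(2,3), of "hdiff (\<lambda>ys. E (x # ys))"] hdiff_cochain[OF E'] Suc
      by simp
    also have "hdiff (hdiff (\<lambda>ys. E (x # ys))) xs = \<zero>" using Cons.IH[OF E'] x Suc by simp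
    finally show ?thesis using 1 by (simp add: a_minus_def r_neg)
  qed
qed simp

lemma prism_closed:
  assumes "cochain S (Suc n) (carrier R) E" "length xs = n" "set xs \<subseteq> S" "\<rho> ` S \<subseteq> S"
  shows "prism \<rho> E xs \<in> carrier R"
  using assms(1-3)
proof (induction xs arbitrary: E n)
  case (Cons x xs)
  then obtain m where m: "n = Suc m" by (cases n) auto
  have "set (x # map \<rho> (x # xs)) \<subseteq> S" using Cons.prems(3) assms(4) by auto
  then have "E (x # map \<rho> (x # xs)) \<in> carrier R"
    using Cons.prems by (intro cochainD[OF Cons.prems(1)]) auto
  then show ?case using Cons.IH[OF cochain_Cons[of S "Suc m" "carrier R" E x]] Cons.prems m by simp
qed simp

lemma prism_cochain:
  "cochain S (Suc n) (carrier R) E \<Longrightarrow> \<rho> ` S \<subseteq> S \<Longrightarrow> cochain S n (carrier R) (prism \<rho> E)"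
  using prism_closed unfolding cochain_def by blast

lemma prism_cong:
  assumes "\<And>ys. length ys = Suc n \<Longrightarrow> set ys \<subseteq> S \<Longrightarrow> E ys = E' ys"
    and "length xs = n" "set xs \<subseteq> S" "\<rho> ` S \<subseteq> S"
  shows "prism \<rho> E xs = prism \<rho> E' xs"
  using assms(1-3)
proof (induction xs arbitrary: E E' n)
  case (Cons x xs)
  then obtain m where m: "n = Suc m" by (cases n) auto
  have "set (x # map \<rho> (x # xs)) \<subseteq> S" using Cons.prems(3) assms(4) by auto
  then have "E (x # map \<rho> (x # xs)) = E' (x # map \<rho> (x # xs))" using Cons.prems by simp
  moreover have "prism \<rho> (\<lambda>ys. E (x # ys)) xs = prism \<rho> (\<lambda>ys. E' (x # ys)) xs"
    using Cons.prems m by (intro Cons.IH[of m]) auto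
  ultimately show ?case by simp
qed simp

lemma prism_zero: "prism \<rho> (\<lambda>ys. \<zero>) xs = \<zero>"
  by (induction xs) (simp_all add: a_minus_def)

lemma prism_diff:
  assumes "cochain S (Suc n) (carrier R) E" "cochain S (Suc n) (carrier R) E'"
    and "length xs = n" "set xs \<subseteq> S" "\<rho> ` S \<subseteq> S"
  shows "prism \<rho> (\<lambda>ys. E ys \<ominus> E' ys) xs = prism \<rho> E xs \<ominus> prism \<rho> E' xs"
  using assms(1-4)
proof (induction xs arbitrary: E E' n)
  case Nil
  then show ?case by (simp add: a_minus_def)
next
  case (Cons x xs)
  then obtain m where m: "n = Suc m" by (cases n) auto
  have x: "x \<in> S" "set xs \<subseteq> S" "length xs = m" using Cons.prems m by auto
  have "set (x # map \<rho> (x # xs)) \<subseteq> S" using x assms(5) by auto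
  then have c: "E (x # map \<rho> (x # xs)) \<in> carrier R" "E' (x # map \<rho> (x # xs)) \<in> carrier R"
    using x(3) m by (intro cochainD[OF Cons.prems(1)] cochainD[OF Cons.prems(2)]; simp)+
  have cc: "cochain S (Suc m) (carrier R) (\<lambda>ys. E (x # ys))" "cochain S (Suc m) (carrier R) (\<lambda>ys. E' (x # ys))"
    using Cons.prems m x by (auto intro: cochain_Cons)
  define a b where "a = E (x # map \<rho> (x # xs))" and "b = E' (x # map \<rho> (x # xs))"
  define u v where "u = prism \<rho> (\<lambda>ys. E (x # ys)) xs" and "v = prism \<rho> (\<lambda>ys. E' (x # ys)) xs"
  have "a \<in> carrier R" "b \<in> carrier R" "u \<in> carrier R" "v \<in> carrier R"
    using c prism_closed[OF cc(1) x(3,2) assms(5)] prism_closed[OF cc(2) x(3,2) assms(5)]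
    unfolding a_def b_def u_def v_def by auto
  then have "\<ominus> (a \<ominus> b) \<ominus> (u \<ominus> v) = (\<ominus> a \<ominus> u) \<ominus> (\<ominus> b \<ominus> v)" by algebra
  then show ?case using Cons.IH[OF cc x(3,2)] unfolding a_def b_def u_def v_def by simp
qed

lemma prism_hom:
  assumes "cochain S (Suc n) (carrier R) E" "length xs = n" "set xs \<subseteq> S" "\<rho> ` S \<subseteq> S"
    and h: "h \<zero> = \<zero>" "\<And>x. x \<in> carrier R \<Longrightarrow> h x \<in> carrier R" "\<And>x. x \<in> carrier R \<Longrightarrow> h (\<ominus> x) = \<ominus> h x"
      "\<And>x y. x \<in> carrier R \<Longrightarrow> y \<in> carrier R \<Longrightarrow> h (x \<ominus> y) = h x \<ominus> h y"
  shows "prism \<rho> (\<lambda>ys. h (E ys)) xs = h (prism \<rho> E xs)"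
  using assms(1-3)
proof (induction xs arbitrary: E n)
  case Nil
  then show ?case using h by simp
next
  case (Cons x xs)
  then obtain m where m: "n = Suc m" by (cases n) auto
  have x: "x \<in> S" "set xs \<subseteq> S" "length xs = m" using Cons.prems m by auto
  have "set (x # map \<rho> (x # xs)) \<subseteq> S" using x assms(4) by auto
  then have c: "E (x # map \<rho> (x # xs)) \<in> carrier R"
    using x(3) m by (intro cochainD[OF Cons.prems(1)]) simp_all
  have cc: "cochain S (Suc m) (carrier R) (\<lambda>ys. E (x # ys))"
    using Cons.prems m x by (auto intro: cochain_Cons)
  show ?case using Cons.IH[OF cc x(3,2)] c prism_closed[OF cc x(3,2) assms(4)] h(3,4) by simp
qed

lemma prism_map:
  assumes "\<And>x. x \<in> S \<Longrightarrow> \<rho> (\<tau> x) = \<tau> (\<rho> x)" "set xs \<subseteq> S"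
  shows "prism \<rho> (\<lambda>ys. E (map \<tau> ys)) xs = prism \<rho> E (map \<tau> xs)"
  using assms(2)
proof (induction xs arbitrary: E)
  case (Cons x xs)
  have "map (\<lambda>y. \<rho> (\<tau> y)) xs = map (\<lambda>y. \<tau> (\<rho> y)) xs" using Cons.prems assms(1) by auto
  then have m: "map \<rho> (map \<tau> xs) = map \<tau> (map \<rho> xs)" by simp
  have x: "\<rho> (\<tau> x) = \<tau> (\<rho> x)" "set xs \<subseteq> S" using Cons.prems assms(1) by auto
  show ?case using Cons.IH[OF x(2), of "\<lambda>ys. E (\<tau> x # ys)"] by (simp only: prism.simps list.map m x(1))
qed simp

text \<open>Induction along the list: the prism terms that keep the head \<open>x\<close> in front
  reproduce the identity for the cochain with first entry \<open>x\<close>, and the others cancel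
  except for the two end terms.\<close>

lemma prism_homotopy:
  assumes "cochain S n (carrier R) E" "length xs = n" "set xs \<subseteq> S" "\<rho> ` S \<subseteq> S"
  shows "hdiff (prism \<rho> E) xs \<oplus> prism \<rho> (hdiff E) xs = E xs \<ominus> E (map \<rho> xs)"
  using assms(1-3)
proof (induction xs arbitrary: E n)
  case Nil
  then have "E [] \<in> carrier R" using cochainD by fastforce
  then show ?case by (simp add: a_minus_def r_neg)
next
  case (Cons x xs)
  then obtain m where m: "n = Suc m" by (cases n) auto
  have x: "x \<in> S" "set xs \<subseteq> S" "length xs = m" "\<rho> x \<in> S" using Cons.prems m assms(4) by auto
  have mx: "set (map \<rho> xs) \<subseteq> S" "length (map \<rho> xs) = m" using x assms(4) by auto
  have sm: "set (map \<rho> ys) \<subseteq> S" if "set ys \<subseteq> S" for ys using that assms(4) by auto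
  let ?E = "\<lambda>ys. E (x # ys)" and ?EE = "\<lambda>ys. E (x # \<rho> x # map \<rho> ys)"
  have E: "cochain S (Suc m) (carrier R) E" using Cons.prems(1) m by simp
  have E': "cochain S m (carrier R) ?E" using E x by (auto intro: cochain_Cons)
  have cE: "E ys \<in> carrier R" if "length ys = Suc m" "set ys \<subseteq> S" for ys
    using cochainD[OF E that] .
  define k where "k = prism \<rho> E xs"
  define l where "l = prism \<rho> (hdiff ?E) xs"
  define q where "q = hdiff (prism \<rho> ?E) xs"
  define w where "w = hdiff ?EE xs"
  define a where "a = E (\<rho> x # map \<rho> xs)"
  define b where "b = E (x # map \<rho> xs)"
  define c where "c = E (x # xs)"
  have kc: "k \<in> carrier R" unfolding k_def using prism_closed[OF E x(3,2) assms(4)] .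
  have lc: "l \<in> carrier R" unfolding l_def using prism_closed[OF hdiff_cochain[OF E'] x(3,2) assms(4)] .
  have abc: "a \<in> carrier R" "b \<in> carrier R" "c \<in> carrier R"
    unfolding a_def b_def c_def using x mx by (intro cE; simp)+
  have qwc: "q \<in> carrier R \<and> w \<in> carrier R \<and>
      hdiff (\<lambda>ys. prism \<rho> E (x # ys)) xs = \<ominus> w \<ominus> q"
  proof (cases m)
    case 0
    then have "xs = []" using x by simp
    then show ?thesis unfolding q_def w_def by (simp add: a_minus_def)
  next
    case (Suc j)
    have K': "cochain S j (carrier R) (prism \<rho> ?E)" using E' Suc assms(4) by (auto intro: prism_cochain)
    have EE: "cochain S j (carrier R) ?EE"
      unfolding cochain_def using x sm Suc by (intro allI impI cE) simp_all
    have l: "length xs = Suc j" using x Suc by simp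
    have EE': "cochain S j (carrier R) (\<lambda>ys. \<ominus> ?EE ys)" using EE unfolding cochain_def by simp
    have "hdiff (\<lambda>ys. \<ominus> ?EE ys) xs = \<ominus> hdiff ?EE xs"
      by (rule hdiff_hom[OF EE l x(2)]) (simp, algebra)
    then show ?thesis
      unfolding q_def w_def using hdiff_closed[OF K' l x(2)] hdiff_closed[OF EE l x(2)]
        hdiff_diff[OF EE' K' l x(2)] by simp
  qed
  have 1: "hdiff (prism \<rho> E) (x # xs) = k \<ominus> (\<ominus> w \<ominus> q)" using qwc unfolding k_def by simp
  have "prism \<rho> (hdiff E) (x # xs) =
      \<ominus> hdiff E (x # \<rho> x # map \<rho> xs) \<ominus> prism \<rho> (\<lambda>ys. E ys \<ominus> hdiff ?E ys) xs" by simp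
  also have "prism \<rho> (\<lambda>ys. E ys \<ominus> hdiff ?E ys) xs = k \<ominus> l"
    unfolding k_def l_def by (rule prism_diff[OF E hdiff_cochain[OF E'] x(3,2) assms(4)])
  also have "hdiff E (x # \<rho> x # map \<rho> xs) = a \<ominus> (b \<ominus> w)"
    unfolding a_def b_def w_def by (simp add: hdiff_map)
  finally have 2: "prism \<rho> (hdiff E) (x # xs) = \<ominus> (a \<ominus> (b \<ominus> w)) \<ominus> (k \<ominus> l)" .
  \<comment> \<open>This is the induction hypothesis. In the total, \<open>k\<close>,
    \<open>w\<close> and \<open>b\<close> occur with both signs, and \<open>c - a\<close>
    remains.\<close>
  have 3: "q \<oplus> l = c \<ominus> b" unfolding q_def l_def c_def b_def using Cons.IH[OF E' x(3,2)] by simp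
  have "(k \<ominus> (\<ominus> w \<ominus> q)) \<oplus> (\<ominus> (a \<ominus> (b \<ominus> w)) \<ominus> (k \<ominus> l)) = (q \<oplus> l) \<oplus> (b \<ominus> a)"
    using kc lc abc qwc by algebra
  also have "\<dots> = c \<ominus> a" unfolding 3 using abc by algebra
  finally show ?case unfolding 1 2 c_def a_def by simp
qed

end

section \<open>Inhomogeneous cochains and corestriction\<close>

context finite_ring_action
begin

text \<open>All terms of \<open>coboundary\<close> except the first one, by recursion on the list.\<close>

fun faces :: "('g list \<Rightarrow> 'a) \<Rightarrow> 'g list \<Rightarrow> 'a" where
  "faces f [] = \<zero>"
| "faces f [g] = \<ominus> f []"
| "faces f (g # h # gs) = \<ominus> f ((g \<otimes>\<^bsub>G\<^esub> h) # gs) \<ominus> faces (\<lambda>ys. f (g # ys)) (h # gs)"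

text \<open>A version of \<open>coboundary\<close> that is independent of the degree and not extensional; on lists of length
  \<open>n + 1\<close> it depends on the values of \<open>f\<close> on lists of length \<open>n\<close> only.\<close>

definition cob :: "('g list \<Rightarrow> 'a) \<Rightarrow> 'g list \<Rightarrow> 'a" where
  "cob f gs = (case gs of [] \<Rightarrow> \<zero> | g # hs \<Rightarrow> \<phi> g (f hs) \<oplus> faces f gs)"

lemma cob_Cons [simp]: "cob f (g # hs) = \<phi> g (f hs) \<oplus> faces f (g # hs)"
  unfolding cob_def by simp

lemma faces_closed:
  assumes "subgroup S G" "cochain S n (carrier R) f" "length gs = Suc n" "set gs \<subseteq> S"
  shows "faces f gs \<in> carrier R"
  using assms(2-)
proof (induction f gs arbitrary: n rule: faces.induct)
  case (2 f g)
  then show ?case using cochainD[OF 2(1), of "[]"] by simp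
next
  case (3 f g h gs)
  then obtain m where m: "n = Suc m" by (cases n) auto
  have "g \<otimes>\<^bsub>G\<^esub> h \<in> S" using 3 subgroup.m_closed[OF assms(1)] by simp
  then have "f ((g \<otimes>\<^bsub>G\<^esub> h) # gs) \<in> carrier R" using 3 by (intro cochainD[OF 3(2)]) auto
  moreover have "faces (\<lambda>ys. f (g # ys)) (h # gs) \<in> carrier R"
    using 3 m by (intro 3(1)[of m]) (auto intro: cochain_Cons)
  ultimately show ?case by simp
qed simp

lemma alternating_add_pow:
  assumes "x \<in> carrier R"
  shows "add_pow R ((- 1 :: int) ^ Suc k) x = \<ominus> add_pow R ((- 1 :: int) ^ k) x"
  using add.int_pow_neg[OF assms, of "(- 1) ^ k"] by simp

text \<open>Splitting off the summand \<open>i = 0\<close> leaves the alternating sum of the cochain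
  with first entry \<open>g\<close>, with all signs reversed; this is the recursion of
  \<open>faces\<close>.\<close>

lemma faces_eq_finsum:
  assumes "subgroup S G" "cochain S n (carrier R) f" "length gs = Suc n" "set gs \<subseteq> S"
  shows "(\<Oplus>i\<in>{..<n}. add_pow R ((- 1 :: int) ^ Suc i)
      (f (take i gs @ (gs ! i \<otimes>\<^bsub>G\<^esub> gs ! Suc i) # drop (i + 2) gs)))
    \<oplus> add_pow R ((- 1 :: int) ^ Suc n) (f (butlast gs)) = faces f gs"
  using assms(2-)
proof (induction f gs arbitrary: n rule: faces.induct)
  case (2 f g)
  then have "f [] \<in> carrier R" using cochainD[OF 2(1), of "[]"] by simp
  then show ?case using 2 alternating_add_pow[of "f []" 0] by simp
next
  case (3 f g h gs)
  then obtain m where m: "n = Suc m" by (cases n) auto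
  let ?f = "\<lambda>ys. f (g # ys)" and ?l = "h # gs"
  let ?face = "\<lambda>l i. take i l @ (l ! i \<otimes>\<^bsub>G\<^esub> l ! Suc i) # drop (i + 2) l"
  have S: "g \<in> S" "h \<in> S" "set gs \<subseteq> S" "length gs = m" using 3 m by auto
  have f': "cochain S m (carrier R) ?f" using 3(2) m S(1) by (auto intro: cochain_Cons)
  have face: "?f (?face ?l i) \<in> carrier R" if "i < m" for i
  proof (rule cochainD[OF f'])
    show "length (?face ?l i) = m" using that S(4) by simp
    have "?l ! i \<in> S" "?l ! Suc i \<in> S" using that S nth_mem[of i ?l] nth_mem[of "Suc i" ?l] by (auto simp: subset_iff)
    then have "?l ! i \<otimes>\<^bsub>G\<^esub> ?l ! Suc i \<in> S" using subgroup.m_closed[OF assms(1)] by simp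
    moreover have "set (take i ?l) \<subseteq> S" "set (drop (i + 2) ?l) \<subseteq> S"
      using S set_take_subset[of i ?l] set_drop_subset[of "i + 2" ?l] by auto
    ultimately show "set (?face ?l i) \<subseteq> S" by (simp del: drop_Suc_Cons take_Suc_Cons)
  qed
  have gh: "f ((g \<otimes>\<^bsub>G\<^esub> h) # gs) \<in> carrier R"
    using 3 S subgroup.m_closed[OF assms(1)] m by (intro cochainD[OF 3(2)]) auto
  have last: "?f (butlast ?l) \<in> carrier R"
    using S by (intro cochainD[OF f']) (auto dest: in_set_butlastD)
  define F where "F i = add_pow R ((- 1 :: int) ^ Suc i) (?f (?face ?l i))" for i
  have Fc: "F i \<in> carrier R" if "i < m" for i unfolding F_def using face[OF that] by simp
  have "(\<Oplus>i\<in>{..<n}. add_pow R ((- 1 :: int) ^ Suc i) (f (?face (g # ?l) i))) =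
      add_pow R ((- 1 :: int) ^ Suc 0) (f (?face (g # ?l) 0)) \<oplus>
      (\<Oplus>i\<in>{..<m}. add_pow R ((- 1 :: int) ^ Suc (Suc i)) (f (?face (g # ?l) (Suc i))))"
    unfolding m
  proof (rule finsum_lessThan_Suc)
    fix i assume "i \<le> m"
    then show "add_pow R ((- 1 :: int) ^ Suc i) (f (?face (g # ?l) i)) \<in> carrier R"
      using gh face[of "i - 1"] by (cases i) auto
  qed
  also have "add_pow R ((- 1 :: int) ^ Suc 0) (f (?face (g # ?l) 0)) = \<ominus> f ((g \<otimes>\<^bsub>G\<^esub> h) # gs)"
    using alternating_add_pow[OF gh, of 0] gh by simp
  also have "(\<Oplus>i\<in>{..<m}. add_pow R ((- 1 :: int) ^ Suc (Suc i)) (f (?face (g # ?l) (Suc i)))) =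
      (\<Oplus>i\<in>{..<m}. \<ominus> F i)"
  proof (intro finsum_cong')
    fix i assume "i \<in> {..<m}"
    then show "add_pow R ((- 1 :: int) ^ Suc (Suc i)) (f (?face (g # ?l) (Suc i))) = \<ominus> F i"
      unfolding F_def using alternating_add_pow[OF face, of i "Suc i"] by simp
  qed (use Fc in auto)
  also have "\<dots> = \<ominus> (\<Oplus>i\<in>{..<m}. F i)" using Fc by (intro finsum_minus) simp
  finally have 1: "(\<Oplus>i\<in>{..<n}. add_pow R ((- 1 :: int) ^ Suc i) (f (?face (g # ?l) i))) =
    \<ominus> f ((g \<otimes>\<^bsub>G\<^esub> h) # gs) \<oplus> \<ominus> (\<Oplus>i\<in>{..<m}. F i)" .
  have 2: "add_pow R ((- 1 :: int) ^ Suc n) (f (butlast (g # ?l))) =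
      \<ominus> add_pow R ((- 1 :: int) ^ Suc m) (?f (butlast ?l))"
    unfolding m using alternating_add_pow[OF last, of "Suc m"] by simp
  have IH: "(\<Oplus>i\<in>{..<m}. F i) \<oplus> add_pow R ((- 1 :: int) ^ Suc m) (?f (butlast ?l)) = faces ?f ?l"
    unfolding F_def using S by (intro 3(1)[OF f']) auto
  have Fs: "(\<Oplus>i\<in>{..<m}. F i) \<in> carrier R" using Fc by (intro finsum_closed) simp
  have lc: "add_pow R ((- 1 :: int) ^ Suc m) (?f (butlast ?l)) \<in> carrier R" using last by simp
  show ?case
    unfolding 1 2 faces.simps(3) IH[symmetric] using gh Fs lc by (simp add: minus_add a_minus_def a_assoc)
qed simp

lemma coboundary_eq_cob:
  assumes S: "subgroup S G" and f: "cochain S n (carrier R) f" and gs: "length gs = Suc n" "set gs \<subseteq> S"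
  shows "coboundary (G\<lparr>carrier := S\<rparr>) R \<phi> n f gs = cob f gs"
proof -
  obtain g hs where g: "gs = g # hs" using gs(1) by (cases gs) auto
  have gG: "g \<in> carrier G" using g gs(2) subgroup.subset[OF S] by auto
  have fc: "faces f gs \<in> carrier R" by (rule faces_closed[OF S f gs])
  have hc: "f hs \<in> carrier R" using g gs by (intro cochainD[OF f]) auto
  have face: "f (take i gs @ (gs ! i \<otimes>\<^bsub>G\<^esub> gs ! Suc i) # drop (i + 2) gs) \<in> carrier R" if "i < n" for i
  proof (rule cochainD[OF f])
    show "length (take i gs @ (gs ! i \<otimes>\<^bsub>G\<^esub> gs ! Suc i) # drop (i + 2) gs) = n" using that gs by simp
    have "gs ! i \<in> S" "gs ! Suc i \<in> S" using that gs nth_mem[of i gs] nth_mem[of "Suc i" gs] by auto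
    then have "gs ! i \<otimes>\<^bsub>G\<^esub> gs ! Suc i \<in> S" using subgroup.m_closed[OF S] by simp
    then show "set (take i gs @ (gs ! i \<otimes>\<^bsub>G\<^esub> gs ! Suc i) # drop (i + 2) gs) \<subseteq> S"
      using gs set_take_subset[of i gs] set_drop_subset[of "i + 2" gs] by auto
  qed
  have last: "f (butlast gs) \<in> carrier R"
    using gs by (intro cochainD[OF f]) (auto dest: in_set_butlastD)
  have "coboundary (G\<lparr>carrier := S\<rparr>) R \<phi> n f gs = \<phi> (hd gs) (f (tl gs)) \<oplus>
      (\<Oplus>i\<in>{..<n}. add_pow R ((- 1 :: int) ^ Suc i)
        (f (take i gs @ (gs ! i \<otimes>\<^bsub>G\<^esub> gs ! Suc i) # drop (i + 2) gs)))
      \<oplus> add_pow R ((- 1 :: int) ^ Suc n) (f (butlast gs))"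
    unfolding coboundary_def tuples_def using gs by simp
  also have "\<dots> = \<phi> (hd gs) (f (tl gs)) \<oplus> faces f gs"
    unfolding faces_eq_finsum[OF S f gs, symmetric] using gG g hc face last
    by (subst a_assoc) (auto intro!: finsum_closed)
  also have "\<dots> = cob f gs" using g by simp
  finally show ?thesis .
qed

section \<open>Passage between homogeneous and inhomogeneous cochains\<close>

fun quotients :: "'g \<Rightarrow> 'g list \<Rightarrow> 'g list" where
  "quotients x [] = []"
| "quotients x (y # ys) = (inv\<^bsub>G\<^esub> x \<otimes>\<^bsub>G\<^esub> y) # quotients y ys"

fun products :: "'g \<Rightarrow> 'g list \<Rightarrow> 'g list" where
  "products x [] = []"
| "products x (g # gs) = (x \<otimes>\<^bsub>G\<^esub> g) # products (x \<otimes>\<^bsub>G\<^esub> g) gs"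

text \<open>The standard homogeneous form \<open>x0 f(x0^-1 x1, x1^-1 x2, ...)\<close>. A cochain of
  degree \<open>n\<close> becomes a function of lists of length \<open>n + 1\<close>; the value at
  \<open>[]\<close> is a dummy.\<close>

fun homog :: "('g list \<Rightarrow> 'a) \<Rightarrow> 'g list \<Rightarrow> 'a" where
  "homog f [] = \<zero>"
| "homog f (x # xs) = \<phi> x (f (quotients x xs))"

lemma length_quotients [simp]: "length (quotients x xs) = length xs"
  by (induction x xs rule: quotients.induct) simp_all

lemma length_products [simp]: "length (products x xs) = length xs"
  by (induction x xs rule: products.induct) simp_all

lemma quotients_closed:
  assumes "subgroup S G" "x \<in> S" "set xs \<subseteq> S"
  shows "set (quotients x xs) \<subseteq> S"
  using assms(2,3) subgroup.m_closed[OF assms(1)] subgroup.m_inv_closed[OF assms(1)]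
  by (induction x xs rule: quotients.induct) simp_all

lemma products_closed: "x \<in> carrier G \<Longrightarrow> set xs \<subseteq> carrier G \<Longrightarrow> set (products x xs) \<subseteq> carrier G"
  by (induction x xs rule: products.induct) simp_all

lemma quotients_products:
  "x \<in> carrier G \<Longrightarrow> set gs \<subseteq> carrier G \<Longrightarrow> quotients x (products x gs) = gs"
  by (induction x gs rule: products.induct) simp_all

lemma products_quotients:
  "x \<in> carrier G \<Longrightarrow> set ys \<subseteq> carrier G \<Longrightarrow> products x (quotients x ys) = ys"
  by (induction x ys rule: quotients.induct) simp_all

lemma map_products:
  "a \<in> carrier G \<Longrightarrow> x \<in> carrier G \<Longrightarrow> set gs \<subseteq> carrier G \<Longrightarrow>
    map (\<lambda>y. a \<otimes>\<^bsub>G\<^esub> y) (products x gs) = products (a \<otimes>\<^bsub>G\<^esub> x) gs"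
  by (induction x gs rule: products.induct) (simp_all add: G.m_assoc)

lemma quotients_map:
  "a \<in> carrier G \<Longrightarrow> x \<in> carrier G \<Longrightarrow> set ys \<subseteq> carrier G \<Longrightarrow>
    quotients (a \<otimes>\<^bsub>G\<^esub> x) (map (\<lambda>y. a \<otimes>\<^bsub>G\<^esub> y) ys) = quotients x ys"
  by (induction x ys rule: quotients.induct) (simp_all add: G.inv_mult_group G.m_assoc)

lemma homog_cochain:
  assumes "subgroup S G" "cochain S n (carrier R) f"
  shows "cochain S (Suc n) (carrier R) (homog f)"
  unfolding cochain_def
proof (intro allI impI)
  fix gs assume gs: "length gs = Suc n" "set gs \<subseteq> S"
  then obtain x xs where x: "gs = x # xs" by (cases gs) auto
  then have "f (quotients x xs) \<in> carrier R"
    using gs quotients_closed[OF assms(1)] by (intro cochainD[OF assms(2)]) auto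
  then show "homog f gs \<in> carrier R" using x gs subgroup.subset[OF assms(1)] by auto
qed

lemma homog_equivariant:
  assumes f: "cochain (carrier G) n (carrier R) f" and a: "a \<in> carrier G"
    and xs: "length xs = Suc n" "set xs \<subseteq> carrier G"
  shows "homog f (map (\<lambda>y. a \<otimes>\<^bsub>G\<^esub> y) xs) = \<phi> a (homog f xs)"
proof -
  obtain y ys where y: "xs = y # ys" using xs(1) by (cases xs) auto
  have "f (quotients y ys) \<in> carrier R"
    using y xs quotients_closed[OF G.subgroup_self] by (intro cochainD[OF f]) auto
  then show ?thesis using y xs a by (simp add: quotients_map act_comp)
qed

lemma faces_hom:
  assumes "subgroup S G" "cochain S n (carrier R) f" "length gs = Suc n" "set gs \<subseteq> S" "x \<in> carrier G"
  shows "faces (\<lambda>gs. \<phi> x (f gs)) gs = \<phi> x (faces f gs)"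
  using assms(2-4)
proof (induction f gs arbitrary: n rule: faces.induct)
  case (2 f g)
  then show ?case using cochainD[OF 2(1), of "[]"] assms(5) by simp
next
  case (3 f g h gs)
  then obtain m where m: "n = Suc m" by (cases n) auto
  have S: "g \<in> S" "set (h # gs) \<subseteq> S" "length (h # gs) = Suc m" using 3 m by auto
  have f': "cochain S m (carrier R) (\<lambda>ys. f (g # ys))" using 3(2) m S(1) by (auto intro: cochain_Cons)
  have gh: "f ((g \<otimes>\<^bsub>G\<^esub> h) # gs) \<in> carrier R"
    using 3 S subgroup.m_closed[OF assms(1)] m by (intro cochainD[OF 3(2)]) auto
  show ?case using 3(1)[OF f' S(3,2)] faces_closed[OF assms(1) f' S(3,2)] gh assms(5) by simp
qed (use assms(5) in simp)

text \<open>Deleting \<open>y\<close> between its neighbours \<open>x\<close> and \<open>z\<close>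
  merges the quotients \<open>x^-1 y\<close> and \<open>y^-1 z\<close> into their product, and
  deleting the last entry drops the last quotient. The overall sign arises because the deletions are
  counted from the entry after \<open>x\<close>.\<close>

lemma hdiff_quotients:
  assumes S: "subgroup S G" and f: "cochain S n (carrier R) f" and x: "x \<in> S"
    and xs: "length xs = Suc n" "set xs \<subseteq> S"
  shows "hdiff (\<lambda>ys. f (quotients x ys)) xs = \<ominus> faces f (quotients x xs)"
  using f x xs
proof (induction xs arbitrary: f n x)
  case (Cons y ys)
  show ?case
  proof (cases ys)
    case Nil
    then have "f [] \<in> carrier R" using Cons.prems cochainD[OF Cons.prems(1), of "[]"] by simp
    then show ?thesis using Nil by (simp add: a_minus_def)
  next
    case (Cons z zs)
    then obtain m where m: "n = Suc m" using Cons.prems by auto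
    have S': "y \<in> S" "z \<in> S" "set zs \<subseteq> S" "set ys \<subseteq> S" "length ys = Suc m"
      using Cons.prems(3,4) m Cons by auto
    have c: "x \<in> carrier G" "y \<in> carrier G" "z \<in> carrier G"
      using subgroup.subset[OF S] S' Cons.prems(2) by auto
    let ?g = "inv\<^bsub>G\<^esub> x \<otimes>\<^bsub>G\<^esub> y"
    have g: "?g \<in> S" using S' Cons.prems(2) subgroup.m_closed[OF S] subgroup.m_inv_closed[OF S] by simp
    have f': "cochain S m (carrier R) (\<lambda>ys. f (?g # ys))"
      using Cons.prems(1) m g by (auto intro: cochain_Cons)
    have IH: "hdiff (\<lambda>ws. f (?g # quotients y ws)) ys = \<ominus> faces (\<lambda>ys. f (?g # ys)) (quotients y ys)"
      by (rule Cons.IH[OF f' S'(1,5,4)])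
    have qS: "set (quotients y ys) \<subseteq> S" using quotients_closed[OF S S'(1,4)] .
    have fc: "faces (\<lambda>ys. f (?g # ys)) (quotients y ys) \<in> carrier R"
      using faces_closed[OF S f'] qS S'(5) by simp
    have xz: "?g \<otimes>\<^bsub>G\<^esub> (inv\<^bsub>G\<^esub> y \<otimes>\<^bsub>G\<^esub> z) = inv\<^bsub>G\<^esub> x \<otimes>\<^bsub>G\<^esub> z" using c by (simp add: G.m_assoc)
    have "set (quotients x ys) \<subseteq> S" using quotients_closed[OF S Cons.prems(2) S'(4)] .
    then have fx: "f (quotients x ys) \<in> carrier R" using S'(5) m by (intro cochainD[OF Cons.prems(1)]) auto
    have "hdiff (\<lambda>ys. f (quotients x ys)) (y # ys) = f (quotients x ys) \<oplus> faces (\<lambda>ys. f (?g # ys)) (quotients y ys)"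
      using IH fc by (simp add: a_minus_def)
    also have "\<dots> = \<ominus> faces f (quotients x (y # ys))"
      using fx fc Cons xz by (simp add: a_minus_def minus_add)
    finally show ?thesis .
  qed
qed simp

text \<open>Deleting the head \<open>x\<close> moves the base point to
  \<open>y = x (x^-1 y)\<close>, which yields the first term of \<open>cob\<close>; all other
  deletions are covered by \<open>hdiff_quotients\<close>.\<close>

lemma hdiff_homog:
  assumes S: "subgroup S G" and f: "cochain S n (carrier R) f" and x: "x \<in> S"
    and xs: "length xs = Suc n" "set xs \<subseteq> S"
  shows "hdiff (homog f) (x # xs) = \<phi> x (cob f (quotients x xs))"
proof -
  obtain y ys where y: "xs = y # ys" using xs(1) by (cases xs) auto
  have yS: "y \<in> S" "set ys \<subseteq> S" "length ys = n" using y xs by auto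
  have c: "x \<in> carrier G" "y \<in> carrier G" using subgroup.subset[OF S] x yS by auto
  have fy: "f (quotients y ys) \<in> carrier R"
    using yS quotients_closed[OF S yS(1,2)] by (intro cochainD[OF f]) auto
  have \<phi>f: "cochain S n (carrier R) (\<lambda>gs. \<phi> x (f gs))" using f c unfolding cochain_def by simp
  have q: "length (quotients x xs) = Suc n" "set (quotients x xs) \<subseteq> S"
    using xs quotients_closed[OF S x xs(2)] by simp_all
  have fc: "faces f (quotients x xs) \<in> carrier R" by (rule faces_closed[OF S f q])
  have "hdiff (homog f) (x # xs) = homog f xs \<ominus> hdiff (\<lambda>ys. \<phi> x (f (quotients x ys))) xs" by simp
  also have "hdiff (\<lambda>ys. \<phi> x (f (quotients x ys))) xs = \<ominus> faces (\<lambda>gs. \<phi> x (f gs)) (quotients x xs)"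
    by (rule hdiff_quotients[OF S \<phi>f x xs])
  also have "faces (\<lambda>gs. \<phi> x (f gs)) (quotients x xs) = \<phi> x (faces f (quotients x xs))"
    by (rule faces_hom[OF S f q c(1)])
  also have "homog f xs = \<phi> x (\<phi> (inv\<^bsub>G\<^esub> x \<otimes>\<^bsub>G\<^esub> y) (f (quotients y ys)))"
    using y c fy by (simp add: act_comp)
  finally show ?thesis using y c fy fc by (simp add: a_minus_def)
qed

lemma cob_closed:
  assumes "subgroup S G" "cochain S n (carrier R) f"
  shows "cochain S (Suc n) (carrier R) (cob f)"
  unfolding cochain_def
proof (intro allI impI)
  fix gs assume gs: "length gs = Suc n" "set gs \<subseteq> S"
  then obtain g hs where g: "gs = g # hs" by (cases gs) auto
  have "f hs \<in> carrier R" using gs g by (intro cochainD[OF assms(2)]) auto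
  then show "cob f gs \<in> carrier R"
    using faces_closed[OF assms gs] subgroup.subset[OF assms(1)] g gs by auto
qed

text \<open>Evaluated at the list \<open>1, g1, g1 g2, ...\<close>, whose successive quotients are
  \<open>gs\<close>, the claim becomes \<open>hdiff_hdiff\<close>, where no group multiplication
  interferes.\<close>

lemma cob_cob:
  assumes f: "cochain (carrier G) n (carrier R) f" and gs: "length gs = Suc (Suc n)" "set gs \<subseteq> carrier G"
  shows "cob (cob f) gs = \<zero>"
proof -
  note S = G.subgroup_self
  define xs where "xs = products \<one>\<^bsub>G\<^esub> gs"
  have xs: "length xs = Suc (Suc n)" "set xs \<subseteq> carrier G" "quotients \<one>\<^bsub>G\<^esub> xs = gs"
    unfolding xs_def using gs products_closed quotients_products by simp_all
  have cf: "cochain (carrier G) (Suc n) (carrier R) (cob f)" by (rule cob_closed[OF S f])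
  have "cob (cob f) gs \<in> carrier R" using cob_closed[OF S cf] gs by (intro cochainD)
  then have "cob (cob f) gs = \<phi> \<one>\<^bsub>G\<^esub> (cob (cob f) (quotients \<one>\<^bsub>G\<^esub> xs))" using xs(3) by simp
  also have "\<dots> = hdiff (homog (cob f)) (\<one>\<^bsub>G\<^esub> # xs)"
    using hdiff_homog[OF S cf _ xs(1,2)] by simp
  also have "\<dots> = hdiff (hdiff (homog f)) (\<one>\<^bsub>G\<^esub> # xs)"
  proof (rule hdiff_cong[of "Suc (Suc n)" "carrier G"])
    fix ys assume ys: "length ys = Suc (Suc n)" "set ys \<subseteq> carrier G"
    then obtain y zs where "ys = y # zs" by (cases ys) auto
    then show "homog (cob f) ys = hdiff (homog f) ys" using hdiff_homog[OF S f, of y zs] ys by simp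
  qed (use xs in auto)
  also have "\<dots> = \<zero>"
    using hdiff_hdiff[OF homog_cochain[OF S f], of "\<one>\<^bsub>G\<^esub> # xs"] xs by simp
  finally show ?thesis .
qed

text \<open>For a transversal \<open>T\<close> of \<open>G/H\<close> this is the corestriction of \<open>r\<close> times the restriction of \<open>f\<close>,
  on the level of homogeneous cochains on \<open>G\<close>, of which only \<open>H\<close>-equivariance is required.\<close>

theorem trace_annihilates:
  assumes H: "subgroup H G" and T: "G.transversal H T"
    and r: "r \<in> carrier R" "\<And>h. h \<in> H \<Longrightarrow> \<phi> h r = r"
    and f: "cochain (carrier G) (Suc m) (carrier R) f"
    and cocycle: "\<And>gs. length gs = Suc (Suc m) \<Longrightarrow> set gs \<subseteq> carrier G \<Longrightarrow> cob f gs = \<zero>"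
    and k: "cochain H m (carrier R) k"
    and res: "\<And>gs. length gs = Suc m \<Longrightarrow> set gs \<subseteq> H \<Longrightarrow> f gs = cob k gs"
  shows "\<exists>e. cochain (carrier G) m (carrier R) e \<and>
    (\<forall>gs. length gs = Suc m \<longrightarrow> set gs \<subseteq> carrier G \<longrightarrow> cob e gs = (\<Oplus>t\<in>T. \<phi> t r) \<otimes> f gs)"
proof -
  interpret H: subgroup H G by fact
  note S = G.subgroup_self
  have HG: "H \<subseteq> carrier G" by (rule H.subset)
  have TG: "T \<subseteq> carrier G" using T unfolding G.transversal_def by blast
  have finT: "finite T" using TG finite_G finite_subset by blast
  \<comment> \<open>\<open>\<tau> g\<close> represents the left coset of \<open>inv g\<close>,
    because \<open>T\<close> lists left cosets \<open>t H\<close> while \<open>H\<close> has to act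
    on the arguments from the left.\<close>
  have "\<forall>g \<in> carrier G. \<exists>t. t \<in> T \<and> inv\<^bsub>G\<^esub> t \<otimes>\<^bsub>G\<^esub> inv\<^bsub>G\<^esub> g \<in> H"
    using T G.inv_closed unfolding G.transversal_def by (meson G.inv_closed)
  then obtain \<tau> where \<tau>: "\<And>g. g \<in> carrier G \<Longrightarrow> \<tau> g \<in> T"
    "\<And>g. g \<in> carrier G \<Longrightarrow> inv\<^bsub>G\<^esub> (\<tau> g) \<otimes>\<^bsub>G\<^esub> inv\<^bsub>G\<^esub> g \<in> H" by metis
  have \<tau>_eqI: "\<tau> g = t" if "g \<in> carrier G" "t \<in> T" "inv\<^bsub>G\<^esub> t \<otimes>\<^bsub>G\<^esub> inv\<^bsub>G\<^esub> g \<in> H" for g t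
    using T \<tau>[OF that(1)] that G.inv_closed[OF that(1)] unfolding G.transversal_def by blast
  \<comment> \<open>A left \<open>H\<close>-equivariant map from \<open>G\<close> to
    \<open>H\<close>. It extends cochains on \<open>H\<close> to \<open>G\<close>, and its prism
    operator compares \<open>?F\<close> with the pullback of its restriction.\<close>
  define \<rho> where "\<rho> g = g \<otimes>\<^bsub>G\<^esub> \<tau> g" for g
  have \<tau>G: "\<tau> g \<in> carrier G" if "g \<in> carrier G" for g using \<tau>(1)[OF that] TG by blast
  have \<rho>H: "\<rho> g \<in> H" if g: "g \<in> carrier G" for g
  proof -
    have "inv\<^bsub>G\<^esub> (inv\<^bsub>G\<^esub> (\<tau> g) \<otimes>\<^bsub>G\<^esub> inv\<^bsub>G\<^esub> g) \<in> H" using \<tau>(2)[OF g] by simp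
    then show ?thesis unfolding \<rho>_def using g \<tau>G[OF g] by (simp add: G.inv_mult_group)
  qed
  have \<rho>G: "\<rho> ` carrier G \<subseteq> carrier G" using \<rho>H HG by blast
  have \<rho>_equiv: "\<rho> (h \<otimes>\<^bsub>G\<^esub> g) = h \<otimes>\<^bsub>G\<^esub> \<rho> g" if h: "h \<in> H" and g: "g \<in> carrier G" for h g
  proof -
    have hG: "h \<in> carrier G" using h HG by blast
    have "\<tau> (h \<otimes>\<^bsub>G\<^esub> g) = \<tau> g"
    proof (rule \<tau>_eqI)
      have "inv\<^bsub>G\<^esub> (\<tau> g) \<otimes>\<^bsub>G\<^esub> inv\<^bsub>G\<^esub> (h \<otimes>\<^bsub>G\<^esub> g) = (inv\<^bsub>G\<^esub> (\<tau> g) \<otimes>\<^bsub>G\<^esub> inv\<^bsub>G\<^esub> g) \<otimes>\<^bsub>G\<^esub> inv\<^bsub>G\<^esub> h"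
        using hG g \<tau>G[OF g] by (simp add: G.inv_mult_group G.m_assoc)
      then show "inv\<^bsub>G\<^esub> (\<tau> g) \<otimes>\<^bsub>G\<^esub> inv\<^bsub>G\<^esub> (h \<otimes>\<^bsub>G\<^esub> g) \<in> H" using \<tau>(2)[OF g] h by simp
    qed (use hG g \<tau> in auto)
    then show ?thesis unfolding \<rho>_def using hG g \<tau>G[OF g] by (simp add: G.m_assoc)
  qed
  let ?F = "homog f"
  let ?k = "\<lambda>ys. homog k (map \<rho> ys)"
  have F: "cochain (carrier G) (Suc (Suc m)) (carrier R) ?F" by (rule homog_cochain[OF S f])
  have k': "cochain (carrier G) (Suc m) (carrier R) ?k"
    unfolding cochain_def
  proof (intro allI impI)
    fix ys assume "length ys = Suc m" "set ys \<subseteq> carrier G"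
    then show "?k ys \<in> carrier R"
      using \<rho>H by (intro cochainD[OF homog_cochain[OF H k]]) auto
  qed
  have PF: "cochain (carrier G) (Suc m) (carrier R) (prism \<rho> ?F)" by (rule prism_cochain[OF F \<rho>G])
  \<comment> \<open>Chosen so that \<open>hdiff E\<close> is \<open>?F\<close>: the prism term gives
    \<open>?F\<close> minus its pullback along \<open>\<rho>\<close>, and the pullback is the
    differential of \<open>?k\<close>, because \<open>\<rho>\<close> takes values in
    \<open>H\<close>, where \<open>f\<close> is \<open>cob k\<close>.\<close>
  define E where "E ys = prism \<rho> ?F ys \<oplus> ?k ys" for ys
  have Ec: "cochain (carrier G) (Suc m) (carrier R) E"
    using PF k' unfolding E_def cochain_def by simp
  have dF: "hdiff ?F ys = \<zero>" if ys: "length ys = Suc (Suc (Suc m))" "set ys \<subseteq> carrier G" for ys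
  proof -
    obtain y zs where y: "ys = y # zs" using ys(1) by (cases ys) auto
    have "hdiff ?F (y # zs) = \<phi> y (cob f (quotients y zs))" using ys y by (intro hdiff_homog[OF S f]) auto
    also have "cob f (quotients y zs) = \<zero>"
      using ys y quotients_closed[OF S, of y zs] by (intro cocycle) auto
    finally show ?thesis using y ys by simp
  qed
  have dE: "hdiff E xs = ?F xs" if xs: "length xs = Suc (Suc m)" "set xs \<subseteq> carrier G" for xs
  proof -
    have "prism \<rho> (hdiff ?F) xs = prism \<rho> (\<lambda>ys. \<zero>) xs"
      using dF xs \<rho>G by (intro prism_cong[of "Suc (Suc m)" "carrier G"]) auto
    then have K0: "prism \<rho> (hdiff ?F) xs = \<zero>" by (simp add: prism_zero)
    have Fx: "?F xs \<in> carrier R" "hdiff (prism \<rho> ?F) xs \<in> carrier R"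
      using cochainD[OF F] hdiff_closed[OF PF] xs by auto
    have mx: "set (map \<rho> xs) \<subseteq> H" "length (map \<rho> xs) = Suc (Suc m)" using xs \<rho>H by auto
    have "?F (map \<rho> xs) = hdiff (homog k) (map \<rho> xs)"
    proof -
      obtain y zs where y: "map \<rho> xs = y # zs" using mx(2) by (cases "map \<rho> xs") auto
      then have yH: "y \<in> H" "set zs \<subseteq> H" "length zs = Suc m" using mx by auto
      have "hdiff (homog k) (y # zs) = \<phi> y (cob k (quotients y zs))"
        by (rule hdiff_homog[OF H k yH(1,3,2)])
      also have "cob k (quotients y zs) = f (quotients y zs)"
        using yH quotients_closed[OF H yH(1,2)] by (intro res[symmetric]) auto
      finally show ?thesis unfolding y by simp
    qed
    also have "\<dots> = hdiff ?k xs" by (rule hdiff_map)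
    finally have Fm: "?F (map \<rho> xs) = hdiff ?k xs" .
    have "hdiff E xs = hdiff (prism \<rho> ?F) xs \<oplus> hdiff ?k xs"
      unfolding E_def by (rule hdiff_add[OF PF k' xs])
    also have "hdiff (prism \<rho> ?F) xs = ?F xs \<ominus> hdiff ?k xs"
      using prism_homotopy[OF F xs \<rho>G] K0 Fx Fm by simp
    finally show ?thesis using Fx(1) hdiff_closed[OF k' xs] by (simp add: a_minus_def a_assoc l_neg)
  qed
  have E_equiv: "E (map (\<lambda>y. h \<otimes>\<^bsub>G\<^esub> y) ys) = \<phi> h (E ys)"
    if h: "h \<in> H" and ys: "length ys = Suc m" "set ys \<subseteq> carrier G" for h ys
  proof -
    have hG: "h \<in> carrier G" using h HG by blast
    let ?h = "\<lambda>y. h \<otimes>\<^bsub>G\<^esub> y"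
    have "prism \<rho> ?F (map ?h ys) = prism \<rho> (\<lambda>zs. ?F (map ?h zs)) ys"
      using \<rho>_equiv h ys by (intro prism_map[of "carrier G", symmetric]) auto
    also have "\<dots> = prism \<rho> (\<lambda>zs. \<phi> h (?F zs)) ys"
      using homog_equivariant[OF f hG] ys \<rho>G by (intro prism_cong[of "Suc m" "carrier G"]) auto
    also have "\<dots> = \<phi> h (prism \<rho> ?F ys)"
      by (rule prism_hom[OF F ys \<rho>G]) (use hG in auto)
    finally have 1: "prism \<rho> ?F (map ?h ys) = \<phi> h (prism \<rho> ?F ys)" .
    have "map \<rho> (map ?h ys) = map ?h (map \<rho> ys)" using \<rho>_equiv h ys by auto
    moreover have "homog k (map ?h (map \<rho> ys)) = \<phi> h (homog k (map \<rho> ys))"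
    proof -
      obtain y zs where y: "map \<rho> ys = y # zs" using ys(1) by (cases "map \<rho> ys") auto
      have sH: "set (map \<rho> ys) \<subseteq> H" using \<rho>H ys by auto
      then have yH: "y \<in> H" "set zs \<subseteq> H" unfolding y by auto
      have "length (map \<rho> ys) = Suc m" using ys by simp
      then have "length zs = m" unfolding y by simp
      then have "k (quotients y zs) \<in> carrier R"
        using quotients_closed[OF H yH] by (intro cochainD[OF k]) auto
      moreover have "quotients (h \<otimes>\<^bsub>G\<^esub> y) (map ?h zs) = quotients y zs"
        using yH HG by (intro quotients_map hG) auto
      ultimately show ?thesis unfolding y using hG yH HG by (simp add: act_comp subset_iff)
    qed
    ultimately have 2: "?k (map ?h ys) = \<phi> h (?k ys)" by (simp only:)
    show ?thesis unfolding E_def 1 2 using cochainD[OF PF ys] cochainD[OF k' ys] hG by simp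
  qed
  let ?m = "\<lambda>g. map (\<lambda>y. g \<otimes>\<^bsub>G\<^esub> y)"
  have set_m: "set (?m g ys) \<subseteq> carrier G" if "g \<in> carrier G" "set ys \<subseteq> carrier G" for g ys
    using that by auto
  have m_m: "?m g (?m g' ys) = ?m (g \<otimes>\<^bsub>G\<^esub> g') ys" if "g \<in> carrier G" "g' \<in> carrier G" "set ys \<subseteq> carrier G" for g g' ys
    using that by (auto simp: G.m_assoc subset_iff)
  \<comment> \<open>The transfer of \<open>r E\<close> from \<open>H\<close> to \<open>G\<close>: a
    sum of translates over \<open>G/H\<close>, which turns \<open>H\<close>-equivariance into
    \<open>G\<close>-equivariance.\<close>
  define W where "W ys = (\<Oplus>t\<in>T. \<phi> t (r \<otimes> E (?m (inv\<^bsub>G\<^esub> t) ys)))" for ys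
  have Ein: "E (?m g ys) \<in> carrier R" if "g \<in> carrier G" "length ys = Suc m" "set ys \<subseteq> carrier G" for g ys
    using that by (intro cochainD[OF Ec] set_m) auto
  have Wt: "cochain (carrier G) (Suc m) (carrier R) (\<lambda>ys. \<phi> t (r \<otimes> E (?m (inv\<^bsub>G\<^esub> t) ys)))" if "t \<in> T" for t
    unfolding cochain_def using that TG r(1) Ein by (auto simp del: act_mult intro!: act_closed)
  have Wc: "cochain (carrier G) (Suc m) (carrier R) W"
    unfolding cochain_def W_def using cochainD[OF Wt] by (auto intro!: finsum_closed simp del: act_mult)
  define a where "a = (\<Oplus>t\<in>T. \<phi> t r)"
  have ac: "a \<in> carrier R" unfolding a_def using r(1) TG by (intro finsum_closed) auto
  have dW: "hdiff W xs = a \<otimes> ?F xs" if xs: "length xs = Suc (Suc m)" "set xs \<subseteq> carrier G" for xs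
  proof -
    have Fx: "?F xs \<in> carrier R" using cochainD[OF F] xs by auto
    have "hdiff W xs = (\<Oplus>t\<in>T. hdiff (\<lambda>ys. \<phi> t (r \<otimes> E (?m (inv\<^bsub>G\<^esub> t) ys))) xs)"
      unfolding W_def by (rule hdiff_finsum[OF finT Wt xs])
    \<comment> \<open>\<open>?F\<close> is equivariant under all of \<open>G\<close>, so the
      translation inside and the action outside cancel, leaving \<open>\<phi> t r\<close> as
      coefficient.\<close>
    also have "\<dots> = (\<Oplus>t\<in>T. \<phi> t r \<otimes> ?F xs)"
    proof (intro finsum_cong')
      fix t assume t: "t \<in> T"
      then have tG: "t \<in> carrier G" using TG by blast
      have Em: "cochain (carrier G) (Suc m) (carrier R) (\<lambda>ys. E (?m (inv\<^bsub>G\<^esub> t) ys))"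
        unfolding cochain_def using Ein tG by simp
      have "hdiff (\<lambda>ys. \<phi> t (r \<otimes> E (?m (inv\<^bsub>G\<^esub> t) ys))) xs = \<phi> t (r \<otimes> hdiff (\<lambda>ys. E (?m (inv\<^bsub>G\<^esub> t) ys)) xs)"
      proof (rule hdiff_hom[OF Em xs])
        fix x y assume xy: "x \<in> carrier R" "y \<in> carrier R"
        then have "r \<otimes> (x \<ominus> y) = r \<otimes> x \<ominus> r \<otimes> y" using r(1) by algebra
        then show "\<phi> t (r \<otimes> (x \<ominus> y)) = \<phi> t (r \<otimes> x) \<ominus> \<phi> t (r \<otimes> y)" using xy r(1) tG by simp
      qed (use r(1) tG in simp)
      also have "hdiff (\<lambda>ys. E (?m (inv\<^bsub>G\<^esub> t) ys)) xs = ?F (?m (inv\<^bsub>G\<^esub> t) xs)"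
        using dE[of "?m (inv\<^bsub>G\<^esub> t) xs"] set_m[OF _ xs(2)] xs(1) tG by (simp add: hdiff_map)
      also have "\<dots> = \<phi> (inv\<^bsub>G\<^esub> t) (?F xs)" using homog_equivariant[OF f _ xs] tG by simp
      finally show "hdiff (\<lambda>ys. \<phi> t (r \<otimes> E (?m (inv\<^bsub>G\<^esub> t) ys))) xs = \<phi> t r \<otimes> ?F xs"
        using tG r(1) Fx by simp
    qed (use r(1) TG Fx in auto)
    also have "\<dots> = a \<otimes> ?F xs" unfolding a_def using r(1) TG Fx finT by (intro finsum_ldistr[symmetric]) auto
    finally show ?thesis .
  qed
  have W_equiv: "W (?m g ys) = \<phi> g (W ys)" if g: "g \<in> carrier G" and ys: "length ys = Suc m" "set ys \<subseteq> carrier G" for g ys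
  proof -
    define \<Phi> where "\<Phi> u = \<phi> u (r \<otimes> E (?m (inv\<^bsub>G\<^esub> u) (?m g ys)))" for u
    have gys: "length (?m g ys) = Suc m" "set (?m g ys) \<subseteq> carrier G" using ys set_m[OF g ys(2)] by auto
    have \<Phi>c: "\<Phi> u \<in> carrier R" if "u \<in> carrier G" for u
      unfolding \<Phi>_def using that r(1) Ein[OF _ gys] by (simp del: act_mult)
    \<comment> \<open>The term depends on the coset \<open>u H\<close> only: \<open>h\<close> fixes
      \<open>r\<close>, and \<open>E\<close> is \<open>H\<close>-equivariant.\<close>
    have "\<Phi> (u \<otimes>\<^bsub>G\<^esub> h) = \<Phi> u" if u: "u \<in> carrier G" and h: "h \<in> H" for u h
    proof -
      have hG: "h \<in> carrier G" using h HG by blast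
      have "?m (inv\<^bsub>G\<^esub> (u \<otimes>\<^bsub>G\<^esub> h)) (?m g ys) = ?m (inv\<^bsub>G\<^esub> h) (?m (inv\<^bsub>G\<^esub> u) (?m g ys))"
        using m_m[OF _ _ gys(2), of "inv\<^bsub>G\<^esub> h" "inv\<^bsub>G\<^esub> u"] u hG by (simp only: G.inv_mult_group G.inv_closed)
      also have "E \<dots> = \<phi> (inv\<^bsub>G\<^esub> h) (E (?m (inv\<^bsub>G\<^esub> u) (?m g ys)))"
        using h u gys set_m[OF _ gys(2)] by (intro E_equiv) auto
      finally have "\<Phi> (u \<otimes>\<^bsub>G\<^esub> h) = \<phi> (u \<otimes>\<^bsub>G\<^esub> h) (r \<otimes> \<phi> (inv\<^bsub>G\<^esub> h) (E (?m (inv\<^bsub>G\<^esub> u) (?m g ys))))"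
        unfolding \<Phi>_def by simp
      also have "\<dots> = \<phi> u (\<phi> h r \<otimes> E (?m (inv\<^bsub>G\<^esub> u) (?m g ys)))"
        using u hG r(1) Ein[OF _ gys] by (simp add: act_comp del: map_map)
      also have "\<dots> = \<Phi> u" unfolding \<Phi>_def r(2)[OF h] ..
      finally show ?thesis .
    qed
    then have "(\<Oplus>t\<in>T. \<Phi> (g \<otimes>\<^bsub>G\<^esub> t)) = (\<Oplus>t\<in>T. \<Phi> t)"
      using transversal_finsum[OF H T g, of \<Phi>] \<Phi>c by blast
    moreover have "\<phi> g (W ys) = (\<Oplus>t\<in>T. \<Phi> (g \<otimes>\<^bsub>G\<^esub> t))"
      unfolding W_def
    proof (subst act_finsum[OF g], goal_cases)
      case 1
      then show ?case using cochainD[OF Wt ys] by simp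
    next
      case 2
      show ?case
      proof (intro finsum_cong')
        show "(\<lambda>t. \<Phi> (g \<otimes>\<^bsub>G\<^esub> t)) \<in> T \<rightarrow> carrier R" using \<Phi>c g TG by auto
        fix t assume "t \<in> T"
        then have tG: "t \<in> carrier G" using TG by blast
        have "?m (inv\<^bsub>G\<^esub> (g \<otimes>\<^bsub>G\<^esub> t)) (?m g ys) = ?m (inv\<^bsub>G\<^esub> t) ys"
          using m_m[OF _ g ys(2), of "inv\<^bsub>G\<^esub> (g \<otimes>\<^bsub>G\<^esub> t)"] g tG by (simp add: G.inv_mult_group G.m_assoc)
        then show "(\<phi> g \<circ> (\<lambda>t. \<phi> t (r \<otimes> E (?m (inv\<^bsub>G\<^esub> t) ys)))) t = \<Phi> (g \<otimes>\<^bsub>G\<^esub> t)"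
          unfolding \<Phi>_def using g tG r(1) Ein[OF _ ys, of "inv\<^bsub>G\<^esub> t"]
          by (simp add: act_comp del: act_mult map_map)
      qed simp
    qed
    ultimately show ?thesis unfolding W_def \<Phi>_def by simp
  qed
  \<comment> \<open>Dehomogenization at the list \<open>1, g1, g1 g2, ...\<close>; on equivariant
    cochains it is inverse to \<open>homog\<close>.\<close>
  define e where "e gs = W (\<one>\<^bsub>G\<^esub> # products \<one>\<^bsub>G\<^esub> gs)" for gs
  have ec: "cochain (carrier G) m (carrier R) e"
    unfolding cochain_def e_def
    using products_closed by (intro allI impI cochainD[OF Wc]) simp_all
  have he: "homog e ys = W ys" if ys: "length ys = Suc m" "set ys \<subseteq> carrier G" for ys
  proof -
    obtain y zs where y: "ys = y # zs" using ys(1) by (cases ys) auto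
    have yG: "y \<in> carrier G" "set zs \<subseteq> carrier G" using y ys by auto
    have q: "set (quotients y zs) \<subseteq> carrier G" by (rule quotients_closed[OF S yG])
    have "?m y (\<one>\<^bsub>G\<^esub> # products \<one>\<^bsub>G\<^esub> (quotients y zs)) = ys"
      using y yG q by (simp add: map_products products_quotients)
    then show ?thesis
      using W_equiv[OF yG(1), of "\<one>\<^bsub>G\<^esub> # products \<one>\<^bsub>G\<^esub> (quotients y zs)"] y ys q products_closed
      unfolding e_def by simp
  qed
  have "cob e gs = a \<otimes> f gs" if gs: "length gs = Suc m" "set gs \<subseteq> carrier G" for gs
  proof -
    define xs where "xs = products \<one>\<^bsub>G\<^esub> gs"
    have xs: "length xs = Suc m" "set xs \<subseteq> carrier G" "quotients \<one>\<^bsub>G\<^esub> xs = gs"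
      unfolding xs_def using gs products_closed quotients_products by simp_all
    have "cob e gs \<in> carrier R" using cob_closed[OF S ec] gs by (intro cochainD)
    then have "cob e gs = \<phi> \<one>\<^bsub>G\<^esub> (cob e (quotients \<one>\<^bsub>G\<^esub> xs))" using xs(3) by simp
    also have "\<dots> = hdiff (homog e) (\<one>\<^bsub>G\<^esub> # xs)" using hdiff_homog[OF S ec _ xs(1,2)] by simp
    also have "\<dots> = hdiff W (\<one>\<^bsub>G\<^esub> # xs)"
      using he xs by (intro hdiff_cong[of "Suc m" "carrier G"]) auto
    also have "\<dots> = a \<otimes> ?F (\<one>\<^bsub>G\<^esub> # xs)" using xs by (intro dW) auto
    also have "?F (\<one>\<^bsub>G\<^esub> # xs) = f gs" using xs(3) cochainD[OF f gs] by simp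
    finally show ?thesis .
  qed
  then show ?thesis using ec unfolding a_def by blast
qed

end

section \<open>Dimension shifting\<close>

context finite_ring_action
begin

abbreviation cc where "cc \<equiv> cochain (carrier G)"

lemma faces_diff:
  assumes "subgroup S G" "cochain S n (carrier R) f" "cochain S n (carrier R) k" "length gs = Suc n" "set gs \<subseteq> S"
  shows "faces (\<lambda>gs. f gs \<ominus> k gs) gs = faces f gs \<ominus> faces k gs"
  using assms(2-)
proof (induction f gs arbitrary: k n rule: faces.induct)
  case (2 f g)
  then have "f [] \<in> carrier R" "k [] \<in> carrier R"
    using cochainD[OF 2(1), of "[]"] cochainD[OF 2(2), of "[]"] by simp_all
  then show ?case by simp algebra
next
  case (3 f g h gs)
  then obtain m where m: "n = Suc m" by (cases n) auto
  have S: "g \<in> S" "set (h # gs) \<subseteq> S" "length (h # gs) = Suc m" using 3 m by auto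
  have c: "cochain S m (carrier R) (\<lambda>ys. f (g # ys))" "cochain S m (carrier R) (\<lambda>ys. k (g # ys))"
    using 3(2,3) m S(1) by (auto intro: cochain_Cons)
  define a b where "a = f ((g \<otimes>\<^bsub>G\<^esub> h) # gs)" and "b = k ((g \<otimes>\<^bsub>G\<^esub> h) # gs)"
  define u v where "u = faces (\<lambda>ys. f (g # ys)) (h # gs)" and "v = faces (\<lambda>ys. k (g # ys)) (h # gs)"
  have "a \<in> carrier R" "b \<in> carrier R"
    unfolding a_def b_def using S m subgroup.m_closed[OF assms(1)] by (intro cochainD[OF 3(2)] cochainD[OF 3(3)]; simp)+
  moreover have "u \<in> carrier R" "v \<in> carrier R"
    unfolding u_def v_def
    using faces_closed[OF assms(1) c(1) S(3,2)] faces_closed[OF assms(1) c(2) S(3,2)] by auto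
  ultimately have "\<ominus> (a \<ominus> b) \<ominus> (u \<ominus> v) = (\<ominus> a \<ominus> u) \<ominus> (\<ominus> b \<ominus> v)" by algebra
  then show ?case using 3(1)[OF c S(3,2)] unfolding a_def b_def u_def v_def by simp
qed simp

lemma faces_scale:
  assumes "a \<in> carrier R" "cc n (carrier R) f" "length gs = Suc n" "set gs \<subseteq> carrier G"
  shows "faces (\<lambda>gs. a \<otimes> f gs) gs = a \<otimes> faces f gs"
  using assms(2-)
proof (induction f gs arbitrary: n rule: faces.induct)
  case (2 f g)
  then have "f [] \<in> carrier R" using cochainD[OF 2(1), of "[]"] by simp
  then show ?case using assms(1) by (simp add: r_minus)
next
  case (3 f g h gs)
  then obtain m where m: "n = Suc m" by (cases n) auto
  have S: "g \<in> carrier G" "set (h # gs) \<subseteq> carrier G" "length (h # gs) = Suc m" using 3 m by auto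
  have c: "cc m (carrier R) (\<lambda>ys. f (g # ys))" using 3(2) m S(1) by (auto intro: cochain_Cons)
  define x where "x = f ((g \<otimes>\<^bsub>G\<^esub> h) # gs)"
  define u where "u = faces (\<lambda>ys. f (g # ys)) (h # gs)"
  have "x \<in> carrier R" unfolding x_def using S m by (intro cochainD[OF 3(2)]; simp)
  moreover have "u \<in> carrier R"
    unfolding u_def using faces_closed[OF G.subgroup_self c(1) S(3,2)] by auto
  ultimately have "\<ominus> (a \<otimes> x) \<ominus> (a \<otimes> u) = a \<otimes> (\<ominus> x \<ominus> u)" using assms(1) by algebra
  then show ?case using 3(1)[OF c S(3,2)] unfolding x_def u_def by simp
qed (use assms(1) in simp)

lemma cob_diff_on:
  assumes "subgroup S G" "cochain S n (carrier R) f" "cochain S n (carrier R) k" "length gs = Suc n" "set gs \<subseteq> S"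
  shows "cob (\<lambda>gs. f gs \<ominus> k gs) gs = cob f gs \<ominus> cob k gs"
proof -
  obtain g hs where g: "gs = g # hs" using assms(4) by (cases gs) auto
  have gG: "g \<in> carrier G" using g assms(5) subgroup.subset[OF assms(1)] by auto
  define x y u v where "x = \<phi> g (f hs)" and "y = \<phi> g (k hs)" and "u = faces f gs" and "v = faces k gs"
  have fk: "f hs \<in> carrier R" "k hs \<in> carrier R"
    using g assms by (intro cochainD[OF assms(2)] cochainD[OF assms(3)]; simp)+
  have "x \<in> carrier R" "y \<in> carrier R" "u \<in> carrier R" "v \<in> carrier R"
    unfolding x_def y_def u_def v_def
    using fk gG faces_closed[OF assms(1) _ assms(4,5)] assms(2,3) by auto
  then have "(x \<ominus> y) \<oplus> (u \<ominus> v) = (x \<oplus> u) \<ominus> (y \<oplus> v)" by algebra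
  then show ?thesis
    using faces_diff[OF assms] fk gG unfolding x_def y_def u_def v_def g by simp
qed

lemmas cob_diff = cob_diff_on[OF G.subgroup_self]

lemma cob_scale:
  assumes "a \<in> carrier A" "cc n (carrier R) f" "length gs = Suc n" "set gs \<subseteq> carrier G"
  shows "cob (\<lambda>gs. a \<otimes> f gs) gs = a \<otimes> cob f gs"
proof -
  obtain g hs where g: "gs = g # hs" using assms(3) by (cases gs) auto
  have gG: "g \<in> carrier G" using g assms(4) by simp
  have "f hs \<in> carrier R" using g assms by (intro cochainD[OF assms(2)]; simp)
  moreover have "faces f gs \<in> carrier R" using faces_closed[OF G.subgroup_self assms(2-4)] .
  ultimately show ?thesis
    using faces_scale[OF _ assms(2-4), of a] gG assms(1) unfolding g by (simp add: r_distr)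
qed

section \<open>Cohomology with coefficients modulo a stable ideal\<close>

definition stable :: "'a set \<Rightarrow> bool" where
  "stable I \<longleftrightarrow> ideal I R \<and> (\<forall>g \<in> carrier G. \<forall>x \<in> I. \<phi> g x \<in> I)"

lemma stable_zero: "stable {\<zero>}"
  unfolding stable_def using zeroideal by simp

lemma stable_adjoin:
  assumes "stable I" "a \<in> carrier A"
  shows "stable (adjoin R I a)"
proof -
  have I: "ideal I R" "\<And>g x. g \<in> carrier G \<Longrightarrow> x \<in> I \<Longrightarrow> \<phi> g x \<in> I" using assms(1) unfolding stable_def by auto
  have "\<phi> g x \<in> adjoin R I a" if g: "g \<in> carrier G" and x: "x \<in> adjoin R I a" for g x
  proof -
    obtain i r where i: "i \<in> I" "r \<in> carrier R" "x = i \<oplus> a \<otimes> r" using x by (rule adjoinE)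
    have "\<phi> g x = \<phi> g i \<oplus> a \<otimes> \<phi> g r" using i g assms(2) ideal.Icarr[OF I(1)] by simp
    then show ?thesis using adjoinI[OF I(2)[OF g i(1)]] g i(2) by simp
  qed
  then show ?thesis unfolding stable_def using adjoin_ideal[OF I(1)] assms(2) by simp
qed

lemma faces_ideal:
  assumes "ideal I R" "cc n I f" "length gs = Suc n" "set gs \<subseteq> carrier G"
  shows "faces f gs \<in> I"
  using assms(2-)
proof (induction f gs arbitrary: n rule: faces.induct)
  case (2 f g)
  then have "f [] \<in> I" using cochainD[OF 2(1), of "[]"] by simp
  then show ?case using additive_subgroup.a_inv_closed[OF ideal.axioms(1)[OF assms(1)]] by simp
next
  case (3 f g h gs)
  interpret I: ideal I R by fact
  obtain m where m: "n = Suc m" using 3 by (cases n) auto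
  have S: "g \<in> carrier G" "set (h # gs) \<subseteq> carrier G" "length (h # gs) = Suc m" using 3 m by auto
  have c: "cc m I (\<lambda>ys. f (g # ys))" using 3(2) m S(1) by (auto intro: cochain_Cons)
  have "f ((g \<otimes>\<^bsub>G\<^esub> h) # gs) \<in> I" using S m by (intro cochainD[OF 3(2)]; simp)
  then show ?case using 3(1)[OF c S(3,2)] I.minus_closed I.a_inv_closed by simp
qed simp

lemma cob_stable:
  assumes "stable I" "cc n I f"
  shows "cc (Suc n) I (cob f)"
  unfolding cochain_def
proof (intro allI impI)
  interpret I: ideal I R using assms(1) unfolding stable_def by simp
  fix gs assume gs: "length gs = Suc n" "set gs \<subseteq> carrier G"
  obtain g hs where g: "gs = g # hs" using gs(1) by (cases gs) auto
  have "f hs \<in> I" using g gs by (intro cochainD[OF assms(2)]; simp)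
  then have "\<phi> g (f hs) \<in> I" using assms(1) gs(2) g unfolding stable_def by simp
  then show "cob f gs \<in> I"
    using faces_ideal[OF I.is_ideal assms(2) gs] g I.a_closed by simp
qed

lemma cob_closed_G: "cc n (carrier R) f \<Longrightarrow> cc (Suc n) (carrier R) (cob f)"
  by (rule cob_closed[OF G.subgroup_self])

text \<open>A cocycle with values in the \<open>G\<close>-module \<open>R/I\<close>, represented by
  a lift to \<open>R\<close>.\<close>

definition cocycle_mod :: "nat \<Rightarrow> 'a set \<Rightarrow> ('g list \<Rightarrow> 'a) \<Rightarrow> bool" where
  "cocycle_mod n I f \<longleftrightarrow> cc n (carrier R) f \<and> cc (Suc n) I (cob f)"

text \<open>Here \<open>n\<close> is the degree of the cochain \<open>k\<close> that is
  differentiated; \<open>f\<close> has degree \<open>n + 1\<close>.\<close>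

definition coboundary_mod :: "nat \<Rightarrow> 'a set \<Rightarrow> ('g list \<Rightarrow> 'a) \<Rightarrow> bool" where
  "coboundary_mod n I f \<longleftrightarrow>
     (\<exists>k. cc n (carrier R) k \<and> cc (Suc n) I (\<lambda>gs. f gs \<ominus> cob k gs))"

text \<open>\<open>(R/I)\<^sup>G\<close> is the image of \<open>R\<^sup>G\<close>.\<close>

definition invariants_lift :: "'a set \<Rightarrow> bool" where
  "invariants_lift I \<longleftrightarrow> (\<forall>f. cocycle_mod 0 I f \<longrightarrow> (\<exists>c \<in> carrier A. f [] \<ominus> c \<in> I))"

lemma cochain_adjoin:
  assumes I: "ideal I R" and a: "a \<in> carrier R" and f: "cc n (adjoin R I a) f"
  shows "\<exists>u. cc n (carrier R) u \<and> cc n I (\<lambda>gs. f gs \<ominus> a \<otimes> u gs)"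
proof -
  have "\<exists>r. r \<in> carrier R \<and> f gs \<ominus> a \<otimes> r \<in> I" if "length gs = n" "set gs \<subseteq> carrier G" for gs
  proof -
    have "f gs \<in> adjoin R I a" using cochainD[OF f that] .
    moreover from this have "f gs \<in> carrier R" using ideal.Icarr[OF adjoin_ideal[OF I a]] by blast
    ultimately show ?thesis using adjoin_iff[OF I a] by blast
  qed
  then obtain u where "\<And>gs. length gs = n \<Longrightarrow> set gs \<subseteq> carrier G \<Longrightarrow> u gs \<in> carrier R \<and> f gs \<ominus> a \<otimes> u gs \<in> I"
    by metis
  then show ?thesis unfolding cochain_def by blast
qed

lemma cochain_diff: "cc n (carrier R) f \<Longrightarrow> cc n (carrier R) k \<Longrightarrow> cc n (carrier R) (\<lambda>gs. f gs \<ominus> k gs)"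
  unfolding cochain_def by simp

lemma cochain_scale: "a \<in> carrier R \<Longrightarrow> cc n (carrier R) f \<Longrightarrow> cc n (carrier R) (\<lambda>gs. a \<otimes> f gs)"
  unfolding cochain_def by simp

text \<open>The long exact sequence of \<open>0 \<rightarrow> R/I \<rightarrow> R/I \<rightarrow> R/(I + a) \<rightarrow> 0\<close>: the connecting map takes a cocycle
  \<open>f\<close> modulo \<open>I + a\<close> to \<open>u\<close> with \<open>cob f = a u\<close> modulo \<open>I\<close>.\<close>

lemma connecting_cocycle:
  assumes I: "stable I" and a: "a \<in> carrier A" and nz: "nonzerodivisor_mod R I a"
    and f: "cocycle_mod n (adjoin R I a) f"
  obtains u where "cocycle_mod (Suc n) I u" "cc (Suc n) I (\<lambda>gs. cob f gs \<ominus> a \<otimes> u gs)"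
proof -
  interpret I: ideal I R using I unfolding stable_def by simp
  have fc: "cc n (carrier R) f" "cc (Suc n) (adjoin R I a) (cob f)" using f unfolding cocycle_mod_def by auto
  obtain u where u: "cc (Suc n) (carrier R) u" "cc (Suc n) I (\<lambda>gs. cob f gs \<ominus> a \<otimes> u gs)"
    using cochain_adjoin[OF I.is_ideal _ fc(2)] a by auto
  \<comment> \<open>Since \<open>cob (cob f)\<close> vanishes, applying \<open>cob\<close> to
    \<open>cob f - a u\<close> shows that \<open>a cob u\<close> lies in \<open>I\<close>, and
    \<open>a\<close> can be cancelled.\<close>
  have "cc (Suc (Suc n)) I (cob u)"
    unfolding cochain_def
  proof (intro allI impI)
    fix gs assume gs: "length gs = Suc (Suc n)" "set gs \<subseteq> carrier G"
    have uc: "cob u gs \<in> carrier R" using cochainD[OF cob_closed_G[OF u(1)] gs] .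
    have "cob (\<lambda>gs. cob f gs \<ominus> a \<otimes> u gs) gs = cob (cob f) gs \<ominus> cob (\<lambda>gs. a \<otimes> u gs) gs"
      using a u(1) by (intro cob_diff[OF cob_closed_G[OF fc(1)] _ gs] cochain_scale) auto
    also have "\<dots> = \<zero> \<ominus> a \<otimes> cob u gs"
      using cob_cob[OF fc(1) gs] cob_scale[OF a u(1) gs] by simp
    finally have "\<zero> \<ominus> a \<otimes> cob u gs \<in> I" using cochainD[OF cob_stable[OF I u(2)] gs] by simp
    then have "\<ominus> (\<zero> \<ominus> a \<otimes> cob u gs) \<in> I" by (rule I.a_inv_closed)
    moreover have "\<ominus> (\<zero> \<ominus> a \<otimes> cob u gs) = a \<otimes> cob u gs" using a uc by (simp add: a_minus_def)
    ultimately show "cob u gs \<in> I" using nz uc unfolding nonzerodivisor_mod_def by simp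
  qed
  then show ?thesis using that u unfolding cocycle_mod_def by blast
qed

text \<open>Surjectivity of reduction when the next cohomology modulo \<open>I\<close> vanishes: the
  connecting cocycle is then some \<open>cob k\<close>, and subtracting \<open>a k\<close>, which is
  invisible modulo \<open>I + a\<close>, makes \<open>f\<close> a cocycle modulo
  \<open>I\<close>.\<close>

lemma cocycle_mod_lift:
  assumes I: "stable I" and a: "a \<in> carrier A" and nz: "nonzerodivisor_mod R I a"
    and f: "cocycle_mod n (adjoin R I a) f"
    and vanish: "\<And>u. cocycle_mod (Suc n) I u \<Longrightarrow> coboundary_mod n I u"
  obtains k where "cc n (carrier R) k" "cocycle_mod n I (\<lambda>gs. f gs \<ominus> a \<otimes> k gs)"
proof -
  interpret I: ideal I R using I unfolding stable_def by simp
  have aR: "a \<in> carrier R" using a by simp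
  have fc: "cc n (carrier R) f" using f unfolding cocycle_mod_def by auto
  obtain u where u: "cocycle_mod (Suc n) I u" "cc (Suc n) I (\<lambda>gs. cob f gs \<ominus> a \<otimes> u gs)"
    using connecting_cocycle[OF I a nz f] .
  then obtain k where k: "cc n (carrier R) k" "cc (Suc n) I (\<lambda>gs. u gs \<ominus> cob k gs)"
    using vanish unfolding coboundary_mod_def by blast
  have uc: "cc (Suc n) (carrier R) u" using u(1) unfolding cocycle_mod_def by simp
  have "cc (Suc n) I (cob (\<lambda>gs. f gs \<ominus> a \<otimes> k gs))"
    unfolding cochain_def
  proof (intro allI impI)
    fix gs assume gs: "length gs = Suc n" "set gs \<subseteq> carrier G"
    have c: "cob f gs \<in> carrier R" "cob k gs \<in> carrier R" "u gs \<in> carrier R"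
      using cochainD[OF cob_closed_G[OF fc] gs] cochainD[OF cob_closed_G[OF k(1)] gs] cochainD[OF uc gs] by auto
    have "cob (\<lambda>gs. f gs \<ominus> a \<otimes> k gs) gs = cob f gs \<ominus> a \<otimes> cob k gs"
      using cob_diff[OF fc cochain_scale[OF aR k(1)] gs] cob_scale[OF a k(1) gs] by simp
    also have "\<dots> = (cob f gs \<ominus> a \<otimes> u gs) \<oplus> a \<otimes> (u gs \<ominus> cob k gs)" using c aR by algebra
    also have "\<dots> \<in> I" using cochainD[OF u(2) gs] cochainD[OF k(2) gs] I.I_l_closed aR I.a_closed by simp
    finally show "cob (\<lambda>gs. f gs \<ominus> a \<otimes> k gs) gs \<in> I" .
  qed
  then show ?thesis
    using that[OF k(1)] cochain_diff[OF fc cochain_scale[OF aR k(1)]] unfolding cocycle_mod_def by blast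
qed

text \<open>In the long exact sequence the group modulo \<open>I + a\<close> stands between those
  modulo \<open>I\<close> in the same and the next degree. Each division thus shortens the range of
  vanishing by one, exactly as the degree of the class drops.\<close>

lemma vanishing_adjoin:
  assumes I: "stable I" and a: "a \<in> carrier A" and nz: "nonzerodivisor_mod R I a"
    and van: "\<And>u. cocycle_mod (Suc n) I u \<Longrightarrow> coboundary_mod n I u"
      "\<And>u. cocycle_mod (Suc (Suc n)) I u \<Longrightarrow> coboundary_mod (Suc n) I u"
    and f: "cocycle_mod (Suc n) (adjoin R I a) f"
  shows "coboundary_mod n (adjoin R I a) f"
proof -
  interpret I: ideal I R using I unfolding stable_def by simp
  have aR: "a \<in> carrier R" using a by simp
  have fc: "cc (Suc n) (carrier R) f" using f unfolding cocycle_mod_def by auto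
  obtain k where k: "cc (Suc n) (carrier R) k" "cocycle_mod (Suc n) I (\<lambda>gs. f gs \<ominus> a \<otimes> k gs)"
    using cocycle_mod_lift[OF I a nz f van(2)] .
  obtain l where l: "cc n (carrier R) l" "cc (Suc n) I (\<lambda>gs. (f gs \<ominus> a \<otimes> k gs) \<ominus> cob l gs)"
    using van(1)[OF k(2)] unfolding coboundary_mod_def by blast
  have "cc (Suc n) (adjoin R I a) (\<lambda>gs. f gs \<ominus> cob l gs)"
    unfolding cochain_def
  proof (intro allI impI)
    fix gs assume gs: "length gs = Suc n" "set gs \<subseteq> carrier G"
    have "f gs \<in> carrier R" "k gs \<in> carrier R" "cob l gs \<in> carrier R"
      using cochainD[OF fc gs] cochainD[OF k(1) gs] cochainD[OF cob_closed_G[OF l(1)] gs] by auto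
    then have "f gs \<ominus> cob l gs = ((f gs \<ominus> a \<otimes> k gs) \<ominus> cob l gs) \<oplus> a \<otimes> k gs" using aR by algebra
    then show "f gs \<ominus> cob l gs \<in> adjoin R I a"
      using adjoinI[OF cochainD[OF l(2) gs] cochainD[OF k(1) gs], of a] by simp
  qed
  then show ?thesis using l(1) unfolding coboundary_mod_def by blast
qed

text \<open>Vanishing of \<open>H^1\<close> lifts an invariant modulo \<open>I + a\<close> to one
  modulo \<open>I\<close>, from where it lifts to \<open>A\<close> by assumption.\<close>

lemma invariants_lift_adjoin:
  assumes I: "stable I" and a: "a \<in> carrier A" and nz: "nonzerodivisor_mod R I a"
    and van: "\<And>u. cocycle_mod (Suc 0) I u \<Longrightarrow> coboundary_mod 0 I u"
    and lift: "invariants_lift I"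
  shows "invariants_lift (adjoin R I a)"
  unfolding invariants_lift_def
proof (intro allI impI)
  interpret I: ideal I R using I unfolding stable_def by simp
  fix f assume f: "cocycle_mod 0 (adjoin R I a) f"
  obtain k where k: "cc 0 (carrier R) k" "cocycle_mod 0 I (\<lambda>gs. f gs \<ominus> a \<otimes> k gs)"
    using cocycle_mod_lift[OF I a nz f van] .
  obtain c where c: "c \<in> carrier A" "(f [] \<ominus> a \<otimes> k []) \<ominus> c \<in> I"
    using lift k(2) unfolding invariants_lift_def by blast
  have "f [] \<in> carrier R" "k [] \<in> carrier R"
    using f k(1) unfolding cocycle_mod_def cochain_def by simp_all
  then have "f [] \<ominus> c = ((f [] \<ominus> a \<otimes> k []) \<ominus> c) \<oplus> a \<otimes> k []"
    using in_A_carrier[OF a] in_A_carrier[OF c(1)] by algebra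
  then have "f [] \<ominus> c \<in> adjoin R I a" using adjoinI[OF c(2) \<open>k [] \<in> carrier R\<close>, of a] by simp
  then show "\<exists>c \<in> carrier A. f [] \<ominus> c \<in> adjoin R I a" using c(1) by blast
qed

text \<open>If an invariant \<open>s\<close> is \<open>a r\<close> modulo \<open>I\<close>,
  cancelling \<open>a\<close> shows \<open>r\<close> to be invariant modulo \<open>I\<close>, and
  replacing \<open>r\<close> by a lift in \<open>A\<close> makes the multiple of \<open>a\<close>
  one within \<open>A\<close>. This keeps regularity in \<open>A\<close> usable while dividing
  \<open>R\<close>.\<close>

lemma contraction_adjoin:
  assumes I: "stable I" and a: "a \<in> carrier A" and nz: "nonzerodivisor_mod R I a"
    and lift: "invariants_lift I"
  shows "adjoin R I a \<inter> carrier A = adjoin A (I \<inter> carrier A) a"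
proof
  interpret I: ideal I R using I unfolding stable_def by simp
  interpret A: cring A by (rule A_cring)
  have aR: "a \<in> carrier R" using a by simp
  show "adjoin A (I \<inter> carrier A) a \<subseteq> adjoin R I a \<inter> carrier A"
  proof
    fix x assume "x \<in> adjoin A (I \<inter> carrier A) a"
    then obtain i r where "i \<in> I \<inter> carrier A" "r \<in> carrier A" "x = i \<oplus> a \<otimes> r"
      unfolding adjoin_def by auto
    then show "x \<in> adjoin R I a \<inter> carrier A" using adjoinI[of i I r a] a by simp
  qed
  show "adjoin R I a \<inter> carrier A \<subseteq> adjoin A (I \<inter> carrier A) a"
  proof
    fix s assume s: "s \<in> adjoin R I a \<inter> carrier A"
    then have sR: "s \<in> carrier R" by simp
    obtain r where r: "r \<in> carrier R" "s \<ominus> a \<otimes> r \<in> I" using adjoin_iff[OF I.is_ideal aR sR] s by blast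
    have "\<phi> g r \<ominus> r \<in> I" if g: "g \<in> carrier G" for g
    proof -
      have gr: "\<phi> g r \<in> carrier R" using g r(1) by simp
      have "\<phi> g (s \<ominus> a \<otimes> r) = s \<ominus> a \<otimes> \<phi> g r" using g s a r(1) by simp
      then have "s \<ominus> a \<otimes> \<phi> g r \<in> I" using I r(2) g unfolding stable_def by metis
      with r(2) have "(s \<ominus> a \<otimes> r) \<ominus> (s \<ominus> a \<otimes> \<phi> g r) \<in> I" by (rule I.minus_closed)
      moreover have "(s \<ominus> a \<otimes> r) \<ominus> (s \<ominus> a \<otimes> \<phi> g r) = a \<otimes> (\<phi> g r \<ominus> r)" using sR aR r(1) gr by algebra
      ultimately show ?thesis using nz r(1) gr unfolding nonzerodivisor_mod_def by simp
    qed
    then have "cocycle_mod 0 I (\<lambda>_. r)"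
      unfolding cocycle_mod_def cochain_def using r(1) by (auto simp: length_Suc_conv a_minus_def)
    then obtain c where c: "c \<in> carrier A" "r \<ominus> c \<in> I" using lift unfolding invariants_lift_def by blast
    have "s \<ominus> a \<otimes> c = (s \<ominus> a \<otimes> r) \<oplus> a \<otimes> (r \<ominus> c)"
      using sR aR r(1) in_A_carrier[OF c(1)] by algebra
    then have "s \<ominus> a \<otimes> c \<in> I" using r(2) c(2) I.a_closed I.I_l_closed aR by simp
    then have "s \<ominus>\<^bsub>A\<^esub> a \<otimes>\<^bsub>A\<^esub> c \<in> I \<inter> carrier A" using s a c(1) by simp
    then show "s \<in> adjoin A (I \<inter> carrier A) a"
      using A.adjoin_iff[OF contraction_ideal[OF I.is_ideal] a, of s] s c(1) by blast
  qed
qed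

text \<open>In degree \<open>n > 0\<close>, where cocycles modulo \<open>I\<close> are coboundaries, this says that \<open>f\<close> is a coboundary
  modulo \<open>I + a\<close>; in degree \<open>0\<close>, that \<open>f []\<close> is an invariant modulo \<open>I + a\<close>.\<close>

definition liftable :: "nat \<Rightarrow> 'a set \<Rightarrow> 'a \<Rightarrow> ('g list \<Rightarrow> 'a) \<Rightarrow> bool" where
  "liftable n I a f \<longleftrightarrow> (\<exists>z. cocycle_mod n I z \<and> cc n (adjoin R I a) (\<lambda>gs. f gs \<ominus> z gs))"

text \<open>As \<open>a x = cob y\<close> modulo \<open>I\<close>, the connecting map sends the
  class of \<open>y\<close> to that of \<open>x\<close>. If \<open>y\<close> were a cocycle
  \<open>z\<close> plus \<open>a w\<close> modulo \<open>I\<close>, then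
  \<open>a (x - cob w)\<close> would lie in \<open>I\<close> and \<open>x\<close> would be a
  coboundary.\<close>

lemma class_descends:
  assumes I: "stable I" and a: "a \<in> J" and J: "J \<subseteq> carrier A" and nz: "nonzerodivisor_mod R I a"
    and x: "cocycle_mod (Suc n) I x" "\<not> coboundary_mod n I x"
    and Jx: "\<And>b. b \<in> J \<Longrightarrow> coboundary_mod n I (\<lambda>gs. b \<otimes> x gs)"
  obtains y where "cocycle_mod n (adjoin R I a) y" "\<not> liftable n I a y"
    "\<And>b. b \<in> J \<Longrightarrow> liftable n I a (\<lambda>gs. b \<otimes> y gs)"
proof -
  interpret I: ideal I R using I unfolding stable_def by simp
  have aA: "a \<in> carrier A" using a J by blast
  then have aR: "a \<in> carrier R" by simp
  have xc: "cc (Suc n) (carrier R) x" using x(1) unfolding cocycle_mod_def by simp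
  obtain y where y: "cc n (carrier R) y" "cc (Suc n) I (\<lambda>gs. a \<otimes> x gs \<ominus> cob y gs)"
    using Jx[OF a] unfolding coboundary_mod_def by blast
  have c: "x gs \<in> carrier R" "cob y gs \<in> carrier R" "a \<otimes> x gs \<ominus> cob y gs \<in> I"
    if "length gs = Suc n" "set gs \<subseteq> carrier G" for gs
    using cochainD[OF xc that] cochainD[OF cob_closed_G[OF y(1)] that] cochainD[OF y(2) that] by auto
  have "cc (Suc n) (adjoin R I a) (cob y)"
    unfolding cochain_def
  proof (intro allI impI)
    fix gs assume gs: "length gs = Suc n" "set gs \<subseteq> carrier G"
    have "\<ominus> (a \<otimes> x gs \<ominus> cob y gs) \<in> I" using c(3)[OF gs] by (rule I.a_inv_closed)
    moreover have "cob y gs \<ominus> a \<otimes> x gs = \<ominus> (a \<otimes> x gs \<ominus> cob y gs)" using c(1,2)[OF gs] aR by algebra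
    ultimately have "cob y gs \<ominus> a \<otimes> x gs \<in> I" by simp
    then show "cob y gs \<in> adjoin R I a" using adjoin_iff[OF I.is_ideal aR c(2)[OF gs]] c(1)[OF gs] by blast
  qed
  then have Zy: "cocycle_mod n (adjoin R I a) y" using y(1) unfolding cocycle_mod_def by simp
  have "\<not> liftable n I a y"
  proof
    assume "liftable n I a y"
    then obtain z where z: "cocycle_mod n I z" "cc n (adjoin R I a) (\<lambda>gs. y gs \<ominus> z gs)"
      unfolding liftable_def by blast
    have zc: "cc n (carrier R) z" "cc (Suc n) I (cob z)" using z(1) unfolding cocycle_mod_def by auto
    obtain w where w: "cc n (carrier R) w" "cc n I (\<lambda>gs. (y gs \<ominus> z gs) \<ominus> a \<otimes> w gs)"
      using cochain_adjoin[OF I.is_ideal aR z(2)] by blast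
    have "cc (Suc n) I (\<lambda>gs. x gs \<ominus> cob w gs)"
      unfolding cochain_def
    proof (intro allI impI)
      fix gs assume gs: "length gs = Suc n" "set gs \<subseteq> carrier G"
      have cw: "cob w gs \<in> carrier R" "cob z gs \<in> carrier R" "cob z gs \<in> I"
        using cochainD[OF cob_closed_G[OF w(1)] gs] cochainD[OF cob_closed_G[OF zc(1)] gs] cochainD[OF zc(2) gs] by auto
      have "cob (\<lambda>gs. (y gs \<ominus> z gs) \<ominus> a \<otimes> w gs) gs = (cob y gs \<ominus> cob z gs) \<ominus> a \<otimes> cob w gs"
        using cob_diff[OF cochain_diff[OF y(1) zc(1)] cochain_scale[OF aR w(1)] gs]
          cob_diff[OF y(1) zc(1) gs] cob_scale[OF aA w(1) gs] by simp
      then have i: "(cob y gs \<ominus> cob z gs) \<ominus> a \<otimes> cob w gs \<in> I"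
        using cochainD[OF cob_stable[OF I w(2)] gs] by simp
      have "a \<otimes> (x gs \<ominus> cob w gs) = (a \<otimes> x gs \<ominus> cob y gs) \<oplus>
          (((cob y gs \<ominus> cob z gs) \<ominus> a \<otimes> cob w gs) \<oplus> cob z gs)"
        using c(1,2)[OF gs] cw(1,2) aR by algebra
      also have "\<dots> \<in> I" using c(3)[OF gs] i cw(3) by (intro I.a_closed)
      finally show "x gs \<ominus> cob w gs \<in> I" using nz c(1)[OF gs] cw(1) unfolding nonzerodivisor_mod_def by simp
    qed
    then show False using x(2) w(1) unfolding coboundary_mod_def by blast
  qed
  moreover have "liftable n I a (\<lambda>gs. b \<otimes> y gs)" if b: "b \<in> J" for b
  proof -
    have bA: "b \<in> carrier A" using b J by blast
    then have bR: "b \<in> carrier R" by simp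
    obtain u where u: "cc n (carrier R) u" "cc (Suc n) I (\<lambda>gs. b \<otimes> x gs \<ominus> cob u gs)"
      using Jx[OF b] unfolding coboundary_mod_def by blast
    \<comment> \<open>With \<open>cob u = b x\<close> and \<open>cob y = a x\<close> modulo
      \<open>I\<close>, the contributions of \<open>b y\<close> and \<open>a u\<close> to
      \<open>cob z\<close> cancel; and \<open>z\<close> differs from \<open>b y\<close> by a
      multiple of \<open>a\<close> only.\<close>
    define z where "z gs = b \<otimes> y gs \<ominus> a \<otimes> u gs" for gs
    have zc: "cc n (carrier R) z"
      unfolding z_def by (intro cochain_diff cochain_scale bR aR y(1) u(1))
    have "cc (Suc n) I (cob z)"
      unfolding cochain_def
    proof (intro allI impI)
      fix gs assume gs: "length gs = Suc n" "set gs \<subseteq> carrier G"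
      have cu: "cob u gs \<in> carrier R" "b \<otimes> x gs \<ominus> cob u gs \<in> I"
        using cochainD[OF cob_closed_G[OF u(1)] gs] cochainD[OF u(2) gs] by auto
      have "cob z gs = b \<otimes> cob y gs \<ominus> a \<otimes> cob u gs"
        unfolding z_def
        using cob_diff[OF cochain_scale[OF bR y(1)] cochain_scale[OF aR u(1)] gs]
          cob_scale[OF bA y(1) gs] cob_scale[OF aA u(1) gs] by simp
      also have "\<dots> = a \<otimes> (b \<otimes> x gs \<ominus> cob u gs) \<ominus> b \<otimes> (a \<otimes> x gs \<ominus> cob y gs)"
        using c(1,2)[OF gs] cu(1) aR bR by algebra
      also have "\<dots> \<in> I" using cu(2) c(3)[OF gs] aR bR by (intro I.minus_closed[OF I.I_l_closed I.I_l_closed])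
      finally show "cob z gs \<in> I" .
    qed
    moreover have "cc n (adjoin R I a) (\<lambda>gs. b \<otimes> y gs \<ominus> z gs)"
      unfolding cochain_def
    proof (intro allI impI)
      fix gs assume gs: "length gs = n" "set gs \<subseteq> carrier G"
      have uy: "u gs \<in> carrier R" "y gs \<in> carrier R" using cochainD[OF u(1) gs] cochainD[OF y(1) gs] by auto
      have "b \<otimes> y gs \<ominus> z gs = \<zero> \<oplus> a \<otimes> u gs" unfolding z_def using uy aR bR by algebra
      then show "b \<otimes> y gs \<ominus> z gs \<in> adjoin R I a" using adjoinI[OF I.zero_mem uy(1), of a] by simp
    qed
    ultimately show ?thesis using zc unfolding liftable_def cocycle_mod_def by blast
  qed
  ultimately show ?thesis using that Zy by blast
qed

lemma liftable_Suc_iff: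
  assumes I: "stable I" and a: "a \<in> carrier A"
    and van: "\<And>u. cocycle_mod (Suc n) I u \<Longrightarrow> coboundary_mod n I u"
    and f: "cc (Suc n) (carrier R) f"
  shows "liftable (Suc n) I a f \<longleftrightarrow> coboundary_mod n (adjoin R I a) f"
proof
  interpret I: ideal I R using I unfolding stable_def by simp
  have aR: "a \<in> carrier R" using a by simp
  interpret I': ideal "adjoin R I a" R using adjoin_ideal[OF I.is_ideal aR] .
  assume "liftable (Suc n) I a f"
  then obtain z where z: "cocycle_mod (Suc n) I z" "cc (Suc n) (adjoin R I a) (\<lambda>gs. f gs \<ominus> z gs)"
    unfolding liftable_def by blast
  obtain k where k: "cc n (carrier R) k" "cc (Suc n) I (\<lambda>gs. z gs \<ominus> cob k gs)"
    using van[OF z(1)] unfolding coboundary_mod_def by blast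
  have "cc (Suc n) (adjoin R I a) (\<lambda>gs. f gs \<ominus> cob k gs)"
    unfolding cochain_def
  proof (intro allI impI)
    fix gs assume gs: "length gs = Suc n" "set gs \<subseteq> carrier G"
    have c: "f gs \<in> carrier R" "z gs \<in> carrier R" "cob k gs \<in> carrier R"
      using cochainD[OF f gs] z(1) cochainD[OF cob_closed_G[OF k(1)] gs] gs
      unfolding cocycle_mod_def cochain_def by auto
    have "f gs \<ominus> cob k gs = (f gs \<ominus> z gs) \<oplus> (z gs \<ominus> cob k gs)" using c by algebra
    then show "f gs \<ominus> cob k gs \<in> adjoin R I a"
      using cochainD[OF z(2) gs] cochainD[OF k(2) gs] ideal_subset_adjoin[OF I.is_ideal aR] I'.a_closed by auto
  qed
  then show "coboundary_mod n (adjoin R I a) f" using k(1) unfolding coboundary_mod_def by blast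
next
  interpret I: ideal I R using I unfolding stable_def by simp
  assume "coboundary_mod n (adjoin R I a) f"
  then obtain k where k: "cc n (carrier R) k" "cc (Suc n) (adjoin R I a) (\<lambda>gs. f gs \<ominus> cob k gs)"
    unfolding coboundary_mod_def by blast
  have "cocycle_mod (Suc n) I (cob k)"
    unfolding cocycle_mod_def using cob_closed_G[OF k(1)] cob_cob[OF k(1)] I.zero_mem
    by (simp add: cochain_def)
  then show "liftable (Suc n) I a f" using k(2) unfolding liftable_def by blast
qed

text \<open>Dimension shifting along \<open>as\<close> turns a class \<open>x\<close> of degree \<open>n + 1\<close> into an element \<open>y\<close> of \<open>R\<close> that is
  not an invariant modulo \<open>I + as\<close> although \<open>c y\<close> and \<open>e y\<close> are; this contradicts the regularity of the
  sequence in \<open>R\<^sup>G\<close>.\<close>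

theorem no_annihilating_regular_sequence:
  assumes "stable I" and J: "J \<subseteq> carrier A"
    and "length as = Suc n" "set as \<subseteq> J" "c \<in> J" "e \<in> J"
    and "weakly_regular R I (as @ [c, e])" "weakly_regular A (I \<inter> carrier A) (as @ [c, e])"
    and "\<And>j u. j < n \<Longrightarrow> cocycle_mod (Suc j) I u \<Longrightarrow> coboundary_mod j I u"
    and "invariants_lift I"
    and "cocycle_mod (Suc n) I x"
    and "\<And>b. b \<in> J \<Longrightarrow> coboundary_mod n I (\<lambda>gs. b \<otimes> x gs)"
  shows "coboundary_mod n I x"
  using assms(1,3-)
proof (induction n arbitrary: as I x)
  case 0
  show ?case
  proof (rule ccontr)
    assume nx: "\<not> coboundary_mod 0 I x"
    obtain a where as: "as = [a]" using 0(2) by (cases as) auto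
    have aJ: "a \<in> J" using 0(3) as by simp
    have A: "a \<in> carrier A" "c \<in> carrier A" "e \<in> carrier A" using aJ 0(4,5) J by auto
    have nz: "nonzerodivisor_mod R I a" "nonzerodivisor_mod R (adjoin R I a) c"
      using 0(6) as by auto
    interpret I: ideal I R using 0(1) unfolding stable_def by simp
    interpret A: cring A by (rule A_cring)
    define I' where "I' = adjoin R I a"
    interpret I': ideal I' R unfolding I'_def using adjoin_ideal[OF I.is_ideal] A by simp
    have con: "adjoin A (I \<inter> carrier A) a = I' \<inter> carrier A"
      unfolding I'_def using contraction_adjoin[OF 0(1) A(1) nz(1) 0(9)] by simp
    \<comment> \<open>Of the last two elements, \<open>c\<close> is used as a regular element of
      \<open>R\<close> modulo \<open>I'\<close>, and \<open>e\<close> as one of \<open>A\<close>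
      modulo \<open>I'\<close> and \<open>c\<close>.\<close>
    have nzA: "nonzerodivisor_mod A (adjoin A (I' \<inter> carrier A) c) e"
      using 0(7) as con by simp
    have IA: "ideal (I' \<inter> carrier A) A" by (rule contraction_ideal[OF I'.is_ideal])
    have lift_iff: "liftable 0 I a f \<longleftrightarrow> (\<exists>d \<in> carrier A. f [] \<ominus> d \<in> I')" if f: "f [] \<in> carrier R" for f
    proof
      assume "liftable 0 I a f"
      then obtain z where z: "cocycle_mod 0 I z" "f [] \<ominus> z [] \<in> I'"
        unfolding liftable_def I'_def cochain_def by auto
      obtain d where d: "d \<in> carrier A" "z [] \<ominus> d \<in> I" using 0(9) z(1) unfolding invariants_lift_def by blast
      have "z [] \<in> carrier R" using z(1) unfolding cocycle_mod_def cochain_def by simp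
      then have "f [] \<ominus> d = (f [] \<ominus> z []) \<oplus> (z [] \<ominus> d)" using f in_A_carrier[OF d(1)] by algebra
      moreover have "z [] \<ominus> d \<in> I'" using d(2) ideal_subset_adjoin[OF I.is_ideal, of a] A unfolding I'_def by auto
      ultimately have "f [] \<ominus> d \<in> I'" using z(2) I'.a_closed by simp
      then show "\<exists>d \<in> carrier A. f [] \<ominus> d \<in> I'" using d(1) by blast
    next
      assume "\<exists>d \<in> carrier A. f [] \<ominus> d \<in> I'"
      then obtain d where d: "d \<in> carrier A" "f [] \<ominus> d \<in> I'" by blast
      have "cocycle_mod 0 I (\<lambda>_. d)"
        unfolding cocycle_mod_def cochain_def using d(1) I.zero_mem
        by (auto simp: length_Suc_conv a_minus_def r_neg)
      then show "liftable 0 I a f" using d(2) unfolding liftable_def I'_def cochain_def by auto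
    qed
    obtain y where y: "cocycle_mod 0 (adjoin R I a) y" "\<not> liftable 0 I a y"
      "\<And>b. b \<in> J \<Longrightarrow> liftable 0 I a (\<lambda>gs. b \<otimes> y gs)"
      using class_descends[OF 0(1) aJ J nz(1) 0(10) nx 0(11)] by blast
    define z where "z = y []"
    have zR: "z \<in> carrier R" using y(1) unfolding z_def cocycle_mod_def cochain_def by simp
    have cR: "c \<in> carrier R" "e \<in> carrier R" using A by simp_all
    have nz': "\<not> (\<exists>d \<in> carrier A. z \<ominus> d \<in> I')" using y(2) lift_iff[of y] zR unfolding z_def by blast
    obtain u where u: "u \<in> carrier A" "c \<otimes> z \<ominus> u \<in> I'"
      using y(3)[OF 0(4)] lift_iff[of "\<lambda>gs. c \<otimes> y gs"] zR cR unfolding z_def by auto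
    obtain v where v: "v \<in> carrier A" "e \<otimes> z \<ominus> v \<in> I'"
      using y(3)[OF 0(5)] lift_iff[of "\<lambda>gs. e \<otimes> y gs"] zR cR unfolding z_def by auto
    have uvR: "u \<in> carrier R" "v \<in> carrier R" using u v by simp_all
    \<comment> \<open>Both \<open>u / c\<close> and \<open>v / e\<close> represent \<open>z\<close>,
      so \<open>e u = c v\<close> modulo \<open>I'\<close>. Regularity of \<open>e\<close> in
      \<open>A\<close> makes \<open>u\<close> a multiple \<open>c w\<close> with \<open>w\<close>
      invariant, and cancelling \<open>c\<close> in \<open>R\<close> identifies \<open>z\<close>
      with \<open>w\<close> modulo \<open>I'\<close>.\<close>
    have "e \<otimes> u \<ominus> c \<otimes> v = c \<otimes> (e \<otimes> z \<ominus> v) \<ominus> e \<otimes> (c \<otimes> z \<ominus> u)" using uvR cR zR by algebra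
    also have "\<dots> \<in> I'" using u(2) v(2) cR by (intro I'.minus_closed[OF I'.I_l_closed I'.I_l_closed])
    finally have "e \<otimes>\<^bsub>A\<^esub> u \<ominus>\<^bsub>A\<^esub> c \<otimes>\<^bsub>A\<^esub> v \<in> I' \<inter> carrier A" using A u(1) v(1) by simp
    then have "e \<otimes>\<^bsub>A\<^esub> u \<in> adjoin A (I' \<inter> carrier A) c"
      using A.adjoin_iff[OF IA A(2), of "e \<otimes>\<^bsub>A\<^esub> u"] A(3) u(1) v(1) by auto
    then have "u \<in> adjoin A (I' \<inter> carrier A) c"
      using nzA u(1) unfolding nonzerodivisor_mod_def by blast
    then obtain w where w: "w \<in> carrier A" "u \<ominus>\<^bsub>A\<^esub> c \<otimes>\<^bsub>A\<^esub> w \<in> I' \<inter> carrier A"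
      using A.adjoin_iff[OF IA A(2) u(1)] by blast
    then have w': "u \<ominus> c \<otimes> w \<in> I'" using u(1) A by simp
    have wR: "w \<in> carrier R" using w(1) by simp
    have "c \<otimes> (z \<ominus> w) = (c \<otimes> z \<ominus> u) \<oplus> (u \<ominus> c \<otimes> w)" using zR uvR cR wR by algebra
    also have "\<dots> \<in> I'" using u(2) w' by (rule I'.a_closed)
    finally have "z \<ominus> w \<in> I'" using nz(2) zR wR unfolding I'_def nonzerodivisor_mod_def by simp
    then show False using nz' w(1) by blast
  qed
next
  case (Suc n)
  show ?case
  proof (rule ccontr)
    assume nx: "\<not> coboundary_mod (Suc n) I x"
    obtain a as' where as: "as = a # as'" using Suc.prems(2) by (cases as) auto
    have aJ: "a \<in> J" using Suc.prems(3) as by simp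
    have aA: "a \<in> carrier A" using aJ J by auto
    have nz: "nonzerodivisor_mod R I a" using Suc.prems(6) as by auto
    define I' where "I' = adjoin R I a"
    note van = Suc.prems(8)
    obtain y where y: "cocycle_mod (Suc n) I' y" "\<not> liftable (Suc n) I a y"
      "\<And>b. b \<in> J \<Longrightarrow> liftable (Suc n) I a (\<lambda>gs. b \<otimes> y gs)"
      using class_descends[OF Suc.prems(1) aJ J nz Suc.prems(10) nx Suc.prems(11)] unfolding I'_def by blast
    have yc: "cc (Suc n) (carrier R) y" using y(1) unfolding cocycle_mod_def by simp
    have lift_iff: "liftable (Suc n) I a f \<longleftrightarrow> coboundary_mod n I' f" if "cc (Suc n) (carrier R) f" for f
      unfolding I'_def using liftable_Suc_iff[OF Suc.prems(1) aA _ that] van[of n] by simp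
    have "coboundary_mod n I' y"
    proof (rule Suc.IH[of I' as'])
      show "stable I'" unfolding I'_def by (rule stable_adjoin[OF Suc.prems(1) aA])
      show "weakly_regular R I' (as' @ [c, e])" using Suc.prems(6) as unfolding I'_def by simp
      have "I' \<inter> carrier A = adjoin A (I \<inter> carrier A) a"
        unfolding I'_def by (rule contraction_adjoin[OF Suc.prems(1) aA nz Suc.prems(9)])
      then show "weakly_regular A (I' \<inter> carrier A) (as' @ [c, e])" using Suc.prems(7) as by simp
      \<comment> \<open>Degrees \<open>j + 1\<close> and \<open>j + 2\<close> modulo
        \<open>I\<close> are needed here, and both are covered since \<open>j < n\<close>.\<close>
      show "coboundary_mod j I' u" if "j < n" "cocycle_mod (Suc j) I' u" for j u
        using vanishing_adjoin[OF Suc.prems(1) aA nz _ _ that(2)[unfolded I'_def]] van that(1)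
        unfolding I'_def by auto
      show "invariants_lift I'"
        unfolding I'_def using invariants_lift_adjoin[OF Suc.prems(1) aA nz _ Suc.prems(9)] van[of 0] by simp
      show "coboundary_mod n I' (\<lambda>gs. b \<otimes> y gs)" if "b \<in> J" for b
        using y(3)[OF that] lift_iff[OF cochain_scale[OF _ yc], of b] that J by auto
    qed (use Suc.prems(2-5) as y(1) in auto)
    then show False using lift_iff[OF yc] y(2) by blast
  qed
qed

text \<open>By unmixedness, the maximal associated primes of the quotient by \<open>k < n\<close>
  elements have height at most \<open>k\<close>, in either ring, so none of them contains
  \<open>J\<close>.\<close>

lemma exists_regular_sequence:
  assumes CM: "cohen_macaulay R" "cohen_macaulay A" and J: "ideal J A"
    and hA: "\<And>p. primeideal p A \<Longrightarrow> J \<subseteq> p \<Longrightarrow> enat n \<le> prime_height A p"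
    and hR: "\<And>q. primeideal q R \<Longrightarrow> J \<subseteq> q \<Longrightarrow> enat n \<le> prime_height R q"
  shows "k \<le> n \<Longrightarrow> \<exists>as. length as = k \<and> set as \<subseteq> J \<and>
    weakly_regular R {\<zero>} as \<and> weakly_regular A {\<zero>} as"
proof (induction k)
  case 0
  then show ?case by (intro exI[of _ "[]"]) simp
next
  case (Suc k)
  interpret A: noetherian_cring A
    using CM(2) unfolding cohen_macaulay_def noetherian_cring_def by simp
  interpret R: noetherian_cring R
    using CM(1) unfolding cohen_macaulay_def noetherian_cring_def by simp
  interpret J: ideal J A by fact
  obtain as where as: "length as = k" "set as \<subseteq> J" "weakly_regular R {\<zero>} as" "weakly_regular A {\<zero>} as"
    using Suc by auto
  have asA: "set as \<subseteq> carrier A" using as(2) J.Icarr by blast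
  then have asR: "set as \<subseteq> carrier R" using in_A_carrier by blast
  define IR where "IR = foldl (adjoin R) {\<zero>} as"
  define IA where "IA = foldl (adjoin A) {\<zero>} as"
  have IR: "ideal IR R" unfolding IR_def using zeroideal asR by (rule foldl_adjoin_ideal)
  have IA: "ideal IA A" unfolding IA_def using A.zeroideal asA A.foldl_adjoin_ideal by simp
  \<comment> \<open>The primes of \<open>R\<close> are contracted to \<open>A\<close>, so that a
    single prime avoidance inside \<open>J\<close> makes the new element regular in both
    rings.\<close>
  define Q where "Q = A.zero_divisor_primes IA \<union> (\<lambda>q. q \<inter> carrier A) ` zero_divisor_primes IR"
  have "\<exists>a \<in> J. \<forall>q \<in> Q. a \<notin> q"
  proof (rule A.prime_avoidance)
    show "finite Q"
      unfolding Q_def using A.finite_zero_divisor_primes[OF IA] R.finite_zero_divisor_primes[OF IR] by simp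
    show "ideal J A" by fact
    show "primeideal q A" if "q \<in> Q" for q
      using that A.zero_divisor_primes_prime[OF IA] contraction_prime zero_divisor_primes_prime[OF IR]
      unfolding Q_def by blast
    fix q assume "q \<in> Q"
    then consider "q \<in> A.zero_divisor_primes IA" | q' where "q' \<in> zero_divisor_primes IR" "q = q' \<inter> carrier A"
      unfolding Q_def by blast
    then show "\<not> J \<subseteq> q"
    proof cases
      case 1
      then have pr: "primeideal q A" by (rule A.zero_divisor_primes_prime[OF IA])
      obtain z where z: "z \<in> carrier A" "z \<notin> IA" "q = {a \<in> carrier A. a \<otimes>\<^bsub>A\<^esub> z \<in> IA}"
        using 1 unfolding A.zero_divisor_primes_def by blast
      have "prime_height A q \<le> enat (length as)"
        using A.cohen_macaulay_height_le[OF CM(2) pr asA _ z(1)] z(2,3) as(4) unfolding IA_def by simp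
      also have "\<dots> < enat n" using as(1) Suc.prems by simp
      finally show ?thesis using hA[OF pr] by auto
    next
      case 2
      then have pr: "primeideal q' R" by (intro zero_divisor_primes_prime[OF IR])
      obtain z where z: "z \<in> carrier R" "z \<notin> IR" "q' = {a \<in> carrier R. a \<otimes> z \<in> IR}"
        using 2(1) unfolding zero_divisor_primes_def by blast
      have "prime_height R q' \<le> enat (length as)"
        using cohen_macaulay_height_le[OF CM(1) pr asR as(3) z(1)] z(2,3) unfolding IR_def by simp
      also have "\<dots> < enat n" using as(1) Suc.prems by simp
      finally show ?thesis using hR[OF pr] 2(2) by auto
    qed
  qed
  then obtain a where a: "a \<in> J" "\<And>q. q \<in> Q \<Longrightarrow> a \<notin> q" by blast
  have aA: "a \<in> carrier A" using a(1) J.Icarr by blast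
  have nzA: "nonzerodivisor_mod A IA a"
    unfolding nonzerodivisor_mod_def
    using A.zero_divisor_in_prime[OF IA _ _ aA] a(2) unfolding Q_def by blast
  have nzR: "nonzerodivisor_mod R IR a"
    unfolding nonzerodivisor_mod_def
  proof (intro ballI impI, rule ccontr)
    fix r assume r: "r \<in> carrier R" "a \<otimes> r \<in> IR" "r \<notin> IR"
    then obtain q where "q \<in> zero_divisor_primes IR" "a \<in> q"
      using R.zero_divisor_in_prime[OF IR r(1,3) in_A_carrier[OF aA] r(2)] by blast
    then show False using a(2)[of "q \<inter> carrier A"] aA unfolding Q_def by blast
  qed
  show ?case
    using as a(1) nzA nzR unfolding IA_def IR_def
    by (intro exI[of _ "as @ [a]"]) (simp add: weakly_regular_append)
qed

end

section \<open>The annihilator of a class\<close>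

context finite_ring_action
begin

lemma cob_zero: "gs \<noteq> [] \<Longrightarrow> set gs \<subseteq> carrier G \<Longrightarrow> cob (\<lambda>_. \<zero>) gs = \<zero>"
proof -
  have "faces (\<lambda>_. \<zero>) gs = \<zero>" for gs
    by (induction "\<lambda>_ :: 'g list. \<zero>" gs rule: faces.induct) (simp_all add: a_minus_def)
  then show "gs \<noteq> [] \<Longrightarrow> set gs \<subseteq> carrier G \<Longrightarrow> cob (\<lambda>_. \<zero>) gs = \<zero>"
    by (cases gs) auto
qed

text \<open>The sum is written as \<open>f - (0 - k)\<close> so that its additivity is two
  applications of \<open>cob_diff_on\<close>.\<close>

lemma cob_add_on:
  assumes S: "subgroup S G" and f: "cochain S n (carrier R) f" and k: "cochain S n (carrier R) k"
    and gs: "length gs = Suc n" "set gs \<subseteq> S"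
  shows "cob (\<lambda>gs. f gs \<ominus> (\<zero> \<ominus> k gs)) gs = cob f gs \<oplus> cob k gs"
proof -
  have z: "cochain S n (carrier R) (\<lambda>_. \<zero>)" unfolding cochain_def by simp
  have k': "cochain S n (carrier R) (\<lambda>gs. \<zero> \<ominus> k gs)" using k unfolding cochain_def by simp
  have "cob (\<lambda>_. \<zero>) gs = \<zero>" using gs subgroup.subset[OF S] by (intro cob_zero) auto
  moreover have "cob f gs \<in> carrier R" "cob k gs \<in> carrier R"
    using cochainD[OF cob_closed[OF S f] gs] cochainD[OF cob_closed[OF S k] gs] by auto
  ultimately show ?thesis
    using cob_diff_on[OF S f k' gs] cob_diff_on[OF S z k gs] by (simp add: a_minus_def)
qed

section \<open>Comparison with extensional cochains and cohomology classes\<close>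

lemma faces_cong:
  assumes "subgroup S G" "\<And>gs. length gs = n \<Longrightarrow> set gs \<subseteq> S \<Longrightarrow> f gs = k gs"
    "length gs = Suc n" "set gs \<subseteq> S"
  shows "faces f gs = faces k gs"
  using assms(2-)
proof (induction f gs arbitrary: k n rule: faces.induct)
  case (3 f g h gs)
  then obtain m where m: "n = Suc m" by (cases n) auto
  have S: "g \<in> S" "set (h # gs) \<subseteq> S" "length (h # gs) = Suc m" using 3 m by auto
  have "faces (\<lambda>ys. f (g # ys)) (h # gs) = faces (\<lambda>ys. k (g # ys)) (h # gs)"
    using 3(2) S m by (intro 3(1)[of m]) auto
  moreover have "f ((g \<otimes>\<^bsub>G\<^esub> h) # gs) = k ((g \<otimes>\<^bsub>G\<^esub> h) # gs)"
    using S m subgroup.m_closed[OF assms(1)] by (intro 3(2)) auto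
  ultimately show ?case by simp
qed simp_all

lemma cob_cong:
  assumes "subgroup S G" "\<And>gs. length gs = n \<Longrightarrow> set gs \<subseteq> S \<Longrightarrow> f gs = k gs"
    "length gs = Suc n" "set gs \<subseteq> S"
  shows "cob f gs = cob k gs"
  using faces_cong[OF assms] assms(2)[of "tl gs"] assms(3,4) by (cases gs) auto

abbreviation on where "on S \<equiv> G\<lparr>carrier := S\<rparr>"

lemma tuples_on: "gs \<in> tuples (on S) n \<longleftrightarrow> length gs = n \<and> set gs \<subseteq> S"
  unfolding tuples_def by simp

lemma coboundaries_iff:
  assumes S: "subgroup S G"
  shows "f \<in> coboundaries (on S) R \<phi> (Suc m) \<longleftrightarrow>
    (\<exists>k. cochain S m (carrier R) k \<and> f = restrict (cob k) (tuples (on S) (Suc m)))"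
proof
  assume "f \<in> coboundaries (on S) R \<phi> (Suc m)"
  then obtain k where k: "k \<in> tuples (on S) m \<rightarrow>\<^sub>E carrier R" "f = coboundary (on S) R \<phi> m k"
    unfolding coboundaries.simps cochains_def by auto
  have kc: "cochain S m (carrier R) k"
    unfolding cochain_def using k(1) tuples_on[of _ S m] by (auto simp: PiE_iff)
  have "f gs = restrict (cob k) (tuples (on S) (Suc m)) gs" for gs
  proof (cases "gs \<in> tuples (on S) (Suc m)")
    case True
    then show ?thesis using coboundary_eq_cob[OF S kc] k(2) tuples_on by auto
  next
    case False
    then show ?thesis unfolding k(2) coboundary_def by simp
  qed
  then show "\<exists>k. cochain S m (carrier R) k \<and> f = restrict (cob k) (tuples (on S) (Suc m))"
    using kc by blast
next
  assume "\<exists>k. cochain S m (carrier R) k \<and> f = restrict (cob k) (tuples (on S) (Suc m))"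
  then obtain k where k: "cochain S m (carrier R) k" "f = restrict (cob k) (tuples (on S) (Suc m))" by blast
  \<comment> \<open>Members of \<open>cochains\<close> are extensional, whereas \<open>k\<close> is
    arbitrary off the tuples; the restriction has the same \<open>cob\<close> on tuples.\<close>
  define l where "l = restrict k (tuples (on S) m)"
  have lE: "l \<in> carrier (cochains (on S) R m)"
    unfolding l_def cochains_def using k(1) tuples_on by (auto simp: cochain_def)
  have lk: "l gs = k gs" if "length gs = m" "set gs \<subseteq> S" for gs
    unfolding l_def using that tuples_on by simp
  have lc: "cochain S m (carrier R) l" using k(1) lk unfolding cochain_def by simp
  have "f gs = coboundary (on S) R \<phi> m l gs" for gs
  proof (cases "gs \<in> tuples (on S) (Suc m)")
    case True
    then have gs: "length gs = Suc m" "set gs \<subseteq> S" using tuples_on by auto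
    have "f gs = cob k gs" using k(2) True by simp
    also have "\<dots> = cob l gs" using cob_cong[OF S lk gs] by simp
    finally show ?thesis using coboundary_eq_cob[OF S lc gs] by simp
  next
    case False
    then show ?thesis unfolding k(2) coboundary_def by simp
  qed
  then have "f = coboundary (on S) R \<phi> m l" by blast
  then show "f \<in> coboundaries (on S) R \<phi> (Suc m)" using lE by simp
qed

lemma coboundaries_eq:
  assumes "subgroup S G"
  shows "coboundaries (on S) R \<phi> (Suc m) =
    (\<lambda>k. restrict (cob k) (tuples (on S) (Suc m))) ` {k. cochain S m (carrier R) k}"
  using coboundaries_iff[OF assms, of _ m] by blast

lemma restrict_add:
  "(\<lambda>gs\<in>T. restrict f T gs \<oplus> g gs) = (\<lambda>gs\<in>T. f gs \<oplus> g gs)"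
  "(\<lambda>gs\<in>T. f gs \<oplus> restrict g T gs) = (\<lambda>gs\<in>T. f gs \<oplus> g gs)"
  by (intro restrict_ext; simp)+

lemma cocycles_iff:
  "f \<in> cocycles G R \<phi> n \<longleftrightarrow> f \<in> tuples G n \<rightarrow>\<^sub>E carrier R \<and> cocycle_mod n {\<zero>} f"
proof (cases "f \<in> tuples G n \<rightarrow>\<^sub>E carrier R")
  case True
  have fc: "cc n (carrier R) f"
    unfolding cochain_def using True by (auto simp: PiE_iff tuples_def)
  have eq: "coboundary G R \<phi> n f gs = cob f gs" if "length gs = Suc n" "set gs \<subseteq> carrier G" for gs
    using coboundary_eq_cob[OF G.subgroup_self fc that] by simp
  have "coboundary G R \<phi> n f = (\<lambda>gs\<in>tuples G (Suc n). \<zero>) \<longleftrightarrow> (\<forall>gs \<in> tuples G (Suc n). coboundary G R \<phi> n f gs = \<zero>)"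
    unfolding coboundary_def by (auto simp: fun_eq_iff restrict_def)
  also have "\<dots> \<longleftrightarrow> cc (Suc n) {\<zero>} (cob f)" unfolding cochain_def using eq by (auto simp: tuples_def)
  finally show ?thesis
    using True fc unfolding cocycles_def kernel_def cocycle_mod_def cochains_def by simp
next
  case False
  then show ?thesis unfolding cocycles_def kernel_def cochains_def by simp
qed

lemma minus_zero_iff: "x \<in> carrier R \<Longrightarrow> y \<in> carrier R \<Longrightarrow> x \<ominus> y \<in> {\<zero>} \<longleftrightarrow> x = y"
  by (auto simp: a_minus_def r_neg minus_equality dest: sum_zero_eq_neg)

lemma coboundary_mod_zero_iff:
  assumes "cc (Suc n) (carrier R) f"
  shows "coboundary_mod n {\<zero>} f \<longleftrightarrow>
    (\<exists>k. cc n (carrier R) k \<and> (\<forall>gs. length gs = Suc n \<longrightarrow> set gs \<subseteq> carrier G \<longrightarrow> f gs = cob k gs))"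
proof -
  have "cc (Suc n) {\<zero>} (\<lambda>gs. f gs \<ominus> cob k gs) \<longleftrightarrow>
      (\<forall>gs. length gs = Suc n \<longrightarrow> set gs \<subseteq> carrier G \<longrightarrow> f gs = cob k gs)"
    if k: "cc n (carrier R) k" for k
    unfolding cochain_def
    using minus_zero_iff cochainD[OF assms] cochainD[OF cob_closed_G[OF k]] by blast
  then show ?thesis unfolding coboundary_mod_def by blast
qed

abbreviation coset where
  "coset n f \<equiv> coboundaries G R \<phi> n #>\<^bsub>(cochains G R n)\<lparr>carrier := cocycles G R \<phi> n\<rparr>\<^esub> f"

lemma carrier_cohomology: "carrier (cohomology G R \<phi> n) = coset n ` cocycles G R \<phi> n"
  and one_cohomology: "\<one>\<^bsub>cohomology G R \<phi> n\<^esub> = coboundaries G R \<phi> n"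
  unfolding cohomology_def FactGroup_def RCOSETS_def by auto

lemma mem_coset_iff:
  "x \<in> coset (Suc n) f \<longleftrightarrow>
    (\<exists>k. cc n (carrier R) k \<and> x = (\<lambda>gs\<in>tuples G (Suc n). cob k gs \<oplus> f gs))"
proof -
  have "x \<in> coset (Suc n) f \<longleftrightarrow> (\<exists>b \<in> coboundaries G R \<phi> (Suc n). x = (\<lambda>gs\<in>tuples G (Suc n). b gs \<oplus> f gs))"
    unfolding r_coset_def by (auto simp: cochains_def simp del: coboundaries.simps)
  also have "\<dots> \<longleftrightarrow> (\<exists>k. cc n (carrier R) k \<and> x = (\<lambda>gs\<in>tuples G (Suc n). cob k gs \<oplus> f gs))"
    using coboundaries_eq[OF G.subgroup_self, of n] by (simp add: restrict_add del: coboundaries.simps restrict_apply)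
  finally show ?thesis .
qed

lemma self_in_coset:
  assumes "f \<in> cocycles G R \<phi> (Suc n)"
  shows "f \<in> coset (Suc n) f"
  unfolding mem_coset_iff
proof (intro exI conjI)
  show "cc n (carrier R) (\<lambda>_. \<zero>)" unfolding cochain_def by simp
  have f: "f \<in> tuples G (Suc n) \<rightarrow>\<^sub>E carrier R" using assms cocycles_iff by blast
  show "f = (\<lambda>gs\<in>tuples G (Suc n). cob (\<lambda>_. \<zero>) gs \<oplus> f gs)"
  proof
    fix gs
    show "f gs = (\<lambda>gs\<in>tuples G (Suc n). cob (\<lambda>_. \<zero>) gs \<oplus> f gs) gs"
    proof (cases "gs \<in> tuples G (Suc n)")
      case True
      then have "cob (\<lambda>_. \<zero>) gs = \<zero>" by (intro cob_zero) (auto simp: tuples_def)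
      then show ?thesis using True PiE_mem[OF f True] by simp
    next
      case False
      then show ?thesis using PiE_arb[OF f] by simp
    qed
  qed
qed

lemma coset_eq:
  assumes f: "f \<in> cocycles G R \<phi> (Suc n)" and g: "g \<in> cocycles G R \<phi> (Suc n)"
    and fg: "coboundary_mod n {\<zero>} (\<lambda>gs. f gs \<ominus> g gs)"
  shows "coset (Suc n) f = coset (Suc n) g"
proof -
  have c: "cc (Suc n) (carrier R) f" "cc (Suc n) (carrier R) g"
    using f g unfolding cocycles_iff cocycle_mod_def by auto
  obtain l where l: "cc n (carrier R) l"
    "\<And>gs. length gs = Suc n \<Longrightarrow> set gs \<subseteq> carrier G \<Longrightarrow> f gs \<ominus> g gs = cob l gs"
    using fg unfolding coboundary_mod_zero_iff[OF cochain_diff[OF c]] by blast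
  have l': "cc n (carrier R) (\<lambda>gs. \<zero> \<ominus> l gs)" using l(1) unfolding cochain_def by simp
  have in_R: "f gs \<in> carrier R" "g gs \<in> carrier R" "cob k gs \<in> carrier R"
    if "gs \<in> tuples G (Suc n)" "cc n (carrier R) k" for gs k
    using that cochainD[OF c(1)] cochainD[OF c(2)] cochainD[OF cob_closed_G] by (auto simp: tuples_def)
  show ?thesis
  proof (intro subset_antisym subsetI)
    fix x assume "x \<in> coset (Suc n) f"
    then obtain k where k: "cc n (carrier R) k" "x = (\<lambda>gs\<in>tuples G (Suc n). cob k gs \<oplus> f gs)"
      unfolding mem_coset_iff by blast
    have "x = (\<lambda>gs\<in>tuples G (Suc n). cob (\<lambda>gs. k gs \<ominus> (\<zero> \<ominus> l gs)) gs \<oplus> g gs)"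
      unfolding k(2)
    proof (intro restrict_ext)
      fix gs assume gs: "gs \<in> tuples G (Suc n)"
      have "cob (\<lambda>gs. k gs \<ominus> (\<zero> \<ominus> l gs)) gs = cob k gs \<oplus> (f gs \<ominus> g gs)"
        using cob_add_on[OF G.subgroup_self k(1) l(1), of gs] l(2) gs by (simp add: tuples_def)
      then show "cob k gs \<oplus> f gs = cob (\<lambda>gs. k gs \<ominus> (\<zero> \<ominus> l gs)) gs \<oplus> g gs"
        using in_R[OF gs k(1)] by algebra
    qed
    then show "x \<in> coset (Suc n) g" unfolding mem_coset_iff using cochain_diff[OF k(1) l'] by blast
  next
    fix x assume "x \<in> coset (Suc n) g"
    then obtain k where k: "cc n (carrier R) k" "x = (\<lambda>gs\<in>tuples G (Suc n). cob k gs \<oplus> g gs)"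
      unfolding mem_coset_iff by blast
    have "x = (\<lambda>gs\<in>tuples G (Suc n). cob (\<lambda>gs. k gs \<ominus> l gs) gs \<oplus> f gs)"
      unfolding k(2)
    proof (intro restrict_ext)
      fix gs assume gs: "gs \<in> tuples G (Suc n)"
      have "cob (\<lambda>gs. k gs \<ominus> l gs) gs = cob k gs \<ominus> (f gs \<ominus> g gs)"
        using cob_diff[OF k(1) l(1), of gs] l(2) gs by (simp add: tuples_def)
      then show "cob k gs \<oplus> g gs = cob (\<lambda>gs. k gs \<ominus> l gs) gs \<oplus> f gs"
        using in_R[OF gs k(1)] by algebra
    qed
    then show "x \<in> coset (Suc n) f" unfolding mem_coset_iff using cochain_diff[OF k(1) l(1)] by blast
  qed
qed

text \<open>The form in which the minimality of \<open>\<mu>\<close> enters the dimension shift: a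
  statement about a factor group becomes one about cochains that need not be extensional.\<close>

lemma trivial_cohomology:
  assumes triv: "carrier (cohomology G R \<phi> (Suc n)) = {\<one>\<^bsub>cohomology G R \<phi> (Suc n)\<^esub>}"
    and u: "cocycle_mod (Suc n) {\<zero>} u"
  shows "coboundary_mod n {\<zero>} u"
proof -
  define f where "f = restrict u (tuples G (Suc n))"
  have uc: "cc (Suc n) (carrier R) u" "cc (Suc (Suc n)) {\<zero>} (cob u)" using u unfolding cocycle_mod_def by auto
  have fu: "f gs = u gs" if "length gs = Suc n" "set gs \<subseteq> carrier G" for gs
    unfolding f_def using that by (simp add: tuples_def)
  have fc: "cc (Suc n) (carrier R) f" using uc(1) fu unfolding cochain_def by simp
  have "cc (Suc (Suc n)) {\<zero>} (cob f)"
    using uc(2) cob_cong[OF G.subgroup_self fu] unfolding cochain_def by simp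
  then have "cocycle_mod (Suc n) {\<zero>} f" using fc unfolding cocycle_mod_def by blast
  moreover have "f \<in> tuples G (Suc n) \<rightarrow>\<^sub>E carrier R"
    unfolding f_def using uc(1) by (auto simp: cochain_def tuples_def)
  ultimately have fZ: "f \<in> cocycles G R \<phi> (Suc n)" using cocycles_iff by blast
  then have "coset (Suc n) f \<in> carrier (cohomology G R \<phi> (Suc n))" unfolding carrier_cohomology by (rule imageI)
  then have "coset (Suc n) f = coboundaries G R \<phi> (Suc n)" unfolding triv one_cohomology by simp
  then have "f \<in> coboundaries (on (carrier G)) R \<phi> (Suc n)" using self_in_coset[OF fZ] by simp
  then obtain k where k: "cc n (carrier R) k" "f = restrict (cob k) (tuples (on (carrier G)) (Suc n))"
    unfolding coboundaries_iff[OF G.subgroup_self] by blast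
  then have "u gs = cob k gs" if "length gs = Suc n" "set gs \<subseteq> carrier G" for gs
    using fu[OF that] that by (simp add: tuples_def)
  then show ?thesis using k(1) unfolding coboundary_mod_zero_iff[OF uc(1)] by blast
qed

text \<open>Representatives are compared directly, without a group structure on the target. The
  representative of the second class supplied by the equality differs from \<open>g\<close> by some
  \<open>cob l\<close> on \<open>G\<close>, whose restriction to \<open>H\<close> is absorbed into
  the coboundary.\<close>

lemma restriction_agrees:
  assumes f: "f \<in> cocycles G R \<phi> (Suc n)" and g: "g \<in> cocycles G R \<phi> (Suc n)"
    and H: "subgroup H G"
    and eq: "res G R \<phi> (Suc n) H (coset (Suc n) f) = res G R \<phi> (Suc n) H (coset (Suc n) g)"
  shows "\<exists>k. cochain H n (carrier R) k \<and>
    (\<forall>gs. length gs = Suc n \<longrightarrow> set gs \<subseteq> H \<longrightarrow> f gs \<ominus> g gs = cob k gs)"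
proof -
  have HG: "H \<subseteq> carrier G" using subgroup.subset[OF H] .
  let ?r = "\<lambda>f. restrict f (tuples (on H) (Suc n))"
  have res_iff: "x \<in> res G R \<phi> (Suc n) H C \<longleftrightarrow>
      (\<exists>k. cochain H n (carrier R) k \<and> (\<exists>c \<in> C. x = (\<lambda>gs\<in>tuples (on H) (Suc n). cob k gs \<oplus> c gs)))" for x C
  proof -
    have "x \<in> res G R \<phi> (Suc n) H C \<longleftrightarrow> (\<exists>b \<in> coboundaries (on H) R \<phi> (Suc n).
        \<exists>c \<in> C. x = (\<lambda>gs\<in>tuples (on H) (Suc n). b gs \<oplus> ?r c gs))"
      unfolding res_def set_mult_def by (auto simp: cochains_def simp del: coboundaries.simps)
    also have "\<dots> \<longleftrightarrow> (\<exists>k. cochain H n (carrier R) k \<and>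
        (\<exists>c \<in> C. x = (\<lambda>gs\<in>tuples (on H) (Suc n). cob k gs \<oplus> c gs)))"
      using coboundaries_eq[OF H, of n] by (simp add: restrict_add del: coboundaries.simps restrict_apply)
    finally show ?thesis .
  qed
  have c: "cc (Suc n) (carrier R) f" "cc (Suc n) (carrier R) g"
    using f g unfolding cocycles_iff cocycle_mod_def by auto
  have z: "cochain H n (carrier R) (\<lambda>_. \<zero>)" unfolding cochain_def by simp
  have "(\<lambda>gs\<in>tuples (on H) (Suc n). cob (\<lambda>_. \<zero>) gs \<oplus> f gs) \<in> res G R \<phi> (Suc n) H (coset (Suc n) f)"
    unfolding res_iff using z self_in_coset[OF f] by blast
  then obtain k d where k: "cochain H n (carrier R) k" "d \<in> coset (Suc n) g"
    "(\<lambda>gs\<in>tuples (on H) (Suc n). cob (\<lambda>_. \<zero>) gs \<oplus> f gs) = (\<lambda>gs\<in>tuples (on H) (Suc n). cob k gs \<oplus> d gs)"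
    unfolding eq res_iff by blast
  obtain l where l: "cc n (carrier R) l" "d = (\<lambda>gs\<in>tuples G (Suc n). cob l gs \<oplus> g gs)"
    using k(2) unfolding mem_coset_iff by blast
  have lH: "cochain H n (carrier R) l" using l(1) HG by (rule cochain_subset)
  have "f gs \<ominus> g gs = cob (\<lambda>gs. k gs \<ominus> (\<zero> \<ominus> l gs)) gs" if gs: "length gs = Suc n" "set gs \<subseteq> H" for gs
  proof -
    have gsG: "set gs \<subseteq> carrier G" using gs HG by blast
    have r: "f gs \<in> carrier R" "g gs \<in> carrier R" "cob k gs \<in> carrier R" "cob l gs \<in> carrier R"
      using cochainD[OF c(1) gs(1) gsG] cochainD[OF c(2) gs(1) gsG] cochainD[OF cob_closed[OF H k(1)] gs]
        cochainD[OF cob_closed[OF H lH] gs] by auto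
    have "cob (\<lambda>_. \<zero>) gs = \<zero>" using gs gsG by (intro cob_zero) auto
    then have "f gs = cob k gs \<oplus> (cob l gs \<oplus> g gs)"
      using fun_cong[OF k(3), of gs] gs gsG r unfolding l(2) by (simp add: tuples_def)
    then have "f gs \<ominus> g gs = cob k gs \<oplus> cob l gs" using r by algebra
    then show ?thesis using cob_add_on[OF H k(1) lH gs] by simp
  qed
  moreover have "cochain H n (carrier R) (\<lambda>gs. k gs \<ominus> (\<zero> \<ominus> l gs))"
    using k(1) lH unfolding cochain_def by simp
  ultimately show ?thesis by blast
qed

section \<open>Traces in the annihilator of a class and the height of that ideal\<close>

lemma trace_invariant:
  assumes H: "subgroup H G" and T: "G.transversal H T" and r: "r \<in> carrier R" "\<And>h. h \<in> H \<Longrightarrow> \<phi> h r = r"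
  shows "(\<Oplus>t\<in>T. \<phi> t r) \<in> carrier A"
  unfolding carrier_A
proof (intro CollectI conjI ballI)
  have TG: "T \<subseteq> carrier G" using T unfolding G.transversal_def by blast
  have HG: "H \<subseteq> carrier G" using subgroup.subset[OF H] .
  show "(\<Oplus>t\<in>T. \<phi> t r) \<in> carrier R" using r(1) TG by (intro finsum_closed) auto
  fix g assume g: "g \<in> carrier G"
  have "\<phi> g (\<Oplus>t\<in>T. \<phi> t r) = (\<Oplus>t\<in>T. \<phi> (g \<otimes>\<^bsub>G\<^esub> t) r)"
    using g r(1) TG by (subst act_finsum) (auto intro!: finsum_cong' simp: act_comp)
  also have "\<dots> = (\<Oplus>t\<in>T. \<phi> t r)"
    using r HG by (intro transversal_finsum[OF H T g]) (auto simp: act_comp subset_iff)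
  finally show "\<phi> g (\<Oplus>t\<in>T. \<phi> t r) = (\<Oplus>t\<in>T. \<phi> t r)" .
qed

definition annihilator :: "nat \<Rightarrow> ('g list \<Rightarrow> 'a) \<Rightarrow> 'a set" where
  "annihilator n f = {a \<in> carrier A. coboundary_mod n {\<zero>} (\<lambda>gs. a \<otimes> f gs)}"

lemma annihilator_iff:
  assumes f: "cc (Suc n) (carrier R) f"
  shows "a \<in> annihilator n f \<longleftrightarrow> a \<in> carrier A \<and>
    (\<exists>k. cc n (carrier R) k \<and> (\<forall>gs. length gs = Suc n \<longrightarrow> set gs \<subseteq> carrier G \<longrightarrow> a \<otimes> f gs = cob k gs))"
  unfolding annihilator_def using coboundary_mod_zero_iff[OF cochain_scale[OF in_A_carrier f]] by blast

lemma annihilator_ideal_A: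
  assumes f: "cc (Suc n) (carrier R) f"
  shows "ideal (annihilator n f) A"
proof -
  interpret A: cring A by (rule A_cring)
  have fR: "f gs \<in> carrier R" if "length gs = Suc n" "set gs \<subseteq> carrier G" for gs using cochainD[OF f that] .
  show ?thesis
  proof (rule A.ideal_if_closed)
    show "annihilator n f \<subseteq> carrier A" unfolding annihilator_def by blast
    have "cc n (carrier R) (\<lambda>_. \<zero>)" unfolding cochain_def by simp
    moreover have "\<zero> \<otimes> f gs = cob (\<lambda>_. \<zero>) gs" if "length gs = Suc n" "set gs \<subseteq> carrier G" for gs
    proof -
      have "gs \<noteq> []" using that(1) by auto
      then show ?thesis using fR[OF that] cob_zero[of gs] that(2) by simp
    qed
    ultimately show "\<zero>\<^bsub>A\<^esub> \<in> annihilator n f" unfolding annihilator_iff[OF f] by auto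
    fix x assume "x \<in> annihilator n f"
    then obtain k where x: "x \<in> carrier A" "cc n (carrier R) k"
      "\<And>gs. length gs = Suc n \<Longrightarrow> set gs \<subseteq> carrier G \<Longrightarrow> x \<otimes> f gs = cob k gs"
      unfolding annihilator_iff[OF f] by blast
    {
      fix y assume "y \<in> annihilator n f"
      then obtain l where y: "y \<in> carrier A" "cc n (carrier R) l"
        "\<And>gs. length gs = Suc n \<Longrightarrow> set gs \<subseteq> carrier G \<Longrightarrow> y \<otimes> f gs = cob l gs"
        unfolding annihilator_iff[OF f] by blast
      have "cc n (carrier R) (\<lambda>gs. k gs \<ominus> (\<zero> \<ominus> l gs))" using x(2) y(2) unfolding cochain_def by simp
      moreover have "(x \<oplus> y) \<otimes> f gs = cob (\<lambda>gs. k gs \<ominus> (\<zero> \<ominus> l gs)) gs"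
        if gs: "length gs = Suc n" "set gs \<subseteq> carrier G" for gs
        using cob_add_on[OF G.subgroup_self x(2) y(2) gs] x(3)[OF gs] y(3)[OF gs] x(1) y(1) fR[OF gs]
        by (simp add: l_distr)
      ultimately show "x \<oplus>\<^bsub>A\<^esub> y \<in> annihilator n f" unfolding annihilator_iff[OF f] using x(1) y(1) by auto
    next
      fix a assume a: "a \<in> carrier A"
      have "cc n (carrier R) (\<lambda>gs. a \<otimes> k gs)" using cochain_scale[OF in_A_carrier[OF a] x(2)] .
      moreover have "(a \<otimes> x) \<otimes> f gs = cob (\<lambda>gs. a \<otimes> k gs) gs"
        if gs: "length gs = Suc n" "set gs \<subseteq> carrier G" for gs
        using cob_scale[OF a x(2) gs] x(3)[OF gs] x(1) a fR[OF gs] by (simp add: m_assoc)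
      ultimately show "a \<otimes>\<^bsub>A\<^esub> x \<in> annihilator n f" unfolding annihilator_iff[OF f] using x(1) a by auto
    }
  qed
qed

theorem annihilator_height:
  assumes p: "Factorial_Ring.prime (p :: nat)" and char: "add_pow R p \<one> = \<zero>"
    and P: "subgroup P G" "card P = p ^ e" "\<not> p dvd card (lcosets\<^bsub>G\<^esub> P)"
    and f: "cocycle_mod (Suc n) {\<zero>} f"
    and res: "\<And>H. subgroup H G \<Longrightarrow> H \<subseteq> P \<Longrightarrow>
      height R (augmentation_ideal R \<phi> H) \<le> enat (Suc n) + 1 \<Longrightarrow>
      \<exists>k. cochain H n (carrier R) k \<and> (\<forall>gs. length gs = Suc n \<longrightarrow> set gs \<subseteq> H \<longrightarrow> f gs = cob k gs)"
    and q: "primeideal q R" and sub: "annihilator n f \<subseteq> q"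
  shows "enat (Suc n + 2) \<le> prime_height R q"
proof -
  interpret q: primeideal q R by fact
  have fc: "cc (Suc n) (carrier R) f" "cc (Suc (Suc n)) {\<zero>} (cob f)" using f unfolding cocycle_mod_def by auto
  have I: "subgroup (inertia q) G" by (rule inertia_subgroup[OF q])
  obtain g m where g: "g \<in> carrier G"
    "card (inertia q) = card {x \<in> P. g \<otimes>\<^bsub>G\<^esub> x \<otimes>\<^bsub>G\<^esub> inv\<^bsub>G\<^esub> g \<in> inertia q} * m" "\<not> p dvd m"
    using G.coset_index[OF finite_G I P(1) p P(3)] by blast
  \<comment> \<open>Conjugating the prime instead of the Sylow group brings a subgroup of
    \<open>inertia q'\<close> of index prime to \<open>p\<close> inside the given
    \<open>P\<close>.\<close>
  define q' where "q' = act_preimage g q"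
  have q': "primeideal q' R" unfolding q'_def by (rule act_preimage_prime[OF q g(1)])
  interpret q': primeideal q' R by (rule q')
  define H where "H = P \<inter> inertia q'"
  have PG: "P \<subseteq> carrier G" using subgroup.subset[OF P(1)] .
  have Heq: "H = {x \<in> P. g \<otimes>\<^bsub>G\<^esub> x \<otimes>\<^bsub>G\<^esub> inv\<^bsub>G\<^esub> g \<in> inertia q}"
    unfolding H_def q'_def inertia_act_preimage[OF q g(1)] using PG by blast
  have H: "subgroup H G" unfolding H_def using P(1) inertia_subgroup[OF q'] by (rule G.subgroups_Inter_pair)
  have cardI: "card (inertia q') = card H * m"
    using g(2) card_inertia_act_preimage[OF q g(1)] unfolding Heq q'_def by simp
  have "card H dvd card P"
  proof -
    have "subgroup H (on P)" using H P(1) H_def by (intro G.subgroup_incl) auto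
    then have "card (rcosets\<^bsub>on P\<^esub> H) * card H = order (on P)"
      using group.lagrange[OF subgroup.subgroup_is_group[OF P(1) G.is_group]] by blast
    then show ?thesis unfolding order_def by simp (metis dvd_triv_right)
  qed
  then obtain i where cardH: "card H = p ^ i" using divides_primepow_nat[OF p, of "card H" e] P(2) by auto
  obtain T where T: "G.transversal H T" using G.exists_transversal[OF H] by blast
  obtain s where s: "s \<in> carrier R" "(\<Oplus>t\<in>T. \<phi> t (\<Otimes>h\<in>H. \<phi> h s)) \<notin> q'"
    using trace_norm_not_in_prime[OF p char q' H _ cardH cardI g(3) T] H_def by blast
  define r where "r = (\<Otimes>h\<in>H. \<phi> h s)"
  have r: "r \<in> carrier R" "\<And>h. h \<in> H \<Longrightarrow> \<phi> h r = r"
    unfolding r_def using s(1) subgroup.subset[OF H] subgroup_norm_invariant[OF H s(1)]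
    by (auto intro!: finprod_closed)
  have trA: "(\<Oplus>t\<in>T. \<phi> t r) \<in> carrier A" by (rule trace_invariant[OF H T r])
  have "\<not> height R (augmentation_ideal R \<phi> H) \<le> enat (Suc n) + 1"
  proof
    assume "height R (augmentation_ideal R \<phi> H) \<le> enat (Suc n) + 1"
    then obtain k where k: "cochain H n (carrier R) k"
      "\<And>gs. length gs = Suc n \<Longrightarrow> set gs \<subseteq> H \<Longrightarrow> f gs = cob k gs"
      using res[OF H] H_def by blast
    have coc: "cob f gs = \<zero>" if "length gs = Suc (Suc n)" "set gs \<subseteq> carrier G" for gs
      using cochainD[OF fc(2) that] by simp
    obtain e' where "cc n (carrier R) e'"
      "\<And>gs. length gs = Suc n \<Longrightarrow> set gs \<subseteq> carrier G \<Longrightarrow> cob e' gs = (\<Oplus>t\<in>T. \<phi> t r) \<otimes> f gs"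
      using trace_annihilates[OF H T r fc(1) coc k] by blast
    then have "(\<Oplus>t\<in>T. \<phi> t r) \<in> annihilator n f"
      unfolding annihilator_iff[OF fc(1)] using trA by metis
    \<comment> \<open>The trace is invariant, and conjugate primes have the same invariants; so
      membership in \<open>q\<close> passes to \<open>q'\<close>.\<close>
    then have "(\<Oplus>t\<in>T. \<phi> t r) \<in> q'"
      using sub trA act_preimage_contraction[OF q g(1)] unfolding q'_def by blast
    then show False using s(2) unfolding r_def by blast
  qed
  then have "enat (Suc n) + 1 < height R (augmentation_ideal R \<phi> H)" by simp
  then have "enat (Suc n + 2) \<le> height R (augmentation_ideal R \<phi> H)"
    by (metis Suc_1 add_Suc_right eSuc_enat ileI1 one_enat_def plus_enat_simps(1) plus_1_eq_Suc add.commute)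
  also have "\<dots> \<le> prime_height R q'"
    unfolding height_def
  proof (rule INF_lower)
    have "augmentation_ideal R \<phi> H \<subseteq> q'"
      unfolding augmentation_ideal_def
      using H_def by (intro genideal_minimal q'.is_ideal) (auto simp: inertia_def)
    then show "q' \<in> {q. primeideal q R \<and> augmentation_ideal R \<phi> H \<subseteq> q}" using q' by blast
  qed
  also have "\<dots> \<le> prime_height R q" unfolding q'_def by (rule act_preimage_height[OF q g(1)])
  finally show ?thesis .
qed

theorem coboundary_if_restrictions_vanish:
  assumes CM: "cohen_macaulay R" "cohen_macaulay A"
    and p: "Factorial_Ring.prime (p :: nat)" and char: "add_pow R p \<one> = \<zero>"
    and P: "subgroup P G" "card P = p ^ e" "\<not> p dvd card (lcosets\<^bsub>G\<^esub> P)"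
    and f: "cocycle_mod (Suc n) {\<zero>} f"
    and van: "\<And>j u. j < n \<Longrightarrow> cocycle_mod (Suc j) {\<zero>} u \<Longrightarrow> coboundary_mod j {\<zero>} u"
    and res: "\<And>H. subgroup H G \<Longrightarrow> H \<subseteq> P \<Longrightarrow>
      height R (augmentation_ideal R \<phi> H) \<le> enat (Suc n) + 1 \<Longrightarrow>
      \<exists>k. cochain H n (carrier R) k \<and> (\<forall>gs. length gs = Suc n \<longrightarrow> set gs \<subseteq> H \<longrightarrow> f gs = cob k gs)"
  shows "coboundary_mod n {\<zero>} f"
proof -
  define J where "J = annihilator n f"
  have fc: "cc (Suc n) (carrier R) f" using f unfolding cocycle_mod_def by auto
  have J: "ideal J A" unfolding J_def by (rule annihilator_ideal_A[OF fc])
  have JA: "J \<subseteq> carrier A" unfolding J_def annihilator_def by blast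
  have hR: "enat (Suc n + 2) \<le> prime_height R q" if "primeideal q R" "J \<subseteq> q" for q
    using annihilator_height[OF p char P f res that(1)] that(2) unfolding J_def by blast
  \<comment> \<open>A prime of \<open>A\<close> over \<open>J\<close> is the contraction of some
    \<open>q\<close>, which then contains \<open>J\<close> and has large height; contraction does
    not lower it.\<close>
  have hA: "enat (Suc n + 2) \<le> prime_height A p'" if p': "primeideal p' A" "J \<subseteq> p'" for p'
  proof -
    have "noetherian_ring R" using CM(1) unfolding cohen_macaulay_def by blast
    then obtain q where q: "primeideal q R" "q \<inter> carrier A = p'" using lying_over[OF _ p'(1)] by blast
    have "enat (Suc n + 2) \<le> prime_height R q" using hR[OF q(1)] p'(2) q(2) by blast
    also have "\<dots> \<le> prime_height A p'" using height_le_contraction_height[OF q(1)] q(2) by simp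
    finally show ?thesis .
  qed
  obtain bs where bs: "length bs = Suc n + 2" "set bs \<subseteq> J" "weakly_regular R {\<zero>} bs" "weakly_regular A {\<zero>} bs"
    using exists_regular_sequence[OF CM J hA hR order_refl] by blast
  define as where "as = take (Suc n) bs"
  have split: "bs = as @ [bs ! Suc n, bs ! Suc (Suc n)]"
    unfolding as_def using bs(1)
    by (intro nth_equalityI) (auto simp: nth_append less_Suc_eq)
  show ?thesis
  proof (rule no_annihilating_regular_sequence[OF stable_zero JA, of as n "bs ! Suc n" "bs ! Suc (Suc n)"])
    show "length as = Suc n" unfolding as_def using bs(1) by simp
    show "set as \<subseteq> J" unfolding as_def using bs(2) set_take_subset[of "Suc n" bs] by blast
    show "bs ! Suc n \<in> J" "bs ! Suc (Suc n) \<in> J" using bs(1,2) by (auto simp: subset_iff)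
    show "weakly_regular R {\<zero>} (as @ [bs ! Suc n, bs ! Suc (Suc n)])" using bs(3) split by simp
    have "{\<zero>} \<inter> carrier A = {\<zero>}" by auto
    then show "weakly_regular A ({\<zero>} \<inter> carrier A) (as @ [bs ! Suc n, bs ! Suc (Suc n)])"
      using bs(4) split by simp
    \<comment> \<open>In degree 0 a cocycle is an invariant element, so it is its own lift.\<close>
    show "invariants_lift {\<zero>}"
      unfolding invariants_lift_def
    proof (intro allI impI)
      fix y assume "cocycle_mod 0 {\<zero>} y"
      then have y: "y [] \<in> carrier R" "cc (Suc 0) {\<zero>} (cob y)" unfolding cocycle_mod_def cochain_def by auto
      have "\<phi> g (y []) = y []" if g: "g \<in> carrier G" for g
        using cochainD[OF y(2), of "[g]"] g y(1) minus_zero_iff[of "\<phi> g (y [])" "y []"]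
        by (simp add: a_minus_def)
      then have "y [] \<in> carrier A" unfolding carrier_A using y(1) by blast
      then show "\<exists>c \<in> carrier A. y [] \<ominus> c \<in> {\<zero>}" using minus_zero_iff y(1) by blast
    qed
    show "coboundary_mod n {\<zero>} (\<lambda>gs. b \<otimes> f gs)" if "b \<in> J" for b
      using that unfolding J_def annihilator_def by blast
  qed (use van f in auto)
qed

text \<open>The additive group of \<open>K\<close> has order \<open>p\<close>, so \<open>p\<close>
  times any of its elements vanishes, in particular \<open>p\<close> times
  \<open>\<one>\<close>.\<close>

lemma char_of_subfield:
  assumes K: "subfield K R" "card K = p" and p: "p > 0"
  shows "add_pow R p \<one> = \<zero>"
proof -
  have "subring K R" using subfieldE(1)[OF K(1)] .
  then have "subgroup K (add_monoid R)" unfolding subring_def by blast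
  then have gr: "group ((add_monoid R)\<lparr>carrier := K\<rparr>)"
    using subgroup.subgroup_is_group add.is_group by blast
  have "\<one> \<in> K" using subringE(3)[OF \<open>subring K R\<close>] .
  then have "\<one> [^]\<^bsub>(add_monoid R)\<lparr>carrier := K\<rparr>\<^esub> order ((add_monoid R)\<lparr>carrier := K\<rparr>) =
      \<one>\<^bsub>(add_monoid R)\<lparr>carrier := K\<rparr>\<^esub>"
    using group.pow_order_eq_1[OF gr] by simp
  then show ?thesis using K(2) by (simp add: order_def add_pow_def nat_pow_def)
qed

end

theorem proposition5p1:
  fixes G :: "('g, 'b) monoid_scheme" and R :: "('r, 'm) ring_scheme"
    and \<phi> :: "'g \<Rightarrow> 'r \<Rightarrow> 'r" and p :: nat and P :: "'g set" and \<mu> :: enat and \<P> :: "'g set set"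
  assumes "group G" and "finite (carrier G)"
    and "ring_action G R \<phi>"
    and "Factorial_Ring.prime p"
    and "\<exists>K. subfield K R \<and> card K = p"
    and "noetherian_module (invariant_ring G R \<phi>) (ring_as_module R)"
    and "sylow_subgroup p P G"
    and "\<mu> = (INF r \<in> {r. 0 < r \<and> carrier (cohomology G R \<phi> r) \<noteq> {\<one>\<^bsub>cohomology G R \<phi> r\<^esub>}}. enat r)"
    and "\<P> = {P'. subgroup P' G \<and> P' \<subseteq> P \<and> height R (augmentation_ideal R \<phi> P') \<le> \<mu> + 1}"
    and "cohen_macaulay R" and "cohen_macaulay (invariant_ring G R \<phi>)"
    and "\<mu> < \<infinity>"
  shows "inj_on (res_family G R \<phi> (the_enat \<mu>) \<P>) (carrier (cohomology G R \<phi> (the_enat \<mu>)))"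
proof -
  have "cring R" using assms(10) unfolding cohen_macaulay_def by blast
  then interpret finite_ring_action R G \<phi>
    using assms(1-3) by (simp add: finite_ring_action_def finite_ring_action_axioms_def)
  define D where "D = {r. 0 < r \<and> carrier (cohomology G R \<phi> r) \<noteq> {\<one>\<^bsub>cohomology G R \<phi> r\<^esub>}}"
  have \<mu>: "\<mu> = (INF r \<in> D. enat r)" using assms(8) unfolding D_def .
  \<comment> \<open>Finiteness of \<open>\<mu>\<close> excludes the infimum of the empty set, so
    \<open>\<mu>\<close> is attained; being positive it has the form \<open>Suc n\<close>.\<close>
  have "D \<noteq> {}" using assms(12) unfolding \<mu> by (auto simp: top_enat_def)
  then obtain d where "enat d \<in> enat ` D" by blast
  then have "\<mu> \<in> enat ` D" unfolding \<mu> by (rule wellorder_InfI)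
  then obtain r where r: "r \<in> D" "\<mu> = enat r" by blast
  then obtain n where n: "r = Suc n" unfolding D_def using gr0_implies_Suc by blast
  have minimal: "Suc n \<le> j" if "j \<in> D" for j
  proof -
    have "\<mu> \<le> enat j" unfolding \<mu> using that by (rule INF_lower)
    then show ?thesis using r(2) n by simp
  qed
  have van: "coboundary_mod j {\<zero>\<^bsub>R\<^esub>} u" if "j < n" "cocycle_mod (Suc j) {\<zero>\<^bsub>R\<^esub>} u" for j u
  proof (rule trivial_cohomology[OF _ that(2)])
    have "Suc j \<notin> D" using minimal[of "Suc j"] that(1) by auto
    then show "carrier (cohomology G R \<phi> (Suc j)) = {\<one>\<^bsub>cohomology G R \<phi> (Suc j)\<^esub>}" unfolding D_def by simp
  qed
  have P: "subgroup P G" "card P = p ^ multiplicity p (order G)"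
    using assms(7) unfolding sylow_subgroup_def by auto
  have "\<not> p dvd card (lcosets\<^bsub>G\<^esub> P)"
  proof
    assume "p dvd card (lcosets\<^bsub>G\<^esub> P)"
    then have "p ^ Suc (multiplicity p (order G)) dvd card (lcosets\<^bsub>G\<^esub> P) * card P"
      using P(2) by simp
    also have "card (lcosets\<^bsub>G\<^esub> P) * card P = order G" using G.l_lagrange[OF assms(2) P(1)] .
    finally have "p ^ Suc (multiplicity p (order G)) dvd order G" .
    moreover have "order G \<noteq> 0" using G.order_gt_0_iff_finite assms(2) by simp
    ultimately show False
      using power_dvd_iff_le_multiplicity[of "order G" p "Suc (multiplicity p (order G))"]
        prime_gt_1_nat[OF assms(4)] by simp
  qed
  note P = P this
  have char: "add_pow R p \<one>\<^bsub>R\<^esub> = \<zero>\<^bsub>R\<^esub>"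
    using assms(4,5) char_of_subfield prime_gt_0_nat by blast
  show ?thesis
    unfolding r(2) n the_enat.simps
  proof (rule inj_onI)
    fix C D
    assume C: "C \<in> carrier (cohomology G R \<phi> (Suc n))" "D \<in> carrier (cohomology G R \<phi> (Suc n))"
      and eq: "res_family G R \<phi> (Suc n) \<P> C = res_family G R \<phi> (Suc n) \<P> D"
    obtain f g where f: "f \<in> cocycles G R \<phi> (Suc n)" "C = coset (Suc n) f"
      and g: "g \<in> cocycles G R \<phi> (Suc n)" "D = coset (Suc n) g"
      using C unfolding carrier_cohomology by blast
    \<comment> \<open>Injectivity is tested on the difference of two representatives: it restricts
      to coboundaries on all members of \<open>\<P>\<close>, so it must be a coboundary on
      \<open>G\<close>.\<close>
    define h where "h gs = f gs \<ominus>\<^bsub>R\<^esub> g gs" for gs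
    have fg: "cc (Suc n) (carrier R) f" "cc (Suc (Suc n)) {\<zero>\<^bsub>R\<^esub>} (cob f)"
      "cc (Suc n) (carrier R) g" "cc (Suc (Suc n)) {\<zero>\<^bsub>R\<^esub>} (cob g)"
      using f(1) g(1) unfolding cocycles_iff cocycle_mod_def by auto
    have "cocycle_mod (Suc n) {\<zero>\<^bsub>R\<^esub>} h"
      unfolding cocycle_mod_def
    proof
      show "cc (Suc n) (carrier R) h" unfolding h_def by (rule cochain_diff[OF fg(1,3)])
      have "cob h gs = \<zero>\<^bsub>R\<^esub>" if gs: "length gs = Suc (Suc n)" "set gs \<subseteq> carrier G" for gs
        unfolding h_def using cob_diff[OF fg(1,3) gs] cochainD[OF fg(2) gs] cochainD[OF fg(4) gs]
        by (simp add: a_minus_def)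
      then show "cc (Suc (Suc n)) {\<zero>\<^bsub>R\<^esub>} (cob h)" unfolding cochain_def by blast
    qed
    moreover have "\<exists>k. cochain H n (carrier R) k \<and> (\<forall>gs. length gs = Suc n \<longrightarrow> set gs \<subseteq> H \<longrightarrow> h gs = cob k gs)"
      if H: "subgroup H G" "H \<subseteq> P" "height R (augmentation_ideal R \<phi> H) \<le> enat (Suc n) + 1" for H
    proof -
      have "H \<in> \<P>" unfolding assms(9) using H r(2) n by simp
      then have "res G R \<phi> (Suc n) H C = res G R \<phi> (Suc n) H D"
        using fun_cong[OF eq, of H] unfolding res_family_def by simp
      then show ?thesis using restriction_agrees[OF f(1) g(1) H(1)] f(2) g(2) unfolding h_def by blast
    qed
    ultimately have "coboundary_mod n {\<zero>\<^bsub>R\<^esub>} h"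
      using coboundary_if_restrictions_vanish[OF assms(10,11,4) char P _ van] by blast
    then show "C = D" using coset_eq[OF f(1) g(1)] f(2) g(2) unfolding h_def by blast
  qed
qed

end
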